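(* For each $k\in\{3,4,5\}$, there exists $b^{\mathsf H}_k\in(0,1)$ such that, for any $b\in(b^{\mathsf H}_k,1]$, there exists a tiling of $T(1,b)$ by $k$ hexagons that satisfies the equal angle meeting property; denoting by $H_k(b)$ the corresponding tiling domain (the hexagon to which all the domains of the tiling are isometric), one has $$\mathfrak L_k(T(1,b))\le\min\left(k^2\pi^2,\lambda_1(H_k(b))\right)\qquad\text{for all } b\in(b^{\mathsf H}_k,1].$$ More explicitly, one can choose $$b^{\mathsf H}_3=\frac{\sqrt{11}-\sqrt3}{4},\qquad b^{\mathsf H}_4=\frac1{2\sqrt3}<\frac12,\qquad b^{\mathsf H}_5=\frac{\sqrt{291}-5\sqrt3}{36}.$$
   Context: For $b\in(0,1]$, let $T(1,b)=(\mathbb R/\mathbb Z)\times(\mathbb R/b\mathbb Z)$ be the flat torus. For an open set $\omega$ in $T(1,b)$ or $\mathbb R^2$, $\lambda_1(\omega)$ denotes the first eigenvalue of the Laplacian $-\Delta$ on $\omega$ with Dirichlet boundary conditions. A $k$-partition of $T(1,b)$ is a family $\mathcal D=(D_i)_{1\le i\le k}$ of open, connected, mutually disjoint (nonempty) subsets of $T(1,b)$; its energy is $\Lambda_k(\mathcal D)=\max_i\lambda_1(D_i)$, and $\mathfrak L_k(T(1,b))=\inf_{\mathcal D}\Lambda_k(\mathcal D)$ over all $k$-partitions. A $k$-partition is strong if $T(1,b)=\bigcup_i\overline{D_i}$; its boundary is then $N(\mathcal D)=\bigcup_i\partial D_i$. It is regular if $N(\mathcal D)$ is locally a regular curve except at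 finitely many singular points, where finitely many half-curves meet with equal angles (the equal angle meeting property). A tiling of $T(1,b)$ by $k$ hexagons satisfying the equal angle meeting property is a strong regular $k$-partition of $T(1,b)$ all of whose domains are isometric to one and the same (open) plane hexagon $H$, each domain being the injective image of a copy of $H$ in $\mathbb R^2$ under the projection $\mathbb R^2\to T(1,b)$; for such a tiling the equal angle meeting property is equivalent to the fact that all interior angles of $H$ are $2\pi/3$. *)

theory Defs
  imports "HOL-Analysis.Analysis"
begin

type_synonym plane = "real \<times> real"

section \<open>The flat torus\<close>

text \<open>The torus \<open>T(1,b)\<close> is the quotient of the plane by the lattice \<open>\<int> \<times> b\<int>\<close>; its points are the
  cosets of the lattice, and it carries the quotient topology.\<close>

definition torus_proj :: "real \<Rightarrow> plane \<Rightarrow> plane set" where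
  "torus_proj b x = {x + (of_int m, of_int n * b) | m n. True}"

definition torus :: "real \<Rightarrow> plane set topology" where
  "torus b = topology (\<lambda>U. U \<subseteq> range (torus_proj b) \<and> open (torus_proj b -` U))"

lemma openin_torus:
  "openin (torus b) U \<longleftrightarrow> U \<subseteq> range (torus_proj b) \<and> open (torus_proj b -` U)"
proof -
  let ?L = "\<lambda>U. U \<subseteq> range (torus_proj b) \<and> open (torus_proj b -` U)"
  have "?L (S \<inter> T)" if "?L S" "?L T" for S T
    using that open_Int by (metis le_infI1 vimage_Int)
  moreover have "?L (\<Union>K)" if "\<forall>S\<in>K. ?L S" for K
  proof -
    have "torus_proj b -` \<Union>K = (\<Union>S\<in>K. torus_proj b -` S)"
      by (rule vimage_Union)
    then show ?thesis
      using that by (simp add: Sup_le_iff open_UN)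
  qed
  ultimately have "istopology ?L"
    unfolding istopology_def by blast
  then show ?thesis
    by (simp add: torus_def)
qed

lemma topspace_torus: "topspace (torus b) = range (torus_proj b)"
proof -
  have "torus_proj b -` range (torus_proj b) = UNIV"
    by blast
  then have "openin (torus b) (range (torus_proj b))"
    by (simp add: openin_torus)
  then show ?thesis
    by (meson openin_subset openin_topspace openin_torus subset_antisym)
qed

section \<open>The first Dirichlet eigenvalue\<close>

text \<open>
  The plane and the torus are treated uniformly: \<open>X\<close> is the surface, \<open>p\<close> the projection of the plane
  onto it, and \<open>F\<close> a measurable fundamental domain of \<open>p\<close>. Functions on the surface are
  differentiated by means of their lifts along \<open>p\<close>, and integration over \<open>\<omega>\<close> is integration over
  \<open>F \<inter> p -` \<omega>\<close>. The space \<open>H\<^sup>1\<^sub>0(\<omega>)\<close> is the closure in \<open>H\<^sup>1(\<omega>)\<close> of the compactly supported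
  continuously differentiable functions on \<open>\<omega>\<close> (which is also the closure of the
  compactly supported smooth functions).
\<close>

definition grad :: "(plane \<Rightarrow> real) \<Rightarrow> plane \<Rightarrow> plane" where
  "grad f x = (THE D. GDERIV f x :> D)"

definition test_functions ::
    "'a topology \<Rightarrow> (plane \<Rightarrow> 'a) \<Rightarrow> 'a set \<Rightarrow> ('a \<Rightarrow> real) set" where
  "test_functions X p \<omega> = {\<phi>.
     (\<exists>g. continuous_on UNIV g \<and> (\<forall>x. GDERIV (\<phi> \<circ> p) x :> g x)) \<and>
     compactin X (X closure_of {x. \<phi> x \<noteq> 0}) \<and>
     X closure_of {x. \<phi> x \<noteq> 0} \<subseteq> \<omega>}"

definition surface_measure :: "plane set \<Rightarrow> (plane \<Rightarrow> 'a) \<Rightarrow> 'a set \<Rightarrow> plane measure" where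
  "surface_measure F p \<omega> = restrict_space lborel (F \<inter> p -` \<omega>)"

definition L2_function :: "plane measure \<Rightarrow> (plane \<Rightarrow> 'b::euclidean_space) \<Rightarrow> bool" where
  "L2_function M f \<longleftrightarrow> f \<in> borel_measurable M \<and> integrable M (\<lambda>x. (norm (f x))\<^sup>2)"

text \<open>\<open>H10 X p F \<omega> u g\<close>: the function \<open>u\<close> belongs to \<open>H\<^sup>1\<^sub>0(\<omega>)\<close> and \<open>g\<close> is its weak gradient. Both are
  given on \<open>F \<inter> p -` \<omega>\<close>, which represents \<open>\<omega>\<close>; their values elsewhere are irrelevant.\<close>

definition H10 ::
    "'a topology \<Rightarrow> (plane \<Rightarrow> 'a) \<Rightarrow> plane set \<Rightarrow> 'a set \<Rightarrow>
     (plane \<Rightarrow> real) \<Rightarrow> (plane \<Rightarrow> plane) \<Rightarrow> bool" where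
  "H10 X p F \<omega> u g \<longleftrightarrow>
     (let M = surface_measure F p \<omega> in
      L2_function M u \<and> L2_function M g \<and>
      (\<exists>\<phi> :: nat \<Rightarrow> 'a \<Rightarrow> real. (\<forall>n. \<phi> n \<in> test_functions X p \<omega>) \<and>
         (\<lambda>n. \<integral>x. (\<phi> n (p x) - u x)\<^sup>2 \<partial>M) \<longlonglongrightarrow> 0 \<and>
         (\<lambda>n. \<integral>x. (norm (grad (\<phi> n \<circ> p) x - g x))\<^sup>2 \<partial>M) \<longlonglongrightarrow> 0))"

definition dirichlet_eigenvalue ::
    "'a topology \<Rightarrow> (plane \<Rightarrow> 'a) \<Rightarrow> plane set \<Rightarrow> 'a set \<Rightarrow> real \<Rightarrow> bool" where
  "dirichlet_eigenvalue X p F \<omega> \<mu> \<longleftrightarrow>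
     (let M = surface_measure F p \<omega> in
      \<exists>u g. H10 X p F \<omega> u g \<and> \<not> (AE x in M. u x = 0) \<and>
        (\<forall>\<phi> \<in> test_functions X p \<omega>.
           (\<integral>x. g x \<bullet> grad (\<phi> \<circ> p) x \<partial>M) = \<mu> * (\<integral>x. u x * \<phi> (p x) \<partial>M)))"

definition first_eigenvalue ::
    "'a topology \<Rightarrow> (plane \<Rightarrow> 'a) \<Rightarrow> plane set \<Rightarrow> 'a set \<Rightarrow> real" where
  "first_eigenvalue X p F \<omega> = Inf {\<mu>. dirichlet_eigenvalue X p F \<omega> \<mu>}"

definition lambda1_plane :: "plane set \<Rightarrow> real" where
  "lambda1_plane \<omega> = first_eigenvalue euclidean (\<lambda>x. x) UNIV \<omega>"

definition lambda1_torus :: "real \<Rightarrow> plane set set \<Rightarrow> real" where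
  "lambda1_torus b \<omega> = first_eigenvalue (torus b) (torus_proj b) ({0..<1} \<times> {0..<b}) \<omega>"

section \<open>Partitions\<close>

definition partition_of_torus :: "real \<Rightarrow> nat \<Rightarrow> (nat \<Rightarrow> plane set set) \<Rightarrow> bool" where
  "partition_of_torus b k D \<longleftrightarrow>
     (\<forall>i\<in>{1..k}. openin (torus b) (D i) \<and> connectedin (torus b) (D i) \<and> D i \<noteq> {}) \<and>
     disjoint_family_on D {1..k}"

definition energy :: "real \<Rightarrow> nat \<Rightarrow> (nat \<Rightarrow> plane set set) \<Rightarrow> real" where
  "energy b k D = Max ((\<lambda>i. lambda1_torus b (D i)) ` {1..k})"

definition minimal_energy :: "nat \<Rightarrow> real \<Rightarrow> real" where
  "minimal_energy k b = Inf {energy b k D | D. partition_of_torus b k D}"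

definition strong_partition :: "real \<Rightarrow> nat \<Rightarrow> (nat \<Rightarrow> plane set set) \<Rightarrow> bool" where
  "strong_partition b k D \<longleftrightarrow> partition_of_torus b k D \<and>
     topspace (torus b) = (\<Union>i\<in>{1..k}. torus b closure_of D i)"

definition boundary_set :: "real \<Rightarrow> nat \<Rightarrow> (nat \<Rightarrow> plane set set) \<Rightarrow> plane set set" where
  "boundary_set b k D = (\<Union>i\<in>{1..k}. torus b frontier_of D i)"

text \<open>\<open>d n\<close> is the derivative of order \<open>n\<close> of \<open>\<gamma>\<close> on the interval \<open>I\<close>, one-sided at the end points.\<close>

definition regular_arc :: "(real \<Rightarrow> plane) \<Rightarrow> real set \<Rightarrow> bool" where
  "regular_arc \<gamma> I \<longleftrightarrow> inj_on \<gamma> I \<and>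
     (\<exists>d :: nat \<Rightarrow> real \<Rightarrow> plane. d 0 = \<gamma> \<and>
        (\<forall>n. \<forall>t\<in>I. (d n has_vector_derivative d (Suc n) t) (at t within I)) \<and>
        (\<forall>t\<in>I. d 1 t \<noteq> 0))"

definition regular_curve_near :: "plane set \<Rightarrow> plane \<Rightarrow> bool" where
  "regular_curve_near N x \<longleftrightarrow>
     (\<exists>\<gamma> r. regular_arc \<gamma> {-1..1} \<and> \<gamma> 0 = x \<and> r > 0 \<and>
        N \<inter> ball x r = \<gamma> ` {-1..1} \<inter> ball x r)"

text \<open>Near \<open>x\<close> the set \<open>N\<close> consists of \<open>m\<close> half-curves issuing from \<open>x\<close> and otherwise disjoint, whose
  tangent directions at \<open>x\<close> are equally spaced.\<close>

definition equal_angle_meeting_at :: "plane set \<Rightarrow> plane \<Rightarrow> bool" where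
  "equal_angle_meeting_at N x \<longleftrightarrow>
     (\<exists>(m::nat) (\<gamma> :: nat \<Rightarrow> real \<Rightarrow> plane) \<theta> r. m \<ge> 2 \<and> r > 0 \<and>
        (\<forall>j<m. regular_arc (\<gamma> j) {0..1} \<and> \<gamma> j 0 = x) \<and>
        (\<forall>i<m. \<forall>j<m. i \<noteq> j \<longrightarrow> \<gamma> i ` {0..1} \<inter> \<gamma> j ` {0..1} = {x}) \<and>
        N \<inter> ball x r = (\<Union>j<m. \<gamma> j ` {0..1}) \<inter> ball x r \<and>
        (\<forall>j<m. \<exists>s>0. (\<gamma> j has_vector_derivative
            s *\<^sub>R (cos (\<theta> + 2 * pi * real j / real m), sin (\<theta> + 2 * pi * real j / real m)))
            (at 0 within {0..1})))"

text \<open>Since the projection is a local isometry, the local structure of \<open>N(D)\<close> is that of its preimage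
  in the plane.\<close>

definition regular_partition :: "real \<Rightarrow> nat \<Rightarrow> (nat \<Rightarrow> plane set set) \<Rightarrow> bool" where
  "regular_partition b k D \<longleftrightarrow>
     (\<exists>S. finite S \<and> S \<subseteq> boundary_set b k D \<and>
        (\<forall>x. torus_proj b x \<in> boundary_set b k D - S \<longrightarrow>
               regular_curve_near (torus_proj b -` boundary_set b k D) x) \<and>
        (\<forall>x. torus_proj b x \<in> S \<longrightarrow>
               equal_angle_meeting_at (torus_proj b -` boundary_set b k D) x))"

section \<open>Hexagonal tilings\<close>

text \<open>An open hexagon is the region enclosed by a simple closed polygon with six vertices; three
  consecutive vertices are not aligned, so that all six are genuine vertices.\<close>

definition open_hexagon :: "plane set \<Rightarrow> bool" where
  "open_hexagon H \<longleftrightarrow>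
     (\<exists>v :: nat \<Rightarrow> plane.
        let P = linepath (v 0) (v 1) +++ linepath (v 1) (v 2) +++ linepath (v 2) (v 3) +++
                linepath (v 3) (v 4) +++ linepath (v 4) (v 5) +++ linepath (v 5) (v 0)
        in simple_path P \<and> H = inside (path_image P) \<and>
           (\<forall>i<6. \<not> collinear {v i, v ((i + 1) mod 6), v ((i + 2) mod 6)}))"

definition hexagonal_tiling ::
    "real \<Rightarrow> nat \<Rightarrow> (nat \<Rightarrow> plane set set) \<Rightarrow> plane set \<Rightarrow> bool" where
  "hexagonal_tiling b k D H \<longleftrightarrow>
     strong_partition b k D \<and> regular_partition b k D \<and> open_hexagon H \<and>
     (\<forall>i\<in>{1..k}. \<exists>f :: plane \<Rightarrow> plane. (\<forall>x y. dist (f x) (f y) = dist x y) \<and>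
        inj_on (torus_proj b) (f ` H) \<and> D i = torus_proj b ` f ` H)"

end

theory Submission
  imports Defs
begin

text \<open>
  Both bounds come from explicit partitions. The torus is cut by vertical lines into \<open>k\<close> strips of
  width \<open>1/k\<close>, on which \<open>sin (k * pi * x)\<close>, suitably translated, is a Dirichlet eigenfunction; this
  gives \<open>k\<^sup>2 * pi\<^sup>2\<close> (\<open>minimal_energy_le_strips\<close>).

  The hexagons come from a lattice \<open>L\<close> that contains \<open>\<int> \<times> b\<int>\<close> with index \<open>k\<close>. Write \<open>k = p + q\<close> with
  \<open>(p, q)\<close> one of \<open>(1, 2)\<close>, \<open>(2, 2)\<close>, \<open>(2, 3)\<close>, and let \<open>L\<close> be generated by \<open>W1 = (-1/k, q * b/k)\<close>
  and \<open>W2 = (1/k, p * b/k)\<close>; then \<open>W1 + W2 = (0, b)\<close> and \<open>q * W2 - p * W1 = (1, 0)\<close>. If the triangle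
  with sides \<open>W1\<close> and \<open>W2\<close> issuing from one vertex has all its angles less than \<open>2 * pi/3\<close>, then it has a
  Fermat point, from which its vertices \<open>P0, P1, P2\<close> are seen under equal angles (\<open>fermat_point\<close>). The
  tripod that joins the Fermat point to the three vertices, translated by all of \<open>L\<close>, is a honeycomb:
  edges meet by threes with angles \<open>2 * pi/3\<close>, and the complement consists of the translates by \<open>L\<close> of
  a single hexagon \<open>H\<close>. Modulo \<open>\<int> \<times> b\<int>\<close> there remain \<open>k\<close> of these. The critical angle is the one
  between \<open>W1\<close> and \<open>W2\<close>, and it is less than \<open>2 * pi/3\<close> exactly if
  \<open>sqrt 3 * (p * q * b\<^sup>2 - 1) + k * b > 0\<close>; the threshold for \<open>b\<close> is the positive root of this
  quadratic polynomial.

  That the translates of \<open>H\<close> tile the plane is linear algebra in the coordinates with respect to two of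
  the edge directions: \<open>H\<close> is cut out by bounds on the two coordinates and on their difference. These
  bounds are too narrow for two points of \<open>H\<close> to differ by a nonzero lattice vector
  (\<open>cells_disjoint\<close>), and every point satisfies them, in their non-strict form, after a translation
  (\<open>cells_cover\<close>). The local structure of the boundary follows from the fact that two edges
  of the honeycomb meet in common end points only (\<open>edges_meet\<close>).

  It remains to compare energies. The projection to the torus is injective on each hexagon, so an
  eigenfunction of \<open>H\<close> can be carried to its image and back; the hexagon and its image have the same
  set of Dirichlet eigenvalues, hence the same first eigenvalue (\<open>lambda1_cell\<close>). An energy is an
  upper bound for the infimum over all partitions because all energies are bounded below by a constant
  (\<open>minimal_energy_le\<close>).
\<close>

section \<open>Points of the torus and points of the plane\<close>
text \<open>Quantification over points of the plane stays quantification over points, not over coordinates.\<close>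
declare split_paired_All [simp del] split_paired_Ex [simp del]

definition period :: "real \<Rightarrow> int \<Rightarrow> int \<Rightarrow> plane" where
  "period b m n = (of_int m, of_int n * b)"

lemma period_add: "period b m n + period b m' n' = period b (m + m') (n + n')"
  by (simp add: period_def algebra_simps)

lemma period_diff: "period b m n - period b m' n' = period b (m - m') (n - n')"
  by (simp add: period_def algebra_simps)

lemma period_minus: "- period b m n = period b (- m) (- n)"
  by (simp add: period_def)

lemma period_zero [simp]: "period b 0 0 = 0"
  by (simp add: period_def zero_prod_def)

lemma torus_proj_eq_iff: "torus_proj b x = torus_proj b y \<longleftrightarrow> (\<exists>m n. y = x + period b m n)"
proof
  assume "torus_proj b x = torus_proj b y"
  moreover have "y \<in> torus_proj b y"
    unfolding torus_proj_def by (rule CollectI, rule exI[of _ 0], rule exI[of _ 0]) (simp flip: zero_prod_def)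
  ultimately have "y \<in> torus_proj b x"
    by simp
  then show "\<exists>m n. y = x + period b m n"
    by (auto simp: torus_proj_def period_def)
next
  assume "\<exists>m n. y = x + period b m n"
  then obtain m n where y: "y = x + period b m n"
    by blast
  have proj: "torus_proj b z = range (\<lambda>(m, n). z + period b m n)" for z
    unfolding torus_proj_def period_def image_def by (simp add: split_paired_Ex)
  have "z \<in> torus_proj b x" if "z \<in> torus_proj b y" for z
  proof -
    from that obtain m' n' where "z = x + (period b m n + period b m' n')"
      by (auto simp: proj y add.assoc)
    then show ?thesis
      by (force simp: proj period_add)
  qed
  moreover have "z \<in> torus_proj b y" if "z \<in> torus_proj b x" for z
  proof -
    from that obtain m' n' where "z = y + (period b m' n' - period b m n)"
      by (auto simp: proj y)
    then show ?thesis
      by (force simp: proj period_diff)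
  qed
  ultimately show "torus_proj b x = torus_proj b y"
    by blast
qed

lemma torus_proj_period [simp]: "torus_proj b (x + period b m n) = torus_proj b x"
  using torus_proj_eq_iff by metis

lemma torus_proj_period_diff [simp]: "torus_proj b (x - period b m n) = torus_proj b x"
  using torus_proj_period[of b x "- m" "- n"] by (simp flip: period_minus)

lemma vimage_image_torus_proj:
  "torus_proj b -` torus_proj b ` V = (\<Union>m n. (+) (period b m n) ` V)"
proof -
  have "x \<in> torus_proj b -` torus_proj b ` V \<longleftrightarrow> (\<exists>m n. \<exists>v\<in>V. x = period b m n + v)" for x
  proof -
    have "x \<in> torus_proj b -` torus_proj b ` V \<longleftrightarrow> (\<exists>v\<in>V. torus_proj b v = torus_proj b x)"
      by (metis imageE imageI vimage_eq)
    also have "\<dots> \<longleftrightarrow> (\<exists>v\<in>V. \<exists>m n. x = v + period b m n)"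
      by (simp only: torus_proj_eq_iff)
    also have "\<dots> \<longleftrightarrow> (\<exists>m n. \<exists>v\<in>V. x = period b m n + v)"
      by (metis add.commute)
    finally show ?thesis .
  qed
  then show ?thesis
    by (simp add: set_eq_iff image_iff)
qed

lemma continuous_map_torus_proj: "continuous_map euclidean (torus b) (torus_proj b)"
  by (auto simp: continuous_map_def openin_torus topspace_torus vimage_def)

lemma openin_torus_image:
  assumes "open V"
  shows "openin (torus b) (torus_proj b ` V)"
  using assms by (auto simp: openin_torus vimage_image_torus_proj intro!: open_UN open_translation)

lemma openin_torus_vimage: "openin (torus b) U \<Longrightarrow> open (torus_proj b -` U)"
  by (simp add: openin_torus)

lemma closedin_torus_iff:
  "closedin (torus b) C \<longleftrightarrow> C \<subseteq> range (torus_proj b) \<and> closed (torus_proj b -` C)"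
proof -
  have "torus_proj b -` (range (torus_proj b) - C) = - (torus_proj b -` C)"
    by blast
  then show ?thesis
    by (auto simp: closedin_def openin_torus topspace_torus closed_def)
qed

text \<open>Distinct periods are at distance at least \<open>min 1 b\<close>.\<close>
lemma closed_periods:
  assumes "b > 0" shows "closed ({period b m n |m n. True})"
proof (rule discrete_imp_closed)
  show "0 < min 1 b"
    using assms by simp
  show "\<forall>x\<in>{period b m n |m n. True}. \<forall>y\<in>{period b m n |m n. True}.
      dist y x < min 1 b \<longrightarrow> y = x"
  proof (intro ballI impI)
    fix x y assume "x \<in> {period b m n |m n. True}" "y \<in> {period b m n |m n. True}"
    then obtain m n m' n' where xy: "x = period b m n" "y = period b m' n'"
      by blast
    assume "dist y x < min 1 b"
    then have *: "norm (period b m' n' - period b m n) < min 1 b"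
      by (simp only: dist_norm xy)
    have "\<bar>of_int (m' - m)\<bar> < (1::real)"
      using * norm_fst_le[of "fst (period b m' n' - period b m n)" "snd (period b m' n' - period b m n)"]
      by (simp add: period_def)
    moreover have "\<bar>of_int (n' - n) * b\<bar> < b"
      using * norm_snd_le[of "snd (period b m' n' - period b m n)" "fst (period b m' n' - period b m n)"]
      by (simp add: period_def algebra_simps)
    then have "\<bar>of_int (n' - n)\<bar> < (1::real)"
      using assms by (simp add: abs_mult)
    ultimately show "y = x"
      unfolding xy by (smt (verit, best) of_int_diff of_int_less_1_iff of_int_minus abs_if)
  qed
qed

text \<open>The preimage of the image of \<open>K\<close> is the sum of a compact set and the closed set of periods.\<close>
lemma closedin_torus_image_compact:
  assumes "b > 0" "compact K"
  shows "closedin (torus b) (torus_proj b ` K)"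
proof -
  have "torus_proj b -` torus_proj b ` K = (\<Union>x\<in>K. \<Union>y\<in>{period b m n |m n. True}. {x + y})"
    unfolding vimage_image_torus_proj
    by (simp add: set_eq_iff image_iff add.commute) metis

  then show ?thesis
    using compact_closed_sums[OF assms(2) closed_periods[OF assms(1)]]
    by (simp add: closedin_torus_iff image_mono)
qed

lemma compactin_torus_image: "compact K \<Longrightarrow> compactin (torus b) (torus_proj b ` K)"
  by (rule image_compactin[OF _ continuous_map_torus_proj]) simp

section \<open>Continuously differentiable functions on the plane\<close>
text \<open>The regularity of the lift of a test function.\<close>
definition C1 :: "(plane \<Rightarrow> real) \<Rightarrow> bool" where
  "C1 f \<longleftrightarrow> (\<exists>g. continuous_on UNIV g \<and> (\<forall>x. GDERIV f x :> g x))"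

lemma grad_eq:
  assumes "GDERIV f x :> D" shows "grad f x = D"
proof -
  have "D' = D" if "GDERIV f x :> D'" for D'
  proof -
    have "inner h D' = inner h D" for h
      using fun_cong[OF has_derivative_unique[OF that[unfolded gderiv_def] assms[unfolded gderiv_def]], of h] .
    then show ?thesis
      by (intro iffD1[OF vector_eq_ldot]) (rule allI)
  qed
  with assms show ?thesis
    unfolding grad_def by blast
qed

lemma C1_GDERIV: "C1 f \<Longrightarrow> GDERIV f x :> grad f x"
  unfolding C1_def using grad_eq by (metis (no_types))

lemma C1_continuous_grad: "C1 f \<Longrightarrow> continuous_on UNIV (grad f)"
  unfolding C1_def using grad_eq by (metis continuous_on_cong)

lemma C1_continuous: "C1 f \<Longrightarrow> continuous_on UNIV f"
  using C1_GDERIV[unfolded gderiv_def] by (meson continuous_on_eq_continuous_within has_derivative_continuous)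

lemma GDERIV_cong_open:
  assumes "open V" "x \<in> V" "\<And>y. y \<in> V \<Longrightarrow> f y = h y" "GDERIV h x :> D"
  shows "GDERIV f x :> D"
  using assms unfolding gderiv_def
  by (metis has_derivative_transform_within_open)

lemma C1_zero: "C1 (\<lambda>x. 0)"
  unfolding C1_def by (rule exI[of _ "\<lambda>x. 0"]) (simp add: GDERIV_const)

lemma GDERIV_shift:
  assumes "GDERIV f (x + c) :> D"
  shows "GDERIV (\<lambda>x. f (x + c)) x :> D"
proof -
  have "((\<lambda>x. x + c) has_derivative (\<lambda>h. h)) (at x)"
    by (auto intro!: derivative_eq_intros)
  from has_derivative_compose[OF this assms[unfolded gderiv_def]] show ?thesis
    by (simp add: gderiv_def)
qed

lemma C1_shift:
  assumes "C1 f"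
  shows "C1 (\<lambda>x. f (x + c))"
  unfolding C1_def
proof (intro exI conjI allI)
  show "continuous_on UNIV (\<lambda>x. grad f (x + c))"
    by (rule continuous_on_compose2[OF C1_continuous_grad[OF assms]]) (auto intro!: continuous_intros)
  show "GDERIV (\<lambda>x. f (x + c)) x :> grad f (x + c)" for x
    by (rule GDERIV_shift[OF C1_GDERIV[OF assms]])
qed

text \<open>Functions on the torus will be glued from pieces that are defined in the plane.\<close>
lemma C1_local:
  assumes "\<And>x. \<exists>V h. open V \<and> x \<in> V \<and> C1 h \<and> (\<forall>y\<in>V. f y = h y)"
  shows "C1 f"
proof -
  have *: "\<exists>V h. open V \<and> x \<in> V \<and> C1 h \<and> (\<forall>y\<in>V. GDERIV f y :> grad h y)" for x
  proof -
    obtain V h where V: "open V" "x \<in> V" "C1 h" "\<forall>y\<in>V. f y = h y"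
      using assms by blast
    then have "GDERIV f y :> grad h y" if "y \<in> V" for y
      using GDERIV_cong_open[of V y f h] that C1_GDERIV by blast
    with V show ?thesis by blast
  qed
  then have "GDERIV f x :> grad f x" for x
    using grad_eq by metis
  moreover have "isCont (grad f) x" for x
  proof -
    obtain V h where V: "open V" "x \<in> V" "C1 h" "\<forall>y\<in>V. GDERIV f y :> grad h y"
      using * by blast
    then have eq: "\<forall>y\<in>V. grad f y = grad h y"
      using grad_eq by blast
    have "isCont (grad h) x"
      using C1_continuous_grad[OF V(3)] by (simp add: continuous_on_eq_continuous_at)
    moreover have "eventually (\<lambda>y. grad f y = grad h y) (nhds x)"
      using V(1,2) eq eventually_nhds by blast
    ultimately show ?thesis
      using isCont_cong by metis
  qed
  then have "continuous_on UNIV (grad f)"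
    by (simp add: continuous_at_imp_continuous_on)
  ultimately show ?thesis
    unfolding C1_def by blast
qed

lemma test_functions_iff:
  "\<phi> \<in> test_functions X p \<omega> \<longleftrightarrow> C1 (\<phi> \<circ> p) \<and>
     compactin X (X closure_of {x. \<phi> x \<noteq> 0}) \<and> X closure_of {x. \<phi> x \<noteq> 0} \<subseteq> \<omega>"
  by (auto simp: test_functions_def C1_def)

section \<open>Transport of eigenvalues between two surfaces\<close>
locale measure_iso =
  fixes M :: "'a measure" and N :: "'b measure" and S T
  assumes S [measurable]: "S \<in> M \<rightarrow>\<^sub>M N" and T [measurable]: "T \<in> N \<rightarrow>\<^sub>M M"
    and distr_S: "distr M N S = N"
    and TS: "x \<in> space M \<Longrightarrow> T (S x) = x" and ST: "y \<in> space N \<Longrightarrow> S (T y) = y"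
begin

lemma distr_T: "distr N M T = M"
proof -
  have "distr N M T = distr (distr M N S) M T"
    by (simp add: distr_S)
  also have "\<dots> = distr M M (T \<circ> S)"
    by (rule distr_distr) auto
  also have "\<dots> = distr M M (\<lambda>x. x)"
    by (rule distr_cong) (auto simp: TS)
  finally show ?thesis
    by simp
qed

lemma swap: "measure_iso N M T S"
  by unfold_locales (auto simp: distr_T TS ST)

lemma measurable_comp_iff: "(\<lambda>x. f (S x)) \<in> M \<rightarrow>\<^sub>M K \<longleftrightarrow> f \<in> N \<rightarrow>\<^sub>M K"
proof
  assume "(\<lambda>x. f (S x)) \<in> M \<rightarrow>\<^sub>M K"
  from measurable_compose[OF T this] show "f \<in> N \<rightarrow>\<^sub>M K"
    by (subst measurable_cong[where g = "\<lambda>y. f (S (T y))"]) (auto simp: ST)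
qed (rule measurable_compose[OF S])

lemma integrable_comp_iff:
  fixes f :: "'b \<Rightarrow> 'c::{banach, second_countable_topology}"
  shows "integrable M (\<lambda>x. f (S x)) \<longleftrightarrow> integrable N f"
proof (cases "f \<in> borel_measurable N")
  case True
  then show ?thesis
    using integrable_distr_eq[OF S True] by (simp add: distr_S)
next
  case False
  then show ?thesis
    using measurable_comp_iff[of f borel] borel_measurable_integrable[of N f]
      borel_measurable_integrable[of M "\<lambda>x. f (S x)"] by argo
qed

text \<open>The inverse map is measurable, so \<open>f\<close> and \<open>f \<circ> S\<close> are measurable together. If they are not, both
  integrals have the default value \<open>0\<close>.\<close>
lemma integral_comp:
  fixes f :: "'b \<Rightarrow> 'c::{banach, second_countable_topology}"
  shows "(\<integral>x. f (S x) \<partial>M) = (\<integral>y. f y \<partial>N)"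
proof (cases "f \<in> borel_measurable N")
  case True
  then show ?thesis
    using integral_distr[OF S True] by (simp add: distr_S)
next
  case False
  then have "\<not> integrable N f"
    by auto
  moreover from this have "\<not> integrable M (\<lambda>x. f (S x))"
    by (simp add: integrable_comp_iff)
  ultimately show ?thesis
    by (simp add: not_integrable_integral_eq)
qed

lemma AE_comp_zero:
  fixes u :: "'b \<Rightarrow> real"
  assumes "u \<in> borel_measurable N"
  shows "(AE x in M. u (S x) = 0) \<longleftrightarrow> (AE y in N. u y = 0)"
proof -
  have [measurable]: "u \<in> borel_measurable N" by fact
  have "(AE y in distr M N S. u y = 0) \<longleftrightarrow> (AE x in M. u (S x) = 0)"
    by (rule AE_distr_iff) auto
  then show ?thesis
    unfolding distr_S by (rule sym)
qed

end

lemma L2_function_comp: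
  assumes "measure_iso M N S T"
  shows "L2_function M (\<lambda>x. f (S x)) \<longleftrightarrow> L2_function N f"
proof -
  interpret measure_iso M N S T by fact
  show ?thesis
    unfolding L2_function_def
    using measurable_comp_iff[of f borel] integrable_comp_iff[of "\<lambda>x. (norm (f x))\<^sup>2"] by blast
qed

text \<open>The functions \<open>\<phi>\<close> and \<open>\<psi>\<close> on the two surfaces correspond to each other under \<open>S\<close>. Equality of the
  gradients expresses that \<open>S\<close> is locally a translation.\<close>
definition matching where
  "matching M p q S \<phi> \<psi> \<longleftrightarrow>
    (\<forall>x\<in>space M. \<phi> (p x) = \<psi> (q (S x)) \<and> grad (\<phi> \<circ> p) x = grad (\<psi> \<circ> q) (S x))"

text \<open>An eigenfunction \<open>u\<close> is carried to \<open>u \<circ> S\<close>. Its approximating test functions are pulled back, while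
  the test functions in the weak equation are pushed forward.\<close>
lemma dirichlet_eigenvalue_transfer:
  fixes X :: "'a topology" and Y :: "'b topology" and p :: "plane \<Rightarrow> 'a" and q :: "plane \<Rightarrow> 'b" and F G U V
  defines "M \<equiv> surface_measure F p U" and "N \<equiv> surface_measure G q V"
  assumes iso: "measure_iso M N S T"
    and pull: "\<And>\<psi>. \<psi> \<in> test_functions Y q V \<Longrightarrow> \<exists>\<phi>\<in>test_functions X p U. matching M p q S \<phi> \<psi>"
    and push: "\<And>\<phi>. \<phi> \<in> test_functions X p U \<Longrightarrow> \<exists>\<psi>\<in>test_functions Y q V. matching M p q S \<phi> \<psi>"
    and ev: "dirichlet_eigenvalue Y q G V \<mu>"
  shows "dirichlet_eigenvalue X p F U \<mu>"
proof -
  interpret measure_iso M N S T by fact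
  obtain u g where u: "H10 Y q G V u g" and nz: "\<not> (AE x in N. u x = 0)"
    and eq: "\<And>\<psi>. \<psi> \<in> test_functions Y q V \<Longrightarrow>
      (\<integral>x. g x \<bullet> grad (\<psi> \<circ> q) x \<partial>N) = \<mu> * (\<integral>x. u x * \<psi> (q x) \<partial>N)"
    using ev unfolding dirichlet_eigenvalue_def N_def[symmetric] Let_def by blast
  from u obtain \<psi> where L2: "L2_function N u" "L2_function N g"
    and \<psi>: "\<And>n. \<psi> n \<in> test_functions Y q V"
    and lim: "(\<lambda>n. \<integral>x. (\<psi> n (q x) - u x)\<^sup>2 \<partial>N) \<longlonglongrightarrow> 0"
      "(\<lambda>n. \<integral>x. (norm (grad (\<psi> n \<circ> q) x - g x))\<^sup>2 \<partial>N) \<longlonglongrightarrow> 0"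
    by (auto simp: H10_def N_def Let_def)
  from pull[OF \<psi>] obtain \<phi> where \<phi>: "\<And>n. \<phi> n \<in> test_functions X p U"
    and m: "\<And>n. matching M p q S (\<phi> n) (\<psi> n)"
    by metis
  have "(\<integral>x. (\<phi> n (p x) - u (S x))\<^sup>2 \<partial>M) = (\<integral>x. (\<psi> n (q x) - u x)\<^sup>2 \<partial>N)" for n
    unfolding integral_comp[symmetric, of "\<lambda>x. (\<psi> n (q x) - u x)\<^sup>2"]
    by (rule Bochner_Integration.integral_cong) (use m[of n] in \<open>auto simp: matching_def\<close>)
  moreover have "(\<integral>x. (norm (grad (\<phi> n \<circ> p) x - g (S x)))\<^sup>2 \<partial>M) = (\<integral>x. (norm (grad (\<psi> n \<circ> q) x - g x))\<^sup>2 \<partial>N)" for n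
    unfolding integral_comp[symmetric, of "\<lambda>x. (norm (grad (\<psi> n \<circ> q) x - g x))\<^sup>2"]
    by (rule Bochner_Integration.integral_cong) (use m[of n] in \<open>auto simp: matching_def\<close>)
  ultimately have "H10 X p F U (\<lambda>x. u (S x)) (\<lambda>x. g (S x))"
    unfolding H10_def M_def[symmetric] Let_def
    using lim \<phi> L2 L2_function_comp[OF iso, of u] L2_function_comp[OF iso, of g]
    by (intro conjI exI[of _ \<phi>]) (simp_all)
  moreover have "\<not> (AE x in M. u (S x) = 0)"
    using nz AE_comp_zero L2(1) L2_function_def by blast
  moreover have "(\<integral>x. g (S x) \<bullet> grad (\<phi> \<circ> p) x \<partial>M) = \<mu> * (\<integral>x. u (S x) * \<phi> (p x) \<partial>M)"
    if "\<phi> \<in> test_functions X p U" for \<phi>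
  proof -
    obtain \<psi> where \<psi>: "\<psi> \<in> test_functions Y q V" and m: "matching M p q S \<phi> \<psi>"
      using push[OF \<open>\<phi> \<in> test_functions X p U\<close>] by blast
    have "(\<integral>x. g (S x) \<bullet> grad (\<phi> \<circ> p) x \<partial>M) = (\<integral>x. g x \<bullet> grad (\<psi> \<circ> q) x \<partial>N)"
      unfolding integral_comp[symmetric, of "\<lambda>x. g x \<bullet> grad (\<psi> \<circ> q) x"]
      by (rule Bochner_Integration.integral_cong) (use m in \<open>auto simp: matching_def\<close>)
    moreover have "(\<integral>x. u (S x) * \<phi> (p x) \<partial>M) = (\<integral>x. u x * \<psi> (q x) \<partial>N)"
      unfolding integral_comp[symmetric, of "\<lambda>x. u x * \<psi> (q x)"]
      by (rule Bochner_Integration.integral_cong) (use m in \<open>auto simp: matching_def\<close>)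
    ultimately show ?thesis
      using eq[OF \<psi>] by simp
  qed
  ultimately show ?thesis
    unfolding dirichlet_eigenvalue_def M_def[symmetric] Let_def by blast
qed

lemma dirichlet_eigenvalue_transfer_iff:
  fixes X :: "'a topology" and Y :: "'b topology" and p :: "plane \<Rightarrow> 'a" and q :: "plane \<Rightarrow> 'b" and F G U V
  defines "M \<equiv> surface_measure F p U" and "N \<equiv> surface_measure G q V"
  assumes iso: "measure_iso M N S T"
    and pull: "\<And>\<psi>. \<psi> \<in> test_functions Y q V \<Longrightarrow> \<exists>\<phi>\<in>test_functions X p U. matching M p q S \<phi> \<psi>"
    and push: "\<And>\<phi>. \<phi> \<in> test_functions X p U \<Longrightarrow> \<exists>\<psi>\<in>test_functions Y q V. matching M p q S \<phi> \<psi>"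
  shows "dirichlet_eigenvalue X p F U \<mu> \<longleftrightarrow> dirichlet_eigenvalue Y q G V \<mu>"
proof
  interpret measure_iso M N S T by fact
  have m: "matching N q p T \<psi> \<phi>" if "matching M p q S \<phi> \<psi>" for \<phi> \<psi>
    unfolding matching_def
  proof
    fix y assume y: "y \<in> space N"
    then have "T y \<in> space M"
      using T measurable_space by metis
    then show "\<psi> (q y) = \<phi> (p (T y)) \<and> grad (\<psi> \<circ> q) y = grad (\<phi> \<circ> p) (T y)"
      using that ST[OF y] by (metis matching_def)
  qed
  assume "dirichlet_eigenvalue X p F U \<mu>"
  then show "dirichlet_eigenvalue Y q G V \<mu>"
    using dirichlet_eigenvalue_transfer[OF swap[unfolded M_def N_def]] pull push m
    unfolding M_def N_def by metis
next
  assume "dirichlet_eigenvalue Y q G V \<mu>"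
  with dirichlet_eigenvalue_transfer[OF iso[unfolded M_def N_def]] pull push
  show "dirichlet_eigenvalue X p F U \<mu>"
    unfolding M_def N_def by blast
qed

section \<open>Domains of the torus on which the projection has an inverse\<close>
lemma period_inject: "b > 0 \<Longrightarrow> period b m n = period b m' n' \<longleftrightarrow> m = m' \<and> n = n'"
  by (simp add: period_def)

definition fundamental_domain :: "real \<Rightarrow> plane set" where
  "fundamental_domain b = {0..<1} \<times> {0..<b}"

definition torus_reduce :: "real \<Rightarrow> plane \<Rightarrow> plane" where
  "torus_reduce b x = x - period b \<lfloor>fst x\<rfloor> \<lfloor>snd x / b\<rfloor>"

lemma torus_proj_reduce [simp]: "torus_proj b (torus_reduce b x) = torus_proj b x"
  by (simp add: torus_reduce_def)

lemma torus_reduce_in: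
  assumes "b > 0" shows "torus_reduce b x \<in> fundamental_domain b"
proof -
  obtain s t where x: "x = (s, t)" by (cases x)
  have "0 \<le> t / b - \<lfloor>t / b\<rfloor>" "t / b - \<lfloor>t / b\<rfloor> < 1"
    by linarith+
  then have "0 \<le> t - \<lfloor>t / b\<rfloor> * b" "t - \<lfloor>t / b\<rfloor> * b < b"
    using assms by (simp_all add: field_simps)
  then show ?thesis
    unfolding x torus_reduce_def fundamental_domain_def period_def
    by simp linarith
qed

lemma fundamental_domain_unique:
  assumes "b > 0" "x \<in> fundamental_domain b" "x + period b m n \<in> fundamental_domain b"
  shows "m = 0 \<and> n = 0"
proof -
  obtain s t where x: "x = (s, t)" by (cases x)
  have "\<bar>of_int m\<bar> < (1::real)" "\<bar>of_int n * b\<bar> < b"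
    using assms unfolding x fundamental_domain_def period_def by auto
  then have "\<bar>of_int m\<bar> < (1::real)" "\<bar>of_int n\<bar> < (1::real)"
    using assms(1) by (auto simp: abs_mult)
  then show ?thesis
    by linarith
qed

lemma borel_fundamental_domain [measurable]: "fundamental_domain b \<in> sets borel"
  unfolding fundamental_domain_def by (simp add: borel_Times)

lemma emeasure_lborel_translate:
  fixes a :: plane
  assumes "A \<in> sets borel"
  shows "emeasure lborel ((\<lambda>y. a + y) -` A) = emeasure lborel A"
proof -
  have "emeasure lborel A = emeasure (distr lborel borel ((+) a)) A"
    by (simp add: lborel_distr_plus)
  also have "\<dots> = emeasure lborel ((+) a -` A)"
    using assms by (subst emeasure_distr) auto
  finally show ?thesis
    by simp
qed

text \<open>The inverse of the chart \<open>y \<mapsto> torus_proj b (c + y)\<close> of the torus by \<open>H\<close>.\<close>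
definition cell_point :: "real \<Rightarrow> plane \<Rightarrow> plane set \<Rightarrow> plane set \<Rightarrow> plane" where
  "cell_point b c H d = (THE y. y \<in> H \<and> torus_proj b (c + y) = d)"

locale embedded_cell =
  fixes b :: real and c :: plane and H :: "plane set"
  assumes b: "b > 0" and open_H: "open H" and bounded_H: "bounded H"
    and inj: "inj_on (torus_proj b) ((+) c ` H)"
begin

definition "D = torus_proj b ` (+) c ` H"

definition "S x = cell_point b c H (torus_proj b x)"

abbreviation "M \<equiv> surface_measure (fundamental_domain b) (torus_proj b) D"
abbreviation "N \<equiv> surface_measure UNIV (\<lambda>x. x) H"

lemma inj_H: "h \<in> H \<Longrightarrow> h' \<in> H \<Longrightarrow> torus_proj b (c + h) = torus_proj b (c + h') \<Longrightarrow> h = h'"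
  using inj unfolding inj_on_def by (metis add_left_cancel imageI)

lemma cell_point_eq: "h \<in> H \<Longrightarrow> cell_point b c H (torus_proj b (c + h)) = h"
  unfolding cell_point_def by (rule the_equality) (auto intro: inj_H)

lemma S_eq: "x - c - period b m n \<in> H \<Longrightarrow> S x = x - c - period b m n"
  unfolding S_def using cell_point_eq[of "x - c - period b m n"] by simp

lemma in_D_iff: "torus_proj b x \<in> D \<longleftrightarrow> (\<exists>m n. x - c - period b m n \<in> H)"
proof
  assume "torus_proj b x \<in> D"
  then obtain h where h: "h \<in> H" "torus_proj b (c + h) = torus_proj b x"
    unfolding D_def by auto
  then obtain m n where "x = c + h + period b m n"
    using torus_proj_eq_iff by blast
  with h(1) show "\<exists>m n. x - c - period b m n \<in> H"
    by (intro exI[of _ m] exI[of _ n]) simp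
next
  assume "\<exists>m n. x - c - period b m n \<in> H"
  then obtain m n where h: "x - c - period b m n \<in> H" by blast
  have "torus_proj b (c + (x - c - period b m n)) = torus_proj b x"
    by simp
  then show "torus_proj b x \<in> D"
    unfolding D_def using h by (metis imageI)
qed

lemma open_vimage_D: "open (torus_proj b -` D)"
  unfolding D_def by (intro openin_torus_vimage openin_torus_image open_translation open_H)

lemma space_M: "space M = fundamental_domain b \<inter> torus_proj b -` D"
  by (simp add: surface_measure_def space_restrict_space)

lemma space_N: "space N = H"
  by (simp add: surface_measure_def space_restrict_space)

lemma sets_M: "A \<in> sets M \<longleftrightarrow> A \<subseteq> space M \<and> A \<in> sets borel"
  using open_vimage_D unfolding space_M
  by (simp add: surface_measure_def sets_restrict_space_iff)

lemma sets_N: "A \<in> sets N \<longleftrightarrow> A \<subseteq> H \<and> A \<in> sets borel"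
  using open_H by (simp add: surface_measure_def sets_restrict_space_iff)

lemma emeasure_M: "A \<in> sets M \<Longrightarrow> emeasure M A = emeasure lborel A"
  using open_vimage_D unfolding sets_M space_M
  by (simp add: surface_measure_def emeasure_restrict_space)

lemma emeasure_N: "A \<in> sets N \<Longrightarrow> emeasure N A = emeasure lborel A"
  using open_H unfolding sets_N
  by (simp add: surface_measure_def emeasure_restrict_space)

abbreviation "per z \<equiv> period b (fst z) (snd z)"

lemma S_vimage:
  assumes "A \<subseteq> H"
  shows "S -` A \<inter> space M = (\<Union>z. {x \<in> fundamental_domain b. x - c - per z \<in> A})"
proof -
  have "S x \<in> A \<and> torus_proj b x \<in> D \<longleftrightarrow> (\<exists>z. x - c - per z \<in> A)" for x
    using assms in_D_iff[of x] S_eq[of x] by (auto) (metis fst_conv snd_conv subsetD)+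
  then show ?thesis
    by (simp add: space_M set_eq_iff) blast
qed

lemma piece_measurable:
  assumes "A \<in> sets borel"
  shows "{x \<in> fundamental_domain b. x - c - per z \<in> A} \<in> sets borel"
proof -
  have "(\<lambda>x. x - c - per z) \<in> borel \<rightarrow>\<^sub>M borel"
    by measurable
  from measurable_sets[OF this assms] have "(\<lambda>x. x - c - per z) -` A \<in> sets borel"
    by simp
  then have "fundamental_domain b \<inter> (\<lambda>x. x - c - per z) -` A \<in> sets borel"
    by auto
  then show ?thesis
    by (simp add: Int_def vimage_def)
qed

lemma S_vimage_sets:
  assumes "A \<in> sets N"
  shows "S -` A \<inter> space M \<in> sets M"
proof -
  have "(\<Union>z. {x \<in> fundamental_domain b. x - c - per z \<in> A}) \<in> sets borel"
    using assms by (intro sets.countable_UN'' piece_measurable) (auto simp: sets_N)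
  then have "S -` A \<inter> space M \<in> sets borel"
    using S_vimage[of A] assms by (simp add: sets_N)
  then show ?thesis
    unfolding sets_M by (intro conjI Int_lower2)
qed

text \<open>Both sides are cut into pieces, indexed by the periods, that correspond by translation. The pieces
  \<open>P z\<close> of the fundamental domain are disjoint because \<open>H\<close> projects injectively; the pieces \<open>Q z\<close> of
  \<open>A\<close> are disjoint and exhaust \<open>A\<close> because the fundamental domain meets every orbit once.\<close>
lemma emeasure_S_vimage:
  assumes "A \<in> sets N"
  shows "emeasure M (S -` A \<inter> space M) = emeasure N A"
proof -
  have A: "A \<subseteq> H" "A \<in> sets borel"
    using assms by (auto simp: sets_N)
  define P where "P z = {x \<in> fundamental_domain b. x - c - per z \<in> A}" for z
  define Q where "Q z = {y \<in> A. c + per z + y \<in> fundamental_domain b}" for z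
  have P: "P z \<in> sets borel" for z
    unfolding P_def by (rule piece_measurable[OF A(2)])
  have QP: "Q z = (+) (c + per z) -` P z" for z
    by (auto simp: P_def Q_def)
  have Q: "Q z \<in> sets borel" for z
    using measurable_sets[OF _ P, of "(+) (c + per z)" borel z] by (simp add: QP)
  have dP: "disjoint_family P"
  proof (unfold disjoint_family_on_def, intro ballI impI)
    fix z z' assume "z \<noteq> (z'::int\<times>int)"
    show "P z \<inter> P z' = {}"
    proof (rule ccontr)
      assume "P z \<inter> P z' \<noteq> {}"
      then obtain x where "x - c - per z \<in> A" "x - c - per z' \<in> A"
        unfolding P_def by blast
      with A(1) have "S x = x - c - per z" "S x = x - c - per z'"
        by (meson S_eq subsetD)+
      then have "per z = per z'"
        by simp
      with \<open>z \<noteq> z'\<close> show False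
        using period_inject[OF b] by (simp add: prod_eq_iff)
    qed
  qed
  have dQ: "disjoint_family Q"
  proof (unfold disjoint_family_on_def, intro ballI impI)
    fix z z' assume "z \<noteq> (z'::int\<times>int)"
    show "Q z \<inter> Q z' = {}"
    proof (rule ccontr)
      assume "Q z \<inter> Q z' \<noteq> {}"
      then obtain y where y: "c + per z + y \<in> fundamental_domain b" "c + per z' + y \<in> fundamental_domain b"
        unfolding Q_def by blast
      have "c + per z' + y = c + per z + y + period b (fst z' - fst z) (snd z' - snd z)"
        by (simp flip: period_diff)
      then have "fst z' - fst z = 0 \<and> snd z' - snd z = 0"
        using fundamental_domain_unique[OF b y(1)] y(2) by metis
      with \<open>z \<noteq> z'\<close> show False
        by (simp add: prod_eq_iff)
    qed
  qed
  have UQ: "(\<Union>z. Q z) = A"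
  proof -
    have "\<exists>z. y \<in> Q z" if "y \<in> A" for y
    proof (rule exI[of _ "(- \<lfloor>fst (c + y)\<rfloor>, - \<lfloor>snd (c + y) / b\<rfloor>)"])
      have "c + per (- \<lfloor>fst (c + y)\<rfloor>, - \<lfloor>snd (c + y) / b\<rfloor>) + y = torus_reduce b (c + y)"
        by (simp add: torus_reduce_def flip: period_minus)
      then show "y \<in> Q (- \<lfloor>fst (c + y)\<rfloor>, - \<lfloor>snd (c + y) / b\<rfloor>)"
        using torus_reduce_in[OF b, of "c + y"] that by (simp add: Q_def)
    qed
    then show ?thesis
      by (auto simp: Q_def)
  qed
  have PQ: "emeasure lborel (P z) = emeasure lborel (Q z)" for z
    using emeasure_lborel_translate[OF P, of "c + per z" z] by (simp add: QP)
  have "emeasure M (S -` A \<inter> space M) = emeasure lborel (\<Union>z. P z)"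
    using emeasure_M[OF S_vimage_sets[OF assms]] S_vimage[OF A(1)] by (simp add: P_def)
  also have "\<dots> = (\<integral>\<^sup>+z. emeasure lborel (P z) \<partial>count_space UNIV)"
    using P dP by (intro emeasure_UN_countable) auto
  also have "\<dots> = (\<integral>\<^sup>+z. emeasure lborel (Q z) \<partial>count_space UNIV)"
    by (simp add: PQ)
  also have "\<dots> = emeasure lborel (\<Union>z. Q z)"
    using Q dQ by (intro emeasure_UN_countable[symmetric]) auto
  also have "\<dots> = emeasure N A"
    by (simp add: UQ emeasure_N[OF assms])
  finally show ?thesis .
qed

lemma torus_reduce_measurable [measurable]: "torus_reduce b \<in> borel \<rightarrow>\<^sub>M borel"
proof -
  have "(\<lambda>x::plane. (of_int \<lfloor>fst x\<rfloor>, of_int \<lfloor>snd x / b\<rfloor> * b) :: plane) \<in> borel_measurable borel"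
  proof (rule borel_measurable_Pair)
    have [measurable]: "(fst :: plane \<Rightarrow> real) \<in> borel_measurable borel"
        "(snd :: plane \<Rightarrow> real) \<in> borel_measurable borel"
      by (auto intro!: borel_measurable_continuous_onI continuous_intros)
    show "(\<lambda>x::plane. of_int \<lfloor>fst x\<rfloor> :: real) \<in> borel_measurable borel"
      by measurable
    show "(\<lambda>x::plane. of_int \<lfloor>snd x / b\<rfloor> * b :: real) \<in> borel_measurable borel"
      by measurable
  qed
  then show ?thesis
    unfolding torus_reduce_def[abs_def] period_def by measurable
qed

lemma measure_iso_cell: "measure_iso M N S (\<lambda>y. torus_reduce b (c + y))"
proof
  show S: "S \<in> M \<rightarrow>\<^sub>M N"
  proof (rule measurableI)
    show "S x \<in> space N" if "x \<in> space M" for x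
      using that in_D_iff[of x] S_eq[of x] by (auto simp: space_M space_N)
  qed (rule S_vimage_sets)
  have DT: "torus_reduce b (c + y) \<in> space M" if "y \<in> H" for y
    using that torus_reduce_in[OF b, of "c + y"] unfolding space_M by (simp add: D_def)
  show "(\<lambda>y. torus_reduce b (c + y)) \<in> N \<rightarrow>\<^sub>M M"
  proof (rule measurableI)
    show "torus_reduce b (c + y) \<in> space M" if "y \<in> space N" for y
      using DT that by (simp add: space_N)
    fix A assume "A \<in> sets M"
    then have "(\<lambda>y. torus_reduce b (c + y)) -` A \<in> sets borel"
      using measurable_sets[of "\<lambda>y. torus_reduce b (c + y)" borel borel A] by (simp add: sets_M)
    then show "(\<lambda>y. torus_reduce b (c + y)) -` A \<inter> space N \<in> sets N"
      using open_H by (simp add: sets_N space_N borel_open sets.Int)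
  qed
  show "distr M N S = N"
  proof (rule measure_eqI)
    show "emeasure (distr M N S) A = emeasure N A" if "A \<in> sets (distr M N S)" for A
      using that emeasure_S_vimage by (simp add: emeasure_distr[OF S])
  qed simp
  show "S (torus_reduce b (c + y)) = y" if "y \<in> space N" for y
    using that cell_point_eq by (simp add: S_def space_N)
  show "torus_reduce b (c + S x) = x" if xM: "x \<in> space M" for x
  proof -
    obtain m n where h: "x - c - period b m n \<in> H"
      using xM in_D_iff[of x] by (auto simp: space_M)
    have "torus_proj b (torus_reduce b (c + S x)) = torus_proj b x"
      using S_eq[OF h] by simp
    then obtain m' n' where eq: "torus_reduce b (c + S x) = x + period b m' n'"
      using torus_proj_eq_iff by metis
    have "x \<in> fundamental_domain b" "x + period b m' n' \<in> fundamental_domain b"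
      using xM torus_reduce_in[OF b, of "c + S x"] by (auto simp: space_M eq)
    then have "m' = 0 \<and> n' = 0"
      using fundamental_domain_unique[OF b] by blast
    then show ?thesis
      using eq by simp
  qed
qed

text \<open>A test function on \<open>H\<close> is moved to the torus and extended by zero. The image of its support is compact
  and therefore closed in the torus; the lift vanishes near every point over the complement of this
  image, and near the points over \<open>D\<close> it is a translate of \<open>\<psi>\<close>.\<close>
lemma pull_test_function:
  assumes "\<psi> \<in> test_functions euclidean (\<lambda>x. x) H"
  shows "\<exists>\<phi>\<in>test_functions (torus b) (torus_proj b) D. matching M (torus_proj b) (\<lambda>x. x) S \<phi> \<psi>"
proof -
  define K where "K = closure {x. \<psi> x \<noteq> 0}"
  have \<psi>: "C1 \<psi>" and K: "compact K" "K \<subseteq> H"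
    using assms by (auto simp: test_functions_iff K_def comp_def)
  have zero: "\<psi> y = 0" if "y \<notin> K" for y
    using that closure_subset[of "{x. \<psi> x \<noteq> 0}"] by (auto simp: K_def)
  define \<phi> where "\<phi> d = (if d \<in> D then \<psi> (cell_point b c H d) else 0)" for d
  define KD where "KD = torus_proj b ` (+) c ` K"
  have KD: "closedin (torus b) KD" "compactin (torus b) KD" "KD \<subseteq> D"
    unfolding KD_def D_def using K b
    by (auto intro!: closedin_torus_image_compact compactin_torus_image compact_translation)
  have \<phi>_eq: "\<phi> (torus_proj b x) = \<psi> (x - c - period b m n)" if "x - c - period b m n \<in> H" for x m n
    using S_eq[OF that] in_D_iff[of x] that by (auto simp: \<phi>_def S_def)
  have \<phi>_zero: "\<phi> d = 0" if "d \<notin> KD" for d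
  proof (cases "d \<in> D")
    case True
    then obtain h where h: "h \<in> H" "d = torus_proj b (c + h)"
      by (auto simp: D_def)
    then have "h \<notin> K"
      using that by (auto simp: KD_def)
    then show ?thesis
      using h cell_point_eq zero by (simp add: \<phi>_def)
  qed (simp add: \<phi>_def)
  have local: "open {x. x - c - period b m n \<in> H}" for m n
  proof -
    have "open ((\<lambda>x. x - c - period b m n) -` H)"
      by (intro open_vimage open_H continuous_intros)
    then show ?thesis
      by (simp add: vimage_def)
  qed
  have C1_eq: "\<psi> (x - c - period b m n) = \<psi> (x + (- c - period b m n))" for x m n
    by (simp add: algebra_simps)
  have "C1 (\<phi> \<circ> torus_proj b)"
  proof (rule C1_local)
    fix x
    show "\<exists>V h. open V \<and> x \<in> V \<and> C1 h \<and> (\<forall>y\<in>V. (\<phi> \<circ> torus_proj b) y = h y)"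
    proof (cases "torus_proj b x \<in> D")
      case True
      then obtain m n where h: "x - c - period b m n \<in> H"
        using in_D_iff by blast
      show ?thesis
        using h local[of m n] C1_shift[OF \<psi>] \<phi>_eq C1_eq[of _ m n]
        by (intro exI[of _ "{x. x - c - period b m n \<in> H}"] exI[of _ "\<lambda>x. \<psi> (x + (- c - period b m n))"]) auto
    next
      case False
      have "open (- (torus_proj b -` KD))"
        using KD(1) by (simp add: closedin_torus_iff open_Compl)
      moreover have "x \<in> - (torus_proj b -` KD)"
        using False KD(3) by auto
      ultimately show ?thesis
        using C1_zero \<phi>_zero
        by (intro exI[of _ "- (torus_proj b -` KD)"] exI[of _ "\<lambda>x. 0"]) auto
    qed
  qed
  moreover have sub: "torus b closure_of {d. \<phi> d \<noteq> 0} \<subseteq> KD"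
    using KD(1) \<phi>_zero by (intro closure_of_minimal) auto
  ultimately have "\<phi> \<in> test_functions (torus b) (torus_proj b) D"
    unfolding test_functions_iff using closed_compactin[OF KD(2) sub] KD(3) by auto
  moreover have "matching M (torus_proj b) (\<lambda>x. x) S \<phi> \<psi>"
    unfolding matching_def
  proof
    fix x assume "x \<in> space M"
    then obtain m n where h: "x - c - period b m n \<in> H"
      using in_D_iff by (auto simp: space_M)
    have d: "GDERIV (\<lambda>x. \<psi> (x + (- c - period b m n))) x :> grad \<psi> (x + (- c - period b m n))"
      by (rule GDERIV_shift[OF C1_GDERIV[OF \<psi>]])
    have cong: "(\<phi> \<circ> torus_proj b) y = \<psi> (y + (- c - period b m n))"
      if "y \<in> {x. x - c - period b m n \<in> H}" for y
      using that \<phi>_eq[of y m n] C1_eq[of y m n] by simp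
    have "GDERIV (\<phi> \<circ> torus_proj b) x :> grad \<psi> (x + (- c - period b m n))"
      by (rule GDERIV_cong_open[OF local[of m n] _ cong d]) (simp add: h)
    moreover have "S x = x + (- c - period b m n)"
      using S_eq[OF h] by (simp add: algebra_simps)
    ultimately have "grad (\<phi> \<circ> torus_proj b) x = grad \<psi> (S x)"
      by (simp only: grad_eq)
    then show "\<phi> (torus_proj b x) = \<psi> (S x) \<and> grad (\<phi> \<circ> torus_proj b) x = grad (\<psi> \<circ> (\<lambda>x. x)) (S x)"
      using \<phi>_eq[OF h] S_eq[OF h] by (simp add: comp_def)
  qed
  ultimately show ?thesis
    by blast
qed

text \<open>What has to be shown is that the part \<open>K\<close> of the support seen in \<open>H\<close> is closed. A point over the
  support that is outside \<open>H\<close> lies in another translate of \<open>H\<close>, and this translate is an open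
  neighbourhood of the point and disjoint from \<open>H\<close>.\<close>
lemma push_test_function:
  assumes "\<phi> \<in> test_functions (torus b) (torus_proj b) D"
  shows "\<exists>\<psi>\<in>test_functions euclidean (\<lambda>x. x) H. matching M (torus_proj b) (\<lambda>x. x) S \<phi> \<psi>"
proof -
  define KD where "KD = torus b closure_of {d. \<phi> d \<noteq> 0}"
  have \<phi>: "C1 (\<phi> \<circ> torus_proj b)" and KD: "KD \<subseteq> D" "closedin (torus b) KD"
    using assms by (auto simp: test_functions_iff KD_def)
  have \<phi>_zero: "\<phi> (torus_proj b x) = 0" if "torus_proj b x \<notin> KD" for x
    using that closure_of_subset_Int[of "torus b" "{d. \<phi> d \<noteq> 0}"]
    by (auto simp: KD_def topspace_torus)
  define \<psi> where "\<psi> y = (if y \<in> H then \<phi> (torus_proj b (c + y)) else 0)" for y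
  define K where "K = {y\<in>H. torus_proj b (c + y) \<in> KD}"
  have "\<exists>V. open V \<and> y \<in> V \<and> V \<subseteq> - K" if "y \<notin> K" for y
  proof (cases "torus_proj b (c + y) \<in> KD")
    case False
    have "open ((+) c -` (- (torus_proj b -` KD)))"
      using KD(2) by (intro open_vimage continuous_intros) (simp add: closedin_torus_iff open_Compl)
    then show ?thesis
      using False by (intro exI[of _ "(+) c -` (- (torus_proj b -` KD))"]) (auto simp: K_def)
  next
    case True
    then have "torus_proj b (c + y) \<in> D"
      using KD(1) by blast
    then obtain m n where h: "c + y - c - period b m n \<in> H"
      using in_D_iff by blast
    have op: "open ((\<lambda>y. y - period b m n) -` H)"
      by (intro open_vimage open_H continuous_intros)
    have "z \<notin> K" if z: "z - period b m n \<in> H" for z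
    proof
      assume "z \<in> K"
      then have "z \<in> H"
        by (simp add: K_def)
      moreover have "torus_proj b (c + z) = torus_proj b (c + (z - period b m n))"
        using torus_proj_period_diff[of b "c + z" m n] by (simp add: algebra_simps)
      ultimately have "z = z - period b m n"
        using inj_H z by blast
      then have "period b m n = 0"
        by simp
      then show False
        using h that \<open>y \<notin> K\<close> True by (simp add: K_def)
    qed
    then show ?thesis
      using h op by (intro exI[of _ "(\<lambda>y. y - period b m n) -` H"]) auto
  qed
  then have "open (- K)"
    by (subst openin_subopen[of euclidean, simplified]) blast
  then have K: "closed K" "compact K" "K \<subseteq> H"
    using bounded_H bounded_subset[of H K] by (auto simp: closed_def compact_eq_bounded_closed K_def)
  have \<psi>_zero: "\<psi> y = 0" if "y \<notin> K" for y
    using that \<phi>_zero by (auto simp: \<psi>_def K_def)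
  have C1: "C1 (\<lambda>y. (\<phi> \<circ> torus_proj b) (y + c))"
    by (rule C1_shift[OF \<phi>])
  have "C1 \<psi>"
  proof (rule C1_local)
    fix y
    show "\<exists>V h. open V \<and> y \<in> V \<and> C1 h \<and> (\<forall>y\<in>V. \<psi> y = h y)"
    proof (cases "y \<in> H")
      case True
      then show ?thesis
        using C1 open_H
        by (intro exI[of _ H] exI[of _ "\<lambda>y. (\<phi> \<circ> torus_proj b) (y + c)"]) (auto simp: \<psi>_def add.commute)
    next
      case False
      then show ?thesis
        using C1_zero \<open>open (- K)\<close> \<psi>_zero K(3)
        by (intro exI[of _ "- K"] exI[of _ "\<lambda>y. 0"]) auto
    qed
  qed
  moreover have sub: "closure {y. \<psi> y \<noteq> 0} \<subseteq> K"
    using K(1) \<psi>_zero by (intro closure_minimal) auto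
  moreover have "compact (closure {y. \<psi> y \<noteq> 0})"
    using sub K(2) by (meson closed_closure compact_Int_closed compact_closure inf.absorb_iff2 bounded_subset compact_imp_bounded closure_subset subset_trans)
  ultimately have "\<psi> \<in> test_functions euclidean (\<lambda>x. x) H"
    unfolding test_functions_iff using K(3) by (auto simp: comp_def)
  moreover have "matching M (torus_proj b) (\<lambda>x. x) S \<phi> \<psi>"
    unfolding matching_def
  proof
    fix x assume "x \<in> space M"
    then obtain m n where h: "x - c - period b m n \<in> H"
      using in_D_iff by (auto simp: space_M)
    define y where "y = x - c - period b m n"
    have Sx: "S x = y"
      using S_eq[OF h] by (simp add: y_def)
    have x: "x = y + c + period b m n"
      by (simp add: y_def)
    have d: "GDERIV (\<lambda>z. (\<phi> \<circ> torus_proj b) (z + (c + period b m n))) y :> grad (\<phi> \<circ> torus_proj b) (y + (c + period b m n))"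
      by (rule GDERIV_shift[OF C1_GDERIV[OF \<phi>]])
    have cong: "\<psi> z = (\<phi> \<circ> torus_proj b) (z + (c + period b m n))" if "z \<in> H" for z
      using that torus_proj_period[of b "z + c" m n] by (simp add: \<psi>_def add.assoc add.commute[of c])
    have "GDERIV \<psi> y :> grad (\<phi> \<circ> torus_proj b) (y + (c + period b m n))"
      by (rule GDERIV_cong_open[OF open_H _ cong d]) (simp_all add: h y_def)
    then have "grad \<psi> y = grad (\<phi> \<circ> torus_proj b) x"
      using grad_eq by (metis x add.assoc)
    moreover have "\<phi> (torus_proj b x) = \<psi> y"
      using h torus_proj_period[of b "y + c" m n] by (simp add: \<psi>_def x[symmetric] y_def[symmetric]) (simp add: x add.commute)
    ultimately show "\<phi> (torus_proj b x) = \<psi> (S x) \<and> grad (\<phi> \<circ> torus_proj b) x = grad (\<psi> \<circ> (\<lambda>x. x)) (S x)"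
      by (simp add: Sx comp_def)
  qed
  ultimately show ?thesis
    by blast
qed

text \<open>The two domains have the same set of eigenvalues, hence the same infimum of it.\<close>
lemma lambda1_cell: "lambda1_torus b D = lambda1_plane H"
proof -
  have "dirichlet_eigenvalue (torus b) (torus_proj b) (fundamental_domain b) D \<mu> \<longleftrightarrow>
      dirichlet_eigenvalue euclidean (\<lambda>x. x) UNIV H \<mu>" for \<mu>
    by (rule dirichlet_eigenvalue_transfer_iff[OF measure_iso_cell pull_test_function push_test_function])
  then show ?thesis
    by (simp add: lambda1_torus_def lambda1_plane_def first_eigenvalue_def fundamental_domain_def)
qed

end

section \<open>The minimal energy is below the energy of each partition\<close>
lemma integrable_surface_measure:
  fixes h :: "plane \<Rightarrow> 'b::euclidean_space"
  assumes "openin (torus b) U" and "continuous_on UNIV h"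
  shows "integrable (surface_measure (fundamental_domain b) (torus_proj b) U) h"
proof -
  let ?A = "fundamental_domain b \<inter> torus_proj b -` U"
  have A: "?A \<in> sets borel"
    using openin_torus_vimage[OF assms(1)] by auto
  have "integrable lborel (\<lambda>x. indicator ({0..1} \<times> {0..b}) x *\<^sub>R h x)"
    using assms(2) by (intro borel_integrable_compact compact_Times continuous_on_subset[OF assms(2)]) auto
  then have "set_integrable lborel ({0..1} \<times> {0..b}) h"
    by (simp add: set_integrable_def)
  then have "set_integrable lborel ?A h"
    by (rule set_integrable_subset) (use A in \<open>auto simp: fundamental_domain_def\<close>)
  then show ?thesis
    using A by (simp add: surface_measure_def integrable_restrict_space set_integrable_def)
qed

text \<open>Testing the weak equation with the functions \<open>v n\<close> that approximate \<open>u\<close> leads to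
  \<open>\<integral>|g|\<^sup>2 = \<mu> * \<integral>u\<^sup>2\<close> in the limit. The sign of \<open>\<mu>\<close> already follows from the lower bounds
  \<open>- |grad (v n) - g|\<^sup>2\<close> for \<open>2 * (g \<bullet> grad (v n))\<close> and \<open>u\<^sup>2 - (v n - u)\<^sup>2\<close> for \<open>2 * u * v n\<close>.\<close>
lemma dirichlet_eigenvalue_torus_nonneg:
  assumes U: "openin (torus b) U"
    and ev: "dirichlet_eigenvalue (torus b) (torus_proj b) (fundamental_domain b) U \<mu>"
  shows "0 \<le> \<mu>"
proof (rule ccontr)
  assume neg: "\<not> 0 \<le> \<mu>"
  define M where "M = surface_measure (fundamental_domain b) (torus_proj b) U"
  obtain u g where u: "H10 (torus b) (torus_proj b) (fundamental_domain b) U u g"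
    and nz: "\<not> (AE x in M. u x = 0)"
    and eq: "\<And>\<psi>. \<psi> \<in> test_functions (torus b) (torus_proj b) U \<Longrightarrow>
      (\<integral>x. g x \<bullet> grad (\<psi> \<circ> torus_proj b) x \<partial>M) = \<mu> * (\<integral>x. u x * \<psi> (torus_proj b x) \<partial>M)"
    using ev unfolding dirichlet_eigenvalue_def M_def[symmetric] Let_def by blast
  from u obtain \<phi> where L2: "L2_function M u" "L2_function M g"
    and \<phi>: "\<And>n. \<phi> n \<in> test_functions (torus b) (torus_proj b) U"
    and lim: "(\<lambda>n. \<integral>x. (\<phi> n (torus_proj b x) - u x)\<^sup>2 \<partial>M) \<longlonglongrightarrow> 0"
      "(\<lambda>n. \<integral>x. (norm (grad (\<phi> n \<circ> torus_proj b) x - g x))\<^sup>2 \<partial>M) \<longlonglongrightarrow> 0"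
    unfolding H10_def M_def[symmetric] Let_def by blast
  have [measurable]: "u \<in> borel_measurable M" "g \<in> borel_measurable M"
    and iu: "integrable M (\<lambda>x. (u x)\<^sup>2)" and ig: "integrable M (\<lambda>x. (norm (g x))\<^sup>2)"
    using L2 by (auto simp: L2_function_def)
  define v where "v n = \<phi> n \<circ> torus_proj b" for n
  have C1: "C1 (v n)" for n
    using \<phi> by (simp add: test_functions_iff v_def)
  have cont: "continuous_on UNIV (v n)" "continuous_on UNIV (grad (v n))" for n
    using C1 C1_continuous C1_continuous_grad by blast+
  have integr: "integrable M h" if "continuous_on UNIV h" for h :: "plane \<Rightarrow> real"
    unfolding M_def by (rule integrable_surface_measure[OF U that])
  have integr2: "integrable M h" if "continuous_on UNIV h" for h :: "plane \<Rightarrow> plane"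
    unfolding M_def by (rule integrable_surface_measure[OF U that])
  have [measurable]: "v n \<in> borel_measurable M" "grad (v n) \<in> borel_measurable M" for n
    using integr[OF cont(1)] integr2[OF cont(2)] by auto
  have iv: "integrable M (\<lambda>x. (v n x)\<^sup>2)" "integrable M (\<lambda>x. (norm (grad (v n) x))\<^sup>2)" for n
    using cont by (auto intro!: integr continuous_intros)
  have expand: "(norm (p - q))\<^sup>2 = (norm p)\<^sup>2 + (norm q)\<^sup>2 - 2 * (q \<bullet> p)" for p q :: plane
    by (simp add: power2_norm_eq_inner inner_diff inner_commute)
  have pos: "0 \<le> (norm p)\<^sup>2 + (norm q)\<^sup>2 + 2 * (q \<bullet> p)" for p q :: plane
    using zero_le_power2[of "norm (p + q)"] unfolding power2_norm_eq_inner
    by (simp add: inner_add inner_commute)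
  have ip1: "integrable M (\<lambda>x. g x \<bullet> grad (v n) x)" for n
  proof (rule Bochner_Integration.integrable_bound[OF Bochner_Integration.integrable_add[OF ig iv(2)[of n]]])
    show "AE x in M. norm (g x \<bullet> grad (v n) x) \<le> norm ((norm (g x))\<^sup>2 + (norm (grad (v n) x))\<^sup>2)"
    proof (rule AE_I2)
      fix x
      show "norm (g x \<bullet> grad (v n) x) \<le> norm ((norm (g x))\<^sup>2 + (norm (grad (v n) x))\<^sup>2)"
        using expand[of "grad (v n) x" "g x"] pos[of "grad (v n) x" "g x"]
          zero_le_power2[of "norm (grad (v n) x - g x)"]
        unfolding real_norm_def by linarith
    qed
  qed simp
  have ip2: "integrable M (\<lambda>x. u x * v n x)" for n
  proof (rule Bochner_Integration.integrable_bound[OF Bochner_Integration.integrable_add[OF iu iv(1)[of n]]])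
    show "AE x in M. norm (u x * v n x) \<le> norm ((u x)\<^sup>2 + (v n x)\<^sup>2)"
    proof (rule AE_I2)
      fix x
      have "2 * (\<bar>u x\<bar> * \<bar>v n x\<bar>) \<le> (u x)\<^sup>2 + (v n x)\<^sup>2"
        using sum_squares_bound[of "\<bar>u x\<bar>" "\<bar>v n x\<bar>"] by simp
      then show "norm (u x * v n x) \<le> norm ((u x)\<^sup>2 + (v n x)\<^sup>2)"
        by (simp add: abs_mult) (smt (verit) mult_nonneg_nonneg abs_ge_zero)
    qed
  qed simp
  have low1: "- (\<integral>x. (norm (grad (v n) x - g x))\<^sup>2 \<partial>M) \<le> 2 * (\<integral>x. g x \<bullet> grad (v n) x \<partial>M)" for n
  proof -
    have "(\<integral>x. (norm (grad (v n) x - g x))\<^sup>2 \<partial>M) =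
        (\<integral>x. (norm (grad (v n) x))\<^sup>2 \<partial>M) + (\<integral>x. (norm (g x))\<^sup>2 \<partial>M) - 2 * (\<integral>x. g x \<bullet> grad (v n) x \<partial>M)"
      unfolding expand using ig iv(2)[of n] ip1[of n] by simp
    moreover have "0 \<le> (\<integral>x. (norm (grad (v n) x))\<^sup>2 \<partial>M)" "0 \<le> (\<integral>x. (norm (g x))\<^sup>2 \<partial>M)"
      by simp_all
    ultimately show ?thesis
      by linarith
  qed
  have low2: "(\<integral>x. (u x)\<^sup>2 \<partial>M) - (\<integral>x. (v n x - u x)\<^sup>2 \<partial>M) \<le> 2 * (\<integral>x. u x * v n x \<partial>M)" for n
  proof -
    have "(\<integral>x. (v n x - u x)\<^sup>2 \<partial>M) =
        (\<integral>x. (v n x)\<^sup>2 \<partial>M) + (\<integral>x. (u x)\<^sup>2 \<partial>M) - 2 * (\<integral>x. u x * v n x \<partial>M)"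
    proof -
      have "(v n x - u x)\<^sup>2 = (v n x)\<^sup>2 + (u x)\<^sup>2 - 2 * (u x * v n x)" for x
        by (simp add: power2_diff)
      then show ?thesis
        using iu iv(1)[of n] ip2[of n] by simp
    qed
    moreover have "0 \<le> (\<integral>x. (v n x)\<^sup>2 \<partial>M)"
      by simp
    ultimately show ?thesis
      by linarith
  qed
  have "- (\<integral>x. (norm (grad (v n) x - g x))\<^sup>2 \<partial>M) \<le>
      \<mu> * ((\<integral>x. (u x)\<^sup>2 \<partial>M) - (\<integral>x. (v n x - u x)\<^sup>2 \<partial>M))" for n
  proof -
    have "2 * (\<integral>x. g x \<bullet> grad (v n) x \<partial>M) = \<mu> * (2 * (\<integral>x. u x * v n x \<partial>M))"
      using eq[OF \<phi>, of n] by (simp add: v_def)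
    also have "\<dots> \<le> \<mu> * ((\<integral>x. (u x)\<^sup>2 \<partial>M) - (\<integral>x. (v n x - u x)\<^sup>2 \<partial>M))"
      using low2[of n] neg by (intro mult_left_mono_neg) auto
    finally show ?thesis
      using low1[of n] by linarith
  qed
  then have "- 0 \<le> \<mu> * ((\<integral>x. (u x)\<^sup>2 \<partial>M) - 0)"
    using lim unfolding v_def comp_def
    by (intro LIMSEQ_le[OF tendsto_minus[OF lim(2)] tendsto_mult_left[OF tendsto_diff[OF tendsto_const lim(1)]]])
      (auto simp: comp_def)
  then have "(\<integral>x. (u x)\<^sup>2 \<partial>M) \<le> 0"
    using neg by (simp add: zero_le_mult_iff)
  then have "(\<integral>x. (u x)\<^sup>2 \<partial>M) = 0"
    by (simp add: antisym)
  then have "AE x in M. (u x)\<^sup>2 = 0"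
    using integral_nonneg_eq_0_iff_AE[OF iu] by simp
  then show False
    using nz by simp
qed

text \<open>The energies are bounded below: a first eigenvalue on the torus is the infimum of a set of nonnegative
  numbers, which is nonnegative or, if the set is empty, the fixed real number \<open>Inf {}\<close>.\<close>
lemma minimal_energy_le:
  assumes "1 \<le> k" and "partition_of_torus b k D"
    and "\<And>i. i \<in> {1..k} \<Longrightarrow> lambda1_torus b (D i) \<le> c"
  shows "minimal_energy k b \<le> c"
proof -
  have low: "min 0 (Inf {}) \<le> lambda1_torus b U" if "openin (torus b) U" for U
  proof (cases "{\<mu>. dirichlet_eigenvalue (torus b) (torus_proj b) (fundamental_domain b) U \<mu>} = {}")
    case True
    then show ?thesis
      by (simp add: lambda1_torus_def first_eigenvalue_def flip: fundamental_domain_def)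
  next
    case False
    then have "0 \<le> lambda1_torus b U"
      unfolding lambda1_torus_def first_eigenvalue_def fundamental_domain_def[symmetric]
      using dirichlet_eigenvalue_torus_nonneg[OF that] by (intro cInf_greatest) auto
    then show ?thesis
      by simp
  qed
  have "min 0 (Inf {}) \<le> energy b k D'" if "partition_of_torus b k D'" for D'
  proof -
    have "openin (torus b) (D' 1)"
      using that assms(1) by (simp add: partition_of_torus_def)
    from low[OF this] show ?thesis
      unfolding energy_def using assms(1) by (auto intro: order.trans Max_ge)
  qed
  then have "bdd_below {energy b k D |D. partition_of_torus b k D}"
    by (auto intro!: bdd_belowI)
  then have "minimal_energy k b \<le> energy b k D"
    unfolding minimal_energy_def using assms(2) by (intro cInf_lower) auto
  also have "\<dots> \<le> c"
    unfolding energy_def using assms(1,3) by (subst Max_le_iff) auto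
  finally show ?thesis .
qed

section \<open>Vertical strips\<close>
definition strip :: "real \<Rightarrow> real \<Rightarrow> real \<Rightarrow> plane set set" where
  "strip b l r = torus_proj b ` ({l<..<r} \<times> UNIV)"

lemma in_strip_iff: "torus_proj b x \<in> strip b l r \<longleftrightarrow> (\<exists>m. fst x - of_int m \<in> {l<..<r})"
proof
  assume "torus_proj b x \<in> strip b l r"
  then obtain y where y: "fst y \<in> {l<..<r}" "torus_proj b y = torus_proj b x"
    unfolding strip_def by force
  then obtain m n where "x = y + period b m n"
    using torus_proj_eq_iff by blast
  then have "fst x - of_int m = fst y"
    by (simp add: period_def)
  with y(1) show "\<exists>m. fst x - of_int m \<in> {l<..<r}"
    by metis
next
  assume "\<exists>m. fst x - of_int m \<in> {l<..<r}"
  then obtain m where m: "fst x - of_int m \<in> {l<..<r}" by blast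
  have "x - period b m 0 \<in> {l<..<r} \<times> UNIV"
    using m by (cases x) (simp add: period_def)
  then show "torus_proj b x \<in> strip b l r"
    unfolding strip_def by (metis torus_proj_period_diff imageI)
qed

lemma openin_strip: "openin (torus b) (strip b l r)"
  unfolding strip_def by (intro openin_torus_image open_Times) auto

lemma GDERIV_fst:
  assumes "(h has_real_derivative d) (at (fst x))"
  shows "GDERIV (\<lambda>x::plane. h (fst x)) x :> (d, 0)"
proof -
  have "((\<lambda>x. h (fst x)) has_derivative (\<lambda>y. d * fst y)) (at x)"
    using has_derivative_compose[of fst fst x UNIV h "\<lambda>y. d * y"] assms
    by (simp add: has_field_derivative_def has_derivative_fst)
  then show ?thesis
    unfolding gderiv_def by (simp add: inner_prod_def mult.commute)
qed

lemma C1_fst: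
  assumes "\<And>t. (h has_real_derivative h' t) (at t)" "continuous_on UNIV h'"
  shows "C1 (\<lambda>x. h (fst x))"
  unfolding C1_def
proof (intro exI conjI allI)
  show "GDERIV (\<lambda>x. h (fst x)) x :> (h' (fst x), 0)" for x :: plane
    by (rule GDERIV_fst[OF assms(1)])
  show "continuous_on UNIV (\<lambda>x::plane. (h' (fst x), 0))"
    by (intro continuous_intros continuous_on_compose2[OF assms(2)]) auto
qed

text \<open>A function of class \<open>C\<^sup>1\<close> that vanishes for \<open>s \<le> e\<close>, has slope at most \<open>1\<close>, and tends to the
  identity on the positive half-line as \<open>e\<close> tends to \<open>0\<close>. Applied to a positive function with boundary
  values \<open>0\<close>, it produces compactly supported approximations.\<close>
definition cutoff :: "real \<Rightarrow> real \<Rightarrow> real" where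
  "cutoff e s = sqrt (e\<^sup>2 + (max 0 (s - e))\<^sup>2) - e"

definition cutoff' :: "real \<Rightarrow> real \<Rightarrow> real" where
  "cutoff' e s = max 0 (s - e) / sqrt (e\<^sup>2 + (max 0 (s - e))\<^sup>2)"

lemma DERIV_max_square: "((\<lambda>t::real. (max 0 t)\<^sup>2) has_real_derivative 2 * max 0 t) (at t)"
proof -
  consider "t > 0" | "t < 0" | "t = 0" by linarith
  then show ?thesis
  proof cases
    case 1
    have "((\<lambda>t::real. t\<^sup>2) has_real_derivative 2 * max 0 t) (at t)"
      using 1 by (auto intro!: derivative_eq_intros)
    then show ?thesis
      by (rule has_field_derivative_transform_within_open[where S = "{0<..}"]) (use 1 in auto)
  next
    case 2
    have "((\<lambda>t::real. 0) has_real_derivative 2 * max 0 t) (at t)"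
      using 2 by (auto intro!: derivative_eq_intros)
    then show ?thesis
      by (rule has_field_derivative_transform_within_open[where S = "{..<0}"]) (use 2 in auto)
  next
    case 3
    have "(\<lambda>h::real. ((max 0 (0 + h))\<^sup>2 - (max 0 0)\<^sup>2) / h) \<midarrow>0\<rightarrow> 0"
    proof (rule Lim_null_comparison)
      show "\<forall>\<^sub>F h in at 0. norm (((max 0 (0 + h))\<^sup>2 - (max 0 0)\<^sup>2) / h) \<le> \<bar>h::real\<bar>"
        by (intro always_eventually allI) (auto simp: max_def power2_eq_square)
      show "((\<lambda>h::real. \<bar>h\<bar>) \<longlongrightarrow> 0) (at 0)"
        using tendsto_rabs[OF tendsto_ident_at, of 0 UNIV] by simp
    qed
    then show ?thesis
      unfolding 3 DERIV_def by simp
  qed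
qed

lemma DERIV_cutoff:
  assumes "e > 0"
  shows "(cutoff e has_real_derivative cutoff' e s) (at s)"
proof -
  have pos: "0 < e\<^sup>2 + (max 0 (s - e))\<^sup>2"
    using assms by (simp add: add_pos_nonneg)
  have "((\<lambda>s. (max 0 (s - e))\<^sup>2) has_real_derivative 2 * max 0 (s - e)) (at s)"
    using DERIV_shift[of "\<lambda>t. (max 0 t)\<^sup>2" "2 * max 0 (s - e)" s "- e"] DERIV_max_square[of "s - e"]
    by simp
  from DERIV_add[OF DERIV_const[of "e\<^sup>2"] this]
  have "((\<lambda>s. e\<^sup>2 + (max 0 (s - e))\<^sup>2) has_real_derivative 2 * max 0 (s - e)) (at s)"
    by simp
  from DERIV_diff[OF DERIV_chain2[OF DERIV_real_sqrt[OF pos] this] DERIV_const[of e]]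
  show ?thesis
    unfolding cutoff_def[abs_def] cutoff'_def by (simp add: field_simps)
qed

lemma continuous_cutoff':
  assumes "e > 0" shows "continuous_on UNIV (cutoff' e)"
proof -
  have "0 < e\<^sup>2 + (max 0 (s - e))\<^sup>2" for s
    using assms by (simp add: add_pos_nonneg)
  then have "sqrt (e\<^sup>2 + (max 0 (s - e))\<^sup>2) \<noteq> 0" for s
    by (metis less_irrefl real_sqrt_gt_0_iff)
  then show ?thesis
    unfolding cutoff'_def[abs_def] by (intro continuous_intros) auto
qed

lemma cutoff_zero: "e > 0 \<Longrightarrow> s \<le> e \<Longrightarrow> cutoff e s = 0"
  by (simp add: cutoff_def)

lemma cutoff_bounds:
  assumes "e > 0" "s \<ge> 0"
  shows "0 \<le> cutoff e s" "cutoff e s \<le> s"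
proof -
  have "sqrt (e\<^sup>2) \<le> sqrt (e\<^sup>2 + (max 0 (s - e))\<^sup>2)"
    by (rule real_sqrt_le_mono) simp
  then show "0 \<le> cutoff e s"
    using assms by (simp add: cutoff_def)
  have "sqrt (e\<^sup>2 + (max 0 (s - e))\<^sup>2) \<le> e + max 0 (s - e)"
    using assms by (intro real_le_lsqrt) (auto simp: power2_sum)
  moreover have "s \<le> e \<Longrightarrow> sqrt (e\<^sup>2 + (max 0 (s - e))\<^sup>2) = e"
    using assms by simp
  ultimately show "cutoff e s \<le> s"
    using assms by (cases "s \<le> e") (auto simp: cutoff_def max_def split: if_splits)
qed

lemma cutoff'_bounds:
  assumes "e > 0"
  shows "0 \<le> cutoff' e s" "cutoff' e s \<le> 1"
proof -
  have "max 0 (s - e) \<le> sqrt (e\<^sup>2 + (max 0 (s - e))\<^sup>2)"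
    by (rule real_le_rsqrt) simp
  moreover have "0 < e\<^sup>2 + (max 0 (s - e))\<^sup>2"
    using assms by (simp add: add_pos_nonneg)
  ultimately show "0 \<le> cutoff' e s" "cutoff' e s \<le> 1"
    by (auto simp: cutoff'_def)
qed

lemma cutoff_limits:
  assumes s: "s > 0" and e: "e \<longlonglongrightarrow> 0"
  shows "(\<lambda>n. cutoff (e n) s) \<longlonglongrightarrow> s" "(\<lambda>n. cutoff' (e n) s) \<longlonglongrightarrow> 1"
proof -
  have m: "(\<lambda>n. max 0 (s - e n)) \<longlonglongrightarrow> s"
    using tendsto_max[OF tendsto_const tendsto_diff[OF tendsto_const e], of 0 s] s by simp
  have r: "(\<lambda>n. sqrt ((e n)\<^sup>2 + (max 0 (s - e n))\<^sup>2)) \<longlonglongrightarrow> s"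
    using tendsto_real_sqrt[OF tendsto_add[OF tendsto_power[OF e, of 2] tendsto_power[OF m, of 2]]] s
    by simp
  show "(\<lambda>n. cutoff (e n) s) \<longlonglongrightarrow> s"
    unfolding cutoff_def using tendsto_diff[OF r e] by simp
  show "(\<lambda>n. cutoff' (e n) s) \<longlonglongrightarrow> 1"
    unfolding cutoff'_def using tendsto_divide[OF m r] s by simp
qed

locale torus_strip =
  fixes b l r :: real
  assumes b: "b > 0" and l: "0 \<le> l" and lr: "l < r" and r: "r \<le> 1"
begin

text \<open>The square of \<open>w\<close> is the first Dirichlet eigenvalue of the interval from \<open>l\<close> to \<open>r\<close>.\<close>
definition "w = pi / (r - l)"

lemma w_pos: "w > 0"
  using lr by (simp add: w_def)

abbreviation "M \<equiv> surface_measure (fundamental_domain b) (torus_proj b) (strip b l r)"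

lemma vimage_strip:
  "fundamental_domain b \<inter> torus_proj b -` strip b l r = {l<..<r} \<times> {0..<b}"
proof -
  have "(x \<in> {0..<1} \<and> (\<exists>m. x - of_int m \<in> {l<..<r})) \<longleftrightarrow> x \<in> {l<..<r}" for x
  proof
    assume "x \<in> {0..<1} \<and> (\<exists>m. x - of_int m \<in> {l<..<r})"
    then obtain m where m: "x \<in> {0..<1}" "x - of_int m \<in> {l<..<r}" by blast
    then have "\<bar>of_int m\<bar> < (1::real)"
      using l r by auto
    then have "m = 0"
      by linarith
    with m show "x \<in> {l<..<r}"
      by simp
  next
    assume "x \<in> {l<..<r}"
    then show "x \<in> {0..<1} \<and> (\<exists>m. x - of_int m \<in> {l<..<r})"
      using l r by (intro conjI exI[of _ 0]) auto
  qed
  moreover have "x \<in> fundamental_domain b \<inter> torus_proj b -` strip b l r \<longleftrightarrow>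
      (fst x \<in> {0..<1} \<and> (\<exists>m. fst x - of_int m \<in> {l<..<r})) \<and> snd x \<in> {0..<b}" for x
    unfolding fundamental_domain_def mem_Times_iff Int_iff vimage_eq in_strip_iff by argo
  ultimately show ?thesis
    by (intro set_eqI) (simp only: mem_Times_iff)
qed

lemma space_M: "space M = {l<..<r} \<times> {0..<b}"
  using vimage_strip by (simp add: surface_measure_def space_restrict_space)

lemma finite_M: "integrable M (\<lambda>x. c :: real)"
  by (rule integrable_surface_measure[OF openin_strip]) simp

lemma sin_pos:
  assumes "t \<in> {l<..<r}" shows "sin (w * (t - l)) > 0"
proof (rule sin_gt_zero)
  show "0 < w * (t - l)"
    using assms w_pos by simp
  have "w * (t - l) < w * (r - l)"
    using assms w_pos by simp
  then show "w * (t - l) < pi"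
    using lr by (simp add: w_def)
qed

text \<open>The support is contained in the image of \<open>K\<close>, the compact part of the closed strip on which the sine is
  at least \<open>e\<close>; since the sine vanishes at \<open>l\<close> and \<open>r\<close>, this part lies in the open strip.\<close>
lemma approx_test_function:
  assumes e: "e > 0"
  shows "\<exists>\<phi>\<in>test_functions (torus b) (torus_proj b) (strip b l r). \<forall>x\<in>space M.
    \<phi> (torus_proj b x) = cutoff e (sin (w * (fst x - l))) \<and>
    grad (\<phi> \<circ> torus_proj b) x = (cutoff' e (sin (w * (fst x - l))) * (w * cos (w * (fst x - l))), 0)"
proof -
  define h where "h t = cutoff e (sin (w * (t - l)))" for t
  define h' where "h' t = cutoff' e (sin (w * (t - l))) * (w * cos (w * (t - l)))" for t
  have Dh: "(h has_real_derivative h' t) (at t)" for t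
    unfolding h_def[abs_def] h'_def
    by (rule DERIV_chain2[OF DERIV_cutoff[OF e]]) (auto intro!: derivative_eq_intros)
  have Ch: "continuous_on UNIV h'"
    unfolding h'_def[abs_def]
    by (intro continuous_intros continuous_on_compose2[OF continuous_cutoff'[OF e]]) auto
  define \<phi> where "\<phi> d = (if d \<in> strip b l r
    then h (fst (SOME y. fst y \<in> {l<..<r} \<and> torus_proj b y = d)) else 0)" for d
  have \<phi>_eq: "\<phi> (torus_proj b x) = h (fst x - of_int m)" if m: "fst x - of_int m \<in> {l<..<r}" for x m
  proof -
    define y where "y = (SOME y. fst y \<in> {l<..<r} \<and> torus_proj b y = torus_proj b x)"
    have "fst (x - period b m 0) \<in> {l<..<r} \<and> torus_proj b (x - period b m 0) = torus_proj b x"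
      using m by (intro conjI torus_proj_period_diff) (simp add: period_def)
    then have y: "fst y \<in> {l<..<r}" "torus_proj b y = torus_proj b x"
      unfolding y_def by (metis (mono_tags, lifting) someI_ex)+
    then obtain m' n where "x = y + period b m' n"
      using torus_proj_eq_iff by blast
    then have x: "fst x = fst y + of_int m'"
      by (simp add: period_def)
    then have "\<bar>of_int (m' - m)\<bar> < (1::real)"
      using m y(1) l r by auto
    then have "m' = m"
      by linarith
    moreover have "torus_proj b x \<in> strip b l r"
      using m in_strip_iff by blast
    ultimately show ?thesis
      using x by (simp only: \<phi>_def y_def[symmetric] if_True) simp
  qed
  define K where "K = ({l..r} \<inter> {t. e \<le> sin (w * (t - l))}) \<times> {0..b}"
  define KD where "KD = torus_proj b ` K"
  have "closed {t. e \<le> sin (w * (t - l))}"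
    by (intro closed_Collect_le continuous_intros)
  then have "compact K"
    unfolding K_def by (intro compact_Times compact_Int_closed) auto
  then have KD: "closedin (torus b) KD" "compactin (torus b) KD"
    using b by (auto simp: KD_def intro!: closedin_torus_image_compact compactin_torus_image)
  have KDs: "KD \<subseteq> strip b l r"
  proof -
    have "t \<noteq> l \<and> t \<noteq> r" if "e \<le> sin (w * (t - l))" for t
      using that e lr by (auto simp: w_def)
    then have "K \<subseteq> {l<..<r} \<times> UNIV"
      by (fastforce simp: K_def)
    then show ?thesis
      by (auto simp: KD_def strip_def)
  qed
  have \<phi>_zero: "\<phi> (torus_proj b x) = 0" if x: "torus_proj b x \<notin> KD" for x
  proof (cases "torus_proj b x \<in> strip b l r")
    case True
    then obtain m where m: "fst x - of_int m \<in> {l<..<r}"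
      using in_strip_iff by blast
    obtain t where t: "t = fst x - of_int m" "t \<in> {l<..<r}"
      using m by blast
    define z where "z = x - period b m \<lfloor>snd x / b\<rfloor>"
    have "snd (torus_reduce b x) = snd z" "fst z = t"
      by (simp_all add: torus_reduce_def period_def z_def t)
    then have "snd z \<in> {0..b}"
      using torus_reduce_in[OF b, of x] by (auto simp: fundamental_domain_def mem_Times_iff)
    moreover have "z \<notin> K"
      using x unfolding KD_def z_def by (metis imageI torus_proj_period_diff)
    ultimately have "sin (w * (t - l)) \<le> e"
      using t \<open>fst z = t\<close> by (auto simp: K_def mem_Times_iff)
    then show ?thesis
      using \<phi>_eq[OF m] t cutoff_zero[OF e] by (simp add: h_def)
  qed (simp add: \<phi>_def)
  have local: "open {x::plane. fst x - of_int m \<in> {l<..<r}}" for m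
  proof -
    have "open ((\<lambda>x::plane. fst x - of_int m) -` {l<..<r})"
      by (intro open_vimage continuous_intros)
    then show ?thesis
      by (simp add: vimage_def)
  qed
  have C1h: "C1 (\<lambda>x. h (fst x - c))" for c
  proof (rule C1_fst[of "\<lambda>t. h (t - c)" "\<lambda>t. h' (t - c)"])
    show "((\<lambda>t. h (t - c)) has_real_derivative h' (t - c)) (at t)" for t
      using DERIV_shift[of h "h' (t - c)" t "- c"] Dh by simp
    show "continuous_on UNIV (\<lambda>t. h' (t - c))"
      by (intro continuous_on_compose2[OF Ch] continuous_intros) simp
  qed
  have "C1 (\<phi> \<circ> torus_proj b)"
  proof (rule C1_local)
    fix x
    show "\<exists>V h. open V \<and> x \<in> V \<and> C1 h \<and> (\<forall>y\<in>V. (\<phi> \<circ> torus_proj b) y = h y)"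
    proof (cases "torus_proj b x \<in> strip b l r")
      case True
      then obtain m where m: "fst x - of_int m \<in> {l<..<r}"
        using in_strip_iff by blast
      show ?thesis
        using m local[of m] C1h \<phi>_eq
        by (intro exI[of _ "{x. fst x - of_int m \<in> {l<..<r}}"] exI[of _ "\<lambda>x. h (fst x - of_int m)"])
          (simp del: greaterThanLessThan_iff)
    next
      case False
      have "open (- (torus_proj b -` KD))"
        using KD(1) by (simp add: closedin_torus_iff open_Compl)
      moreover have "x \<in> - (torus_proj b -` KD)"
        using False KDs by auto
      ultimately show ?thesis
        using C1_zero \<phi>_zero
        by (intro exI[of _ "- (torus_proj b -` KD)"] exI[of _ "\<lambda>x. 0"]) auto
    qed
  qed
  moreover have sub: "torus b closure_of {d. \<phi> d \<noteq> 0} \<subseteq> KD"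
  proof (rule closure_of_minimal[OF _ KD(1)])
    have "d \<in> KD" if "\<phi> d \<noteq> 0" for d
    proof -
      have "d \<in> strip b l r"
        using that by (auto simp: \<phi>_def split: if_splits)
      then obtain x where "d = torus_proj b x"
        by (auto simp: strip_def)
      then show ?thesis
        using \<phi>_zero that by blast
    qed
    then show "{d. \<phi> d \<noteq> 0} \<subseteq> KD"
      by blast
  qed
  ultimately have "\<phi> \<in> test_functions (torus b) (torus_proj b) (strip b l r)"
    unfolding test_functions_iff using closed_compactin[OF KD(2) sub] KDs by auto
  moreover have "\<phi> (torus_proj b x) = h (fst x) \<and> grad (\<phi> \<circ> torus_proj b) x = (h' (fst x), 0)"
    if x: "x \<in> space M" for x
  proof
    have x0: "fst x - of_int 0 \<in> {l<..<r}"
      using x by (auto simp: space_M)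
    show "\<phi> (torus_proj b x) = h (fst x)"
      using \<phi>_eq[OF x0] by simp
    have "GDERIV (\<phi> \<circ> torus_proj b) x :> (h' (fst x), 0)"
    proof (rule GDERIV_cong_open[OF local[of 0]])
      show "x \<in> {x. fst x - of_int 0 \<in> {l<..<r}}"
        using x0 by blast
      show "GDERIV (\<lambda>x. h (fst x)) x :> (h' (fst x), 0)"
        by (rule GDERIV_fst[OF Dh])
      show "(\<phi> \<circ> torus_proj b) y = h (fst y)" if "y \<in> {x. fst x - of_int 0 \<in> {l<..<r}}" for y
        using that \<phi>_eq[of y 0] by simp
    qed
    then show "grad (\<phi> \<circ> torus_proj b) x = (h' (fst x), 0)"
      by (rule grad_eq)
  qed
  ultimately show ?thesis
    unfolding h_def h'_def by blast
qed

text \<open>Integration by parts in the first variable: the difference of the integrands is the derivative of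
  \<open>w * cos (w * (s - l)) * v (s, y)\<close> with respect to \<open>s\<close>, and \<open>v\<close> vanishes for \<open>s = l\<close> and \<open>s = r\<close>.\<close>
lemma weak_equation:
  assumes "\<phi> \<in> test_functions (torus b) (torus_proj b) (strip b l r)"
  shows "(\<integral>x. (w * cos (w * (fst x - l)), 0) \<bullet> grad (\<phi> \<circ> torus_proj b) x \<partial>M) =
    w\<^sup>2 * (\<integral>x. sin (w * (fst x - l)) * \<phi> (torus_proj b x) \<partial>M)"
proof -
  define v where "v = \<phi> \<circ> torus_proj b"
  define KD where "KD = torus b closure_of {d. \<phi> d \<noteq> 0}"
  have C1: "C1 v" and KD: "KD \<subseteq> strip b l r" "closedin (torus b) KD"
    using assms by (auto simp: test_functions_iff KD_def v_def)
  have v_zero: "v x = 0" if "torus_proj b x \<notin> KD" for x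
    using that closure_of_subset_Int[of "torus b" "{d. \<phi> d \<noteq> 0}"]
    by (auto simp: KD_def topspace_torus v_def)
  \<comment> \<open>The sides of the strip do not meet its image in the torus, since \<open>r - l \<le> 1\<close>; hence \<open>v\<close> vanishes near them.\<close>
  have ends: "v x = 0 \<and> grad v x = 0" if x: "fst x = l \<or> fst x = r" for x
  proof -
    have "torus_proj b x \<notin> strip b l r"
    proof
      assume "torus_proj b x \<in> strip b l r"
      then obtain m where "fst x - of_int m \<in> {l<..<r}"
        using in_strip_iff by blast
      then have "\<bar>of_int m\<bar> < (1::real)" "m \<noteq> 0"
        using x l r by auto
      then show False
        by linarith
    qed
    then have K: "x \<in> - (torus_proj b -` KD)"
      using KD(1) by auto
    have "open (- (torus_proj b -` KD))"
      using KD(2) by (simp add: closedin_torus_iff open_Compl)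
    then have "GDERIV v x :> 0"
      by (rule GDERIV_cong_open[OF _ K]) (auto simp: v_zero GDERIV_const)
    then show ?thesis
      using K v_zero grad_eq by auto
  qed
  define g where "g x = w * cos (w * (fst x - l)) * fst (grad v x)" for x
  define q where "q x = w\<^sup>2 * (sin (w * (fst x - l)) * v x)" for x
  have cont: "continuous_on UNIV v" "continuous_on UNIV (grad v)"
    using C1 C1_continuous C1_continuous_grad by blast+
  have cg: "continuous_on UNIV g" and cq: "continuous_on UNIV q"
    unfolding g_def[abs_def] q_def[abs_def] by (intro continuous_intros cont)+
  have gq0: "(\<integral>x. g x - q x \<partial>M) = 0"
  proof -
    let ?A = "{l<..<r} \<times> {0..<b} :: plane set"
    have A: "?A \<in> sets borel"
      by (simp add: borel_Times)
    have M: "M = restrict_space lborel ?A"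
      by (simp add: surface_measure_def vimage_strip)
    have "integrable M (\<lambda>x. g x - q x)"
      by (intro integrable_surface_measure openin_strip continuous_intros cg cq)
    then have int: "integrable lborel (\<lambda>x. indicator ?A x * (g x - q x))"
      using A unfolding M by (simp add: integrable_restrict_space)
    \<comment> \<open>As the integrand vanishes on the sides, the open interval may be replaced by the closed one.\<close>
    have split: "indicator ?A (s, y) * (g (s, y) - q (s, y)) =
        indicator {0..<b} y * (indicator {l..r} s *\<^sub>R (g (s, y) - q (s, y)))" for s y
      using ends[of "(s, y)"] by (auto simp: indicator_def g_def q_def)
    have inner: "(\<integral>s. indicator {l..r} s *\<^sub>R (g (s, y) - q (s, y)) \<partial>lborel) = 0" for y
    proof -
      let ?P = "\<lambda>s. w * cos (w * (s - l)) * v (s, y)"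
      have Dv: "((\<lambda>s. v (s, y)) has_real_derivative fst (grad v (s, y))) (at s)" for s
      proof -
        have "(v has_derivative (\<lambda>h. h \<bullet> grad v (s, y))) (at (s, y))"
          using C1_GDERIV[OF C1] by (simp add: gderiv_def)
        moreover have "((\<lambda>s. (s, y)) has_derivative (\<lambda>h. (h, 0))) (at s)"
          by (auto intro!: derivative_eq_intros)
        ultimately have "((\<lambda>s. v (s, y)) has_derivative (\<lambda>h. (h, 0) \<bullet> grad v (s, y))) (at s)"
          by (rule has_derivative_compose[rotated])
        then show ?thesis
          unfolding has_field_derivative_def inner_prod_def
          by (rule has_derivative_eq_rhs) (simp add: fun_eq_iff)
      qed
      have "(\<integral>s. indicator {l..r} s *\<^sub>R (g (s, y) - q (s, y)) \<partial>lborel) = ?P r - ?P l"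
      proof (rule integral_FTC_Icc)
        show "l \<le> r"
          using lr by simp
        show "(?P has_vector_derivative (g (s, y) - q (s, y))) (at s within {l..r})" for s
        proof -
          have "(?P has_real_derivative (g (s, y) - q (s, y))) (at s)"
            by (auto intro!: derivative_eq_intros Dv simp: g_def q_def power2_eq_square)
          then show ?thesis
            by (simp add: has_real_derivative_iff_has_vector_derivative has_vector_derivative_at_within)
        qed
        show "continuous_on {l..r} (\<lambda>s. g (s, y) - q (s, y))"
          by (intro continuous_intros continuous_on_compose2[OF cg] continuous_on_compose2[OF cq]) auto
      qed
      also have "\<dots> = 0"
        using ends[of "(l, y)"] ends[of "(r, y)"] by simp
      finally show ?thesis .
    qed
    have "(\<integral>x. g x - q x \<partial>M) = (\<integral>x. indicator ?A x * (g x - q x) \<partial>lborel)"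
      using A unfolding M by (simp add: integral_restrict_space)
    also have "\<dots> = (\<integral>x. (case x of (s, y) \<Rightarrow> indicator ?A (s, y) * (g (s, y) - q (s, y))) \<partial>(lborel \<Otimes>\<^sub>M lborel))"
      by (simp add: lborel_prod case_prod_unfold)
    also have "\<dots> = (\<integral>y. (\<integral>s. indicator ?A (s, y) * (g (s, y) - q (s, y)) \<partial>lborel) \<partial>lborel)"
      by (rule lborel_pair.integral_snd[symmetric])
        (use int in \<open>simp add: lborel_prod case_prod_unfold\<close>)
    also have "\<dots> = 0"
      unfolding split Bochner_Integration.integral_mult_right_zero inner by simp
    finally show ?thesis .
  qed
  have "(\<integral>x. g x - q x \<partial>M) = (\<integral>x. g x \<partial>M) - (\<integral>x. q x \<partial>M)"
    by (intro Bochner_Integration.integral_diff integrable_surface_measure openin_strip cg cq)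
  with gq0 have "(\<integral>x. g x \<partial>M) = (\<integral>x. q x \<partial>M)"
    by simp
  moreover have "(\<lambda>x. (w * cos (w * (fst x - l)), 0) \<bullet> grad v x) = g"
    by (simp add: g_def[abs_def] inner_prod_def)
  ultimately show ?thesis
    by (simp add: q_def v_def)
qed

text \<open>The truncations of the sine converge to it, together with their gradients, by dominated convergence
  on a set of finite measure.\<close>
lemma dirichlet_eigenvalue_strip:
  "dirichlet_eigenvalue (torus b) (torus_proj b) (fundamental_domain b) (strip b l r) (w\<^sup>2)"
proof -
  define u where "u x = sin (w * (fst x - l))" for x :: plane
  define g where "g x = (w * cos (w * (fst x - l)), 0 :: real)" for x :: plane
  define e where "e n = 1 / real (Suc n)" for n
  have e: "e n > 0" "e \<longlonglongrightarrow> 0" for n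
    using LIMSEQ_inverse_real_of_nat by (auto simp: e_def[abs_def] inverse_eq_divide)
  have cu: "continuous_on UNIV u" and cg: "continuous_on UNIV g"
    unfolding u_def[abs_def] g_def[abs_def] by (intro continuous_intros)+
  have L2: "L2_function M u" "L2_function M g"
    unfolding L2_function_def
    by (auto intro!: integrable_surface_measure borel_measurable_integrable openin_strip continuous_intros cu cg)
  obtain \<phi> where \<phi>: "\<And>n. \<phi> n \<in> test_functions (torus b) (torus_proj b) (strip b l r)"
    and \<phi>_eq: "\<And>n x. x \<in> space M \<Longrightarrow> \<phi> n (torus_proj b x) = cutoff (e n) (u x)"
    and \<phi>_grad: "\<And>n x. x \<in> space M \<Longrightarrow> grad (\<phi> n \<circ> torus_proj b) x = cutoff' (e n) (u x) *\<^sub>R g x"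
    using approx_test_function[OF e(1)] unfolding u_def g_def scaleR_Pair real_scaleR_def mult_zero_right
    by metis
  have u_pos: "u x > 0" if "x \<in> space M" for x
    using that sin_pos[of "fst x"] by (auto simp: space_M u_def)
  have C1: "C1 (\<phi> n \<circ> torus_proj b)" for n
    using \<phi> by (simp add: test_functions_iff)
  have c\<phi>: "continuous_on UNIV (\<lambda>x. \<phi> n (torus_proj b x))" "continuous_on UNIV (grad (\<phi> n \<circ> torus_proj b))" for n
    using C1_continuous[OF C1[of n]] C1_continuous_grad[OF C1[of n]] by (auto simp: comp_def)
  have "(\<lambda>n. \<integral>x. (\<phi> n (torus_proj b x) - u x)\<^sup>2 \<partial>M) \<longlonglongrightarrow> (\<integral>x. 0 \<partial>M)"
  proof (rule integral_dominated_convergence[where w = "\<lambda>x. 1"])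
    show "(\<lambda>x. (\<phi> n (torus_proj b x) - u x)\<^sup>2) \<in> borel_measurable M" for n
      by (intro borel_measurable_integrable integrable_surface_measure openin_strip continuous_intros c\<phi> cu)
    show "integrable M (\<lambda>x. 1 :: real)"
      by (rule finite_M)
    show "AE x in M. (\<lambda>n. (\<phi> n (torus_proj b x) - u x)\<^sup>2) \<longlonglongrightarrow> 0"
    proof (rule AE_I2)
      fix x assume x: "x \<in> space M"
      have "(\<lambda>n. (cutoff (e n) (u x) - u x)\<^sup>2) \<longlonglongrightarrow> (u x - u x)\<^sup>2"
        by (intro tendsto_intros cutoff_limits u_pos x e)
      then show "(\<lambda>n. (\<phi> n (torus_proj b x) - u x)\<^sup>2) \<longlonglongrightarrow> 0"
        by (simp add: \<phi>_eq[OF x])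
    qed
    show "AE x in M. norm ((\<phi> n (torus_proj b x) - u x)\<^sup>2) \<le> 1" for n
    proof (rule AE_I2)
      fix x assume x: "x \<in> space M"
      have "\<bar>cutoff (e n) (u x) - u x\<bar> \<le> 1"
        using cutoff_bounds[OF e(1)[of n], of "u x"] u_pos[OF x] sin_le_one[of "w * (fst x - l)"]
        unfolding u_def by linarith
      then show "norm ((\<phi> n (torus_proj b x) - u x)\<^sup>2) \<le> 1"
        by (simp add: \<phi>_eq[OF x] abs_square_le_1)
    qed
  qed simp
  moreover have "(\<lambda>n. \<integral>x. (norm (grad (\<phi> n \<circ> torus_proj b) x - g x))\<^sup>2 \<partial>M) \<longlonglongrightarrow> (\<integral>x. 0 \<partial>M)"
  proof (rule integral_dominated_convergence[where w = "\<lambda>x. w\<^sup>2"])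
    show "(\<lambda>x. (norm (grad (\<phi> n \<circ> torus_proj b) x - g x))\<^sup>2) \<in> borel_measurable M" for n
      by (intro borel_measurable_integrable integrable_surface_measure openin_strip continuous_intros c\<phi> cg)
    show "integrable M (\<lambda>x. w\<^sup>2)"
      by (rule finite_M)
    have norm_eq: "(norm (grad (\<phi> n \<circ> torus_proj b) x - g x))\<^sup>2 = (cutoff' (e n) (u x) - 1)\<^sup>2 * (norm (g x))\<^sup>2"
      if x: "x \<in> space M" for x n
    proof -
      have "grad (\<phi> n \<circ> torus_proj b) x - g x = (cutoff' (e n) (u x) - 1) *\<^sub>R g x"
        by (simp add: \<phi>_grad[OF x] scaleR_left_diff_distrib)
      then show ?thesis
        by (simp add: power_mult_distrib)
    qed
    show "AE x in M. (\<lambda>n. (norm (grad (\<phi> n \<circ> torus_proj b) x - g x))\<^sup>2) \<longlonglongrightarrow> 0"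
    proof (rule AE_I2)
      fix x assume x: "x \<in> space M"
      have "(\<lambda>n. (cutoff' (e n) (u x) - 1)\<^sup>2 * (norm (g x))\<^sup>2) \<longlonglongrightarrow> (1 - 1)\<^sup>2 * (norm (g x))\<^sup>2"
        by (intro tendsto_intros cutoff_limits u_pos x e)
      then show "(\<lambda>n. (norm (grad (\<phi> n \<circ> torus_proj b) x - g x))\<^sup>2) \<longlonglongrightarrow> 0"
        by (simp add: norm_eq[OF x])
    qed
    show "AE x in M. norm ((norm (grad (\<phi> n \<circ> torus_proj b) x - g x))\<^sup>2) \<le> w\<^sup>2" for n
    proof (rule AE_I2)
      fix x assume x: "x \<in> space M"
      have "\<bar>cutoff' (e n) (u x) - 1\<bar> \<le> 1"
        using cutoff'_bounds[OF e(1)[of n], of "u x"] by linarith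
      then have "(cutoff' (e n) (u x) - 1)\<^sup>2 \<le> 1"
        by (simp add: abs_square_le_1)
      moreover have "(norm (g x))\<^sup>2 \<le> w\<^sup>2"
      proof -
        have "(norm (g x))\<^sup>2 = w\<^sup>2 * (cos (w * (fst x - l)))\<^sup>2"
          by (simp add: g_def power2_norm_eq_inner inner_prod_def power_mult_distrib power2_eq_square)
        also have "\<dots> \<le> w\<^sup>2 * 1"
          by (intro mult_left_mono) (simp_all add: abs_square_le_1)
        finally show ?thesis by simp
      qed
      ultimately have "(cutoff' (e n) (u x) - 1)\<^sup>2 * (norm (g x))\<^sup>2 \<le> 1 * w\<^sup>2"
        by (intro mult_mono) auto
      then show "norm ((norm (grad (\<phi> n \<circ> torus_proj b) x - g x))\<^sup>2) \<le> w\<^sup>2"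
        by (simp add: norm_eq[OF x])
    qed
  qed simp
  ultimately have "H10 (torus b) (torus_proj b) (fundamental_domain b) (strip b l r) u g"
    unfolding H10_def Let_def using L2 \<phi> by auto
  moreover have "\<not> (AE x in M. u x = 0)"
  proof
    assume "AE x in M. u x = 0"
    moreover have "AE x in M. u x \<noteq> 0"
      using u_pos by (intro AE_I2) fastforce
    ultimately have "AE x in M. False"
      by eventually_elim auto
    then have "emeasure M (space M) = 0"
      by (simp add: AE_iff_measurable[of "space M"])
    moreover have "emeasure M (space M) = emeasure lborel ({l<..<r} \<times> {0..<b})"
      unfolding space_M unfolding surface_measure_def vimage_strip
      by (subst emeasure_restrict_space) (auto simp: borel_Times)
    moreover have "emeasure lborel ({l<..<r} \<times> {0..<b}) = ennreal ((r - l) * b)"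
      using lr b by (subst lborel_prod[symmetric], subst lborel.emeasure_pair_measure_Times) (auto simp: ennreal_mult)
    ultimately show False
      using lr b by simp
  qed
  ultimately show ?thesis
    unfolding dirichlet_eigenvalue_def Let_def
    using weak_equation unfolding u_def[symmetric] g_def[symmetric] by blast
qed

lemma lambda1_strip: "lambda1_torus b (strip b l r) \<le> w\<^sup>2"
  unfolding lambda1_torus_def first_eigenvalue_def fundamental_domain_def[symmetric]
  using dirichlet_eigenvalue_strip dirichlet_eigenvalue_torus_nonneg[OF openin_strip]
  by (intro cInf_lower) (auto intro!: bdd_belowI)

end

lemma minimal_energy_le_strips:
  assumes "0 < b" "1 \<le> k"
  shows "minimal_energy k b \<le> (real k)\<^sup>2 * pi\<^sup>2"
proof (rule minimal_energy_le[OF assms(2)])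
  let ?D = "\<lambda>i. strip b ((real i - 1) / k) (real i / k)"
  have k: "real k > 0"
    using assms by simp
  show "partition_of_torus b k ?D"
    unfolding partition_of_torus_def
  proof (intro conjI ballI)
    fix i
    show "openin (torus b) (?D i)"
      by (rule openin_strip)
    have "convex ({(real i - 1) / k<..<real i / k} \<times> (UNIV :: real set))"
      by (intro convex_Times) auto
    then have "connected ({(real i - 1) / k<..<real i / k} \<times> (UNIV :: real set))"
      by (rule convex_connected)
    then show "connectedin (torus b) (?D i)"
      unfolding strip_def by (intro connectedin_continuous_map_image[OF continuous_map_torus_proj]) simp
    have "(real i - 1) / k < real i / k"
      using k by (intro divide_strict_right_mono) auto
    then show "?D i \<noteq> {}"
      using dense by (auto simp: strip_def)
  next
    show "disjoint_family_on ?D {1..k}"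
      unfolding disjoint_family_on_def
    proof (intro ballI impI)
      fix i j assume ij: "i \<in> {1..k}" "j \<in> {1..k}" "i \<noteq> j"
      show "?D i \<inter> ?D j = {}"
      proof (rule ccontr)
        assume "?D i \<inter> ?D j \<noteq> {}"
        then obtain x where x: "fst x \<in> {(real i - 1) / k<..<real i / k}" "torus_proj b x \<in> ?D j"
          unfolding strip_def[of b "(real i - 1) / k"] by (force simp: mem_Times_iff)
        then obtain m where m: "fst x - of_int m \<in> {(real j - 1) / k<..<real j / k}"
          using in_strip_iff by blast
        have bounds: "0 \<le> (real n - 1) / k" "real n / k \<le> 1" if "n \<in> {1..k}" for n
          using that by (auto simp: field_simps)
        have "\<bar>of_int m\<bar> < (1::real)"
          using x(1) m bounds[OF ij(1)] bounds[OF ij(2)] by auto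
        then have "m = 0"
          by linarith
        then have "(real i - 1) / k < real j / k" "(real j - 1) / k < real i / k"
          using x(1) m by auto
        then have "real i - 1 < real j" "real j - 1 < real i"
          using k by (auto simp: divide_less_cancel)
        then show False
          using ij(3) by linarith
      qed
    qed
  qed
  fix i assume i: "i \<in> {1..k}"
  interpret torus_strip b "(real i - 1) / k" "real i / k"
    using assms i k by unfold_locales (auto simp: divide_strict_right_mono)
  have "w = pi * k"
    using k unfolding w_def by (simp add: field_simps)
  then show "lambda1_torus b (?D i) \<le> (real k)\<^sup>2 * pi\<^sup>2"
    using lambda1_strip by (simp add: power_mult_distrib mult.commute)
qed

section \<open>Hexagons and honeycombs in the plane\<close>
lemma less_3_cases: "(j::nat) < 3 \<longleftrightarrow> j = 0 \<or> j = 1 \<or> j = 2"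
  by auto

definition cross :: "plane \<Rightarrow> plane \<Rightarrow> real" where
  "cross x y = fst x * snd y - snd x * fst y"

text \<open>The segments from the origin to the points \<open>P j = a j *\<^sub>R e j\<close> form a tripod, and translating it by the
  lattice generated by the differences of the \<open>P j\<close> gives the honeycomb. The structure of the tiling is
  affine and rests on the linear relation between the directions \<open>e j\<close>; the angles come in only with
  \<open>equal_angle_at_vertices\<close>. All computations are made in the coordinates \<open>p\<close> and \<open>q\<close> with
  respect to the basis \<open>e 0\<close>, \<open>e 2\<close>.\<close>
locale honeycomb =
  fixes e :: "nat \<Rightarrow> plane" and a :: "nat \<Rightarrow> real"
  assumes a_pos: "j < 3 \<Longrightarrow> a j > 0"
    and e_sum: "e 0 + e 1 + e 2 = 0"
    and e_indep: "cross (e 0) (e 2) \<noteq> 0"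
begin

definition P :: "nat \<Rightarrow> plane" where "P j = a j *\<^sub>R e j"
definition p :: "plane \<Rightarrow> real" where "p x = cross x (e 2) / cross (e 0) (e 2)"
definition q :: "plane \<Rightarrow> real" where "q x = cross (e 0) x / cross (e 0) (e 2)"

lemma a0: "a 0 > 0" and a1: "a 1 > 0" and a2: "a 2 > 0"
  using a_pos by simp_all

lemma p_simps [simp]: "p (x + y) = p x + p y" "p (x - y) = p x - p y" "p (- x) = - p x"
    "p (s *\<^sub>R x) = s * p x" "p 0 = 0"
  by (simp_all add: p_def cross_def diff_divide_distrib add_divide_distrib algebra_simps)

lemma q_simps [simp]: "q (x + y) = q x + q y" "q (x - y) = q x - q y" "q (- x) = - q x"
    "q (s *\<^sub>R x) = s * q x" "q 0 = 0"
  by (simp_all add: q_def cross_def diff_divide_distrib add_divide_distrib algebra_simps)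

lemma pq_e [simp]: "p (e 0) = 1" "q (e 0) = 0" "p (e 2) = 0" "q (e 2) = 1"
  using e_indep by (simp_all add: p_def q_def cross_def)

lemma pq_e1 [simp]: "p (e (Suc 0)) = -1" "q (e (Suc 0)) = -1"
proof -
  have "e (Suc 0) = - e 0 - e 2"
    using e_sum by (simp add: algebra_simps eq_neg_iff_add_eq_0)
  then show "p (e (Suc 0)) = -1" "q (e (Suc 0)) = -1"
    by simp_all
qed

lemma pq_P [simp]: "p (P 0) = a 0" "q (P 0) = 0" "p (P (Suc 0)) = - a (Suc 0)" "q (P (Suc 0)) = - a (Suc 0)"
    "p (P 2) = 0" "q (P 2) = a 2"
  by (simp_all add: P_def)

lemma pq_expand: "x = p x *\<^sub>R e 0 + q x *\<^sub>R e 2"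
proof -
  have *: "cross (e 0) (e 2) *\<^sub>R x = cross x (e 2) *\<^sub>R e 0 + cross (e 0) x *\<^sub>R e 2"
    by (cases x; cases "e 0"; cases "e 2") (simp add: cross_def algebra_simps)
  have "x = (1 / cross (e 0) (e 2)) *\<^sub>R (cross (e 0) (e 2) *\<^sub>R x)"
    using e_indep by simp
  also have "\<dots> = p x *\<^sub>R e 0 + q x *\<^sub>R e 2"
    unfolding * by (simp add: p_def q_def scaleR_add_right)
  finally show ?thesis .
qed

lemma pq_eqI: "p x = p y \<Longrightarrow> q x = q y \<Longrightarrow> x = y"
  using pq_expand by metis

lemma pq_eq_iff: "x = y \<longleftrightarrow> p x = p y \<and> q x = q y"
  using pq_eqI by blast

lemma continuous_pq [continuous_intros]:
  "continuous_on A p" "continuous_on A q"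
  unfolding p_def[abs_def] q_def[abs_def] cross_def using e_indep
  by (auto intro!: continuous_intros simp: cross_def)

text \<open>The hexagon with the vertices \<open>0\<close>, \<open>P 0\<close>, \<open>P 0 - P 1\<close>, \<open>P 0 - P 1 + P 2\<close>, \<open>P 2 - P 1\<close>, \<open>P 2\<close>. Along
  each pair of opposite sides one of \<open>p\<close>, \<open>q\<close> and \<open>p - q\<close> is constant.\<close>
definition H :: "plane set" where
  "H = {x. 0 < p x \<and> p x < a 0 + a 1 \<and> 0 < q x \<and> q x < a 1 + a 2 \<and> - a 2 < p x - q x \<and> p x - q x < a 0}"

definition HC :: "plane set" where
  "HC = {x. 0 \<le> p x \<and> p x \<le> a 0 + a 1 \<and> 0 \<le> q x \<and> q x \<le> a 1 + a 2 \<and> - a 2 \<le> p x - q x \<and> p x - q x \<le> a 0}"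

definition W1 :: plane where "W1 = P 0 - P 1"
definition W2 :: plane where "W2 = P 2 - P 1"
definition lat :: "int \<Rightarrow> int \<Rightarrow> plane" where "lat m n = of_int m *\<^sub>R W1 + of_int n *\<^sub>R W2"
definition edge :: "plane \<Rightarrow> nat \<Rightarrow> plane set" where "edge z j = {z + t *\<^sub>R P j |t. 0 \<le> t \<and> t \<le> 1}"

lemma pq_W [simp]: "p W1 = a 0 + a 1" "q W1 = a 1" "p W2 = a 1" "q W2 = a 1 + a 2"
  by (simp_all add: W1_def W2_def)

lemma pq_lat: "p (lat m n) = of_int m * (a 0 + a 1) + of_int n * a 1"
    "q (lat m n) = of_int m * a 1 + of_int n * (a 1 + a 2)"
  by (simp_all add: lat_def)

lemma lat_add: "lat m n + lat m' n' = lat (m + m') (n + n')"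
  by (simp add: lat_def algebra_simps)

lemma lat_diff: "lat m n - lat m' n' = lat (m - m') (n - n')"
  by (simp add: lat_def algebra_simps)

lemma lat_zero [simp]: "lat 0 0 = 0"
  by (simp add: lat_def)

lemma open_H: "open H"
  unfolding H_def by (intro open_Collect_conj open_Collect_less continuous_intros)

lemma closed_HC: "closed HC"
  unfolding HC_def by (intro closed_Collect_conj closed_Collect_le continuous_intros)

lemma convex_H: "convex H"
proof (rule convexI)
  fix x y :: plane and s t :: real
  assume x: "x \<in> H" and y: "y \<in> H" and st: "0 \<le> s" "0 \<le> t" "s + t = 1"
  have comb: "s * u + t * v < c" if "u < c" "v < c" for u v c :: real
    by (rule convex_bound_lt) (use that st in auto)
  have comb': "c < s * u + t * v" if "c < u" "c < v" for u v c :: real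
    using comb[of "- u" "- c" "- v"] that by simp
  have diff: "p (s *\<^sub>R x + t *\<^sub>R y) - q (s *\<^sub>R x + t *\<^sub>R y) = s * (p x - q x) + t * (p y - q y)"
    by (simp add: algebra_simps)
  show "s *\<^sub>R x + t *\<^sub>R y \<in> H"
    using x y comb comb' unfolding H_def mem_Collect_eq diff by simp
qed

definition center :: plane where "center = (1 / 2) *\<^sub>R (W1 + P 2)"

lemma center_in_H: "center \<in> H"
  using a0 a1 a2 by (simp add: H_def center_def field_simps)

text \<open>Moving a point of the closed hexagon towards the center makes all the inequalities strict.\<close>
lemma closure_H: "closure H = HC"
proof
  show "closure H \<subseteq> HC"
    by (rule closure_minimal[OF _ closed_HC]) (auto simp: H_def HC_def)
  show "HC \<subseteq> closure H"
  proof
    fix x assume x: "x \<in> HC"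
    define y where "y n = x + (1 / real (Suc n)) *\<^sub>R (center - x)" for n
    have mix: "0 < u + s * (v - u)" if "0 \<le> u" "0 < v" "0 < s" "s \<le> 1" for u v s :: real
    proof -
      have "u + s * (v - u) = (1 - s) * u + s * v"
        by (simp add: algebra_simps)
      moreover have "0 \<le> (1 - s) * u" "0 < s * v"
        using that by simp_all
      ultimately show ?thesis by linarith
    qed
    have mix': "c < u + s * (v - u)" if "c \<le> u" "c < v" "0 < s" "s \<le> 1" for c u v s :: real
      using mix[of "u - c" "v - c" s] that by (simp add: algebra_simps)
    have mix'': "u + s * (v - u) < c" if "u \<le> c" "v < c" "0 < s" "s \<le> 1" for c u v s :: real
      using mix[of "c - u" "c - v" s] that by (simp add: algebra_simps)
    have "y n \<in> H" for n
    proof -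
      define s where "s = 1 / real (Suc n)"
      have s: "0 < s" "s \<le> 1"
        by (simp_all add: s_def)
      have "p (y n) = p x + s * (p center - p x)" "q (y n) = q x + s * (q center - q x)"
        by (simp_all add: y_def s_def)
      moreover from this have d: "p (y n) - q (y n) = (p x - q x) + s * ((p center - q center) - (p x - q x))"
        by (simp add: algebra_simps)
      ultimately show ?thesis
        using x center_in_H s mix' mix'' unfolding H_def HC_def mem_Collect_eq d by simp
    qed
    moreover have "y \<longlonglongrightarrow> x + 0 *\<^sub>R (center - x)"
      unfolding y_def[abs_def] using LIMSEQ_inverse_real_of_nat
      by (intro tendsto_intros) (simp add: inverse_eq_divide)
    ultimately show "x \<in> closure H"
      unfolding closure_sequential by auto
  qed
qed

lemma frontier_H: "frontier H = HC - H"
  by (simp add: frontier_def closure_H interior_open open_H)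

lemma bounded_H: "bounded H"
proof -
  have "norm x \<le> (a 0 + a 1) * norm (e 0) + (a 1 + a 2) * norm (e 2)" if x: "x \<in> H" for x
  proof -
    have "norm x \<le> \<bar>p x\<bar> * norm (e 0) + \<bar>q x\<bar> * norm (e 2)"
      using norm_triangle_ineq[of "p x *\<^sub>R e 0" "q x *\<^sub>R e 2"] pq_expand[of x] by simp
    also have "\<dots> \<le> (a 0 + a 1) * norm (e 0) + (a 1 + a 2) * norm (e 2)"
      using x by (intro add_mono mult_right_mono) (auto simp: H_def)
    finally show ?thesis .
  qed
  then show ?thesis
    unfolding bounded_iff by blast
qed

text \<open>A point of the open and a point of the closed hexagon differ by less than its width with respect to
  each of \<open>p\<close>, \<open>q\<close> and \<open>p - q\<close>.
  A nonzero lattice vector has at least this width with respect to one of them: which one depends on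
  the signs of \<open>m\<close> and \<open>n\<close>.\<close>
lemma cells_disjoint:
  assumes "x \<in> HC" "x - lat m n \<in> H"
  shows "m = 0 \<and> n = 0"
proof -
  let ?M = "of_int m :: real" and ?N = "of_int n :: real"
  have p: "\<bar>?M * (a 0 + a 1) + ?N * a 1\<bar> < a 0 + a 1"
    and q: "\<bar>?M * a 1 + ?N * (a 1 + a 2)\<bar> < a 1 + a 2"
    and d: "\<bar>?M * a 0 - ?N * a 2\<bar> < a 0 + a 2"
    using assms by (auto simp: H_def HC_def pq_lat abs_less_iff algebra_simps)
  have mono: "c \<le> of_int z * c" if "z \<ge> 1" "c > 0" for z and c :: real
    using that by (simp add: mult_le_cancel_right1)
  have mono': "of_int z * c \<le> - c" if "z \<le> -1" "c > 0" for z and c :: real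
    using mono[of "- z" c] that by simp
  note a = a0 a1 a2
  consider "m = 0 \<and> n = 0" | "m \<ge> 1" "n \<ge> 0" | "m \<ge> 0" "n \<ge> 1" | "m \<le> -1" "n \<le> 0" | "m \<le> 0" "n \<le> -1"
    | "m \<ge> 1" "n \<le> -1" | "m \<le> -1" "n \<ge> 1"
    by linarith
  then show ?thesis
  proof cases
    case 2
    then have "a 0 + a 1 \<le> ?M * (a 0 + a 1)" "0 \<le> ?N * a 1"
      using a mono[of m "a 0 + a 1"] by simp_all
    with p show ?thesis by linarith
  next
    case 3
    then have "a 1 + a 2 \<le> ?N * (a 1 + a 2)" "0 \<le> ?M * a 1"
      using a mono[of n "a 1 + a 2"] by simp_all
    with q show ?thesis by linarith
  next
    case 4
    then have "?M * (a 0 + a 1) \<le> - (a 0 + a 1)" "?N * a 1 \<le> 0"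
      using a mono'[of m "a 0 + a 1"] by (simp_all add: mult_le_0_iff)
    with p show ?thesis by linarith
  next
    case 5
    then have "?N * (a 1 + a 2) \<le> - (a 1 + a 2)" "?M * a 1 \<le> 0"
      using a mono'[of n "a 1 + a 2"] by (simp_all add: mult_le_0_iff)
    with q show ?thesis by linarith
  next
    case 6
    with d show ?thesis
      using a mono[of m "a 0"] mono'[of n "a 2"] by linarith
  next
    case 7
    with d show ?thesis
      using a mono'[of m "a 0"] mono[of n "a 2"] by linarith
  qed
qed

lemma lat_eq_iff: "lat m n = lat m' n' \<longleftrightarrow> m = m' \<and> n = n'"
proof
  assume "lat m n = lat m' n'"
  then have "center - lat (m - m') (n - n') \<in> H"
    using center_in_H by (simp flip: lat_diff)
  moreover have "center \<in> HC"
    using center_in_H closure_H closure_subset by blast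
  ultimately have "m - m' = 0 \<and> n - n' = 0"
    by (intro cells_disjoint)
  then show "m = m' \<and> n = n'"
    by simp
qed simp

text \<open>Modulo the lattice, \<open>x\<close> becomes \<open>y = s *\<^sub>R W1 + t *\<^sub>R W2\<close> with \<open>s\<close> and \<open>t\<close> between \<open>0\<close> and \<open>1\<close>. Only the
  upper bounds on \<open>p y\<close> and \<open>q y\<close> can fail, and then \<open>W1\<close> or \<open>W2\<close> has to be subtracted. The choice
  between the two is made by the sign of \<open>(1 - s) * a 0 - (1 - t) * a 2\<close>, because this is what keeps
  \<open>p - q\<close> within its bounds.\<close>
lemma cells_cover: "\<exists>m n. x - lat m n \<in> HC"
proof -
  define det where "det = (a 0 + a 1) * (a 1 + a 2) - a 1 * a 1"
  have det: "det > 0"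
    using a0 a1 a2 by (simp add: det_def algebra_simps add_pos_pos)
  \<comment> \<open>The numbers \<open>u\<close> and \<open>v\<close> are the coordinates of \<open>x\<close> with respect to \<open>W1\<close> and \<open>W2\<close>.\<close>
  define u where "u = (p x * (a 1 + a 2) - q x * a 1) / det"
  define v where "v = (q x * (a 0 + a 1) - p x * a 1) / det"
  have px: "p x = u * (a 0 + a 1) + v * a 1" and qx: "q x = u * a 1 + v * (a 1 + a 2)"
  proof -
    have "(u * (a 0 + a 1) + v * a 1) * det = p x * det" "(u * a 1 + v * (a 1 + a 2)) * det = q x * det"
      using det by (simp_all add: u_def v_def distrib_right) (simp_all add: det_def algebra_simps)
    then show "p x = u * (a 0 + a 1) + v * a 1" "q x = u * a 1 + v * (a 1 + a 2)"
      using det by simp_all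
  qed
  define m n where "m = \<lfloor>u\<rfloor>" and "n = \<lfloor>v\<rfloor>"
  define s t where "s = u - of_int m" and "t = v - of_int n"
  have st: "0 \<le> s" "s < 1" "0 \<le> t" "t < 1"
    unfolding s_def t_def m_def n_def by linarith+
  define y where "y = x - lat m n"
  have py: "p y = s * a 0 + s * a 1 + t * a 1" and qy: "q y = s * a 1 + t * a 1 + t * a 2"
    by (simp_all add: y_def s_def t_def pq_lat px qx algebra_simps)
  note a = a0 a1 a2
  have nonneg: "0 \<le> s * a 0" "0 \<le> s * a 1" "0 \<le> t * a 1" "0 \<le> t * a 2"
    using st a by simp_all
  have le: "s * a 0 \<le> a 0" "s * a 1 \<le> a 1" "t * a 1 \<le> a 1" "t * a 2 \<le> a 2"
    using st a by (simp_all add: mult_le_cancel_right1)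
  show ?thesis
  proof (cases "p y \<le> a 0 + a 1 \<and> q y \<le> a 1 + a 2")
    case True
    then have "y \<in> HC"
      unfolding HC_def mem_Collect_eq py qy using nonneg le by auto
    then show ?thesis
      unfolding y_def by blast
  next
    case False
    show ?thesis
    proof (cases "a 0 - s * a 0 \<le> a 2 - t * a 2")
      case True
      have "p y > a 0 + a 1"
      proof (rule ccontr)
        assume n: "\<not> p y > a 0 + a 1"
        then have "q y > a 1 + a 2"
          using False by simp
        moreover have "(1 - s) * a 1 \<ge> 0"
          using st a by simp
        ultimately show False
          using True n le nonneg unfolding py qy by (simp add: algebra_simps)
      qed
      then have "y - W1 \<in> HC"
        using True nonneg le unfolding HC_def mem_Collect_eq p_simps q_simps pq_W py qy
        by (auto simp: algebra_simps)
      moreover have "y - W1 = x - lat (m + 1) n"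
        by (simp add: y_def lat_def algebra_simps)
      ultimately show ?thesis
        by metis
    next
      case case2: False
      have "q y > a 1 + a 2"
      proof (rule ccontr)
        assume n: "\<not> q y > a 1 + a 2"
        then have "p y > a 0 + a 1"
          using False by simp
        then show False
          using case2 n le nonneg unfolding py qy by (simp add: algebra_simps)
      qed
      then have "y - W2 \<in> HC"
        using case2 nonneg le unfolding HC_def mem_Collect_eq p_simps q_simps pq_W py qy
        by (auto simp: algebra_simps)
      moreover have "y - W2 = x - lat m (n + 1)"
        by (simp add: y_def lat_def algebra_simps)
      ultimately show ?thesis
        by metis
    qed
  qed
qed

lemma in_segment_pq:
  "z \<in> closed_segment A B \<longleftrightarrow>
    (\<exists>u. 0 \<le> u \<and> u \<le> 1 \<and> p z = p A + u * (p B - p A) \<and> q z = q A + u * (q B - q A))"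
  unfolding in_segment pq_eq_iff[of z] by (simp add: algebra_simps)

lemma scale_iff:
  assumes "c > 0"
  shows "(\<exists>u. 0 \<le> u \<and> u \<le> 1 \<and> x = u * c) \<longleftrightarrow> 0 \<le> x \<and> x \<le> (c::real)"
proof
  assume "0 \<le> x \<and> x \<le> c"
  then show "\<exists>u. 0 \<le> u \<and> u \<le> 1 \<and> x = u * c"
    using assms by (intro exI[of _ "x / c"]) simp
qed (use assms in \<open>auto simp: mult_le_cancel_right1\<close>)

lemma sides_in_coordinates:
  "z \<in> closed_segment 0 (P 0) \<longleftrightarrow> q z = 0 \<and> 0 \<le> p z \<and> p z \<le> a 0"
  "z \<in> closed_segment (P 0) (P 0 - P 1) \<longleftrightarrow> p z - q z = a 0 \<and> 0 \<le> q z \<and> q z \<le> a 1"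
  "z \<in> closed_segment (P 0 - P 1) (P 0 - P 1 + P 2) \<longleftrightarrow> p z = a 0 + a 1 \<and> a 1 \<le> q z \<and> q z \<le> a 1 + a 2"
  "z \<in> closed_segment (P 0 - P 1 + P 2) (P 2 - P 1) \<longleftrightarrow> q z = a 1 + a 2 \<and> a 1 \<le> p z \<and> p z \<le> a 0 + a 1"
  "z \<in> closed_segment (P 2 - P 1) (P 2) \<longleftrightarrow> p z - q z = - a 2 \<and> 0 \<le> p z \<and> p z \<le> a 1"
  "z \<in> closed_segment (P 2) 0 \<longleftrightarrow> p z = 0 \<and> 0 \<le> q z \<and> q z \<le> a 2"
proof -
  show "z \<in> closed_segment 0 (P 0) \<longleftrightarrow> q z = 0 \<and> 0 \<le> p z \<and> p z \<le> a 0"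
    using scale_iff[OF a0, of "p z"] unfolding in_segment_pq by auto
  show "z \<in> closed_segment (P 0) (P 0 - P 1) \<longleftrightarrow> p z - q z = a 0 \<and> 0 \<le> q z \<and> q z \<le> a 1"
    using scale_iff[OF a1, of "q z"] unfolding in_segment_pq by auto
  show "z \<in> closed_segment (P 0 - P 1) (P 0 - P 1 + P 2) \<longleftrightarrow> p z = a 0 + a 1 \<and> a 1 \<le> q z \<and> q z \<le> a 1 + a 2"
    using scale_iff[OF a2, of "q z - a 1"] unfolding in_segment_pq by (auto simp: algebra_simps)
  show "z \<in> closed_segment (P 0 - P 1 + P 2) (P 2 - P 1) \<longleftrightarrow> q z = a 1 + a 2 \<and> a 1 \<le> p z \<and> p z \<le> a 0 + a 1"
    using scale_iff[OF a0, of "a 0 + a 1 - p z"] unfolding in_segment_pq by (auto simp: algebra_simps)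
  show "z \<in> closed_segment (P 2 - P 1) (P 2) \<longleftrightarrow> p z - q z = - a 2 \<and> 0 \<le> p z \<and> p z \<le> a 1"
    using scale_iff[OF a1, of "a 1 - p z"] unfolding in_segment_pq by (auto simp: algebra_simps)
  show "z \<in> closed_segment (P 2) 0 \<longleftrightarrow> p z = 0 \<and> 0 \<le> q z \<and> q z \<le> a 2"
    using scale_iff[OF a2, of "a 2 - q z"] unfolding in_segment_pq by (auto simp: algebra_simps)
qed

lemma frontier_H_sides:
  "frontier H = closed_segment 0 (P 0) \<union> closed_segment (P 0) (P 0 - P 1) \<union>
    closed_segment (P 0 - P 1) (P 0 - P 1 + P 2) \<union> closed_segment (P 0 - P 1 + P 2) (P 2 - P 1) \<union>
    closed_segment (P 2 - P 1) (P 2) \<union> closed_segment (P 2) 0"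
proof (rule set_eqI)
  fix z
  show "z \<in> frontier H \<longleftrightarrow> z \<in> closed_segment 0 (P 0) \<union> closed_segment (P 0) (P 0 - P 1) \<union>
    closed_segment (P 0 - P 1) (P 0 - P 1 + P 2) \<union> closed_segment (P 0 - P 1 + P 2) (P 2 - P 1) \<union>
    closed_segment (P 2 - P 1) (P 2) \<union> closed_segment (P 2) 0"
    unfolding frontier_H Un_iff sides_in_coordinates Diff_iff
    unfolding H_def HC_def mem_Collect_eq using a0 a1 a2 by argo
qed

lemma collinear_pq:
  assumes "collinear {A, B, C}"
  shows "(p B - p A) * (q C - q B) = (q B - q A) * (p C - p B)"
proof -
  obtain u where u: "\<forall>x\<in>{A, B, C}. \<forall>y\<in>{A, B, C}. \<exists>c. x - y = c *\<^sub>R u"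
    using assms unfolding collinear_def by blast
  then have "\<exists>c. B - A = c *\<^sub>R u" "\<exists>c. C - B = c *\<^sub>R u"
    by simp_all
  then obtain c d where "B - A = c *\<^sub>R u" "C - B = d *\<^sub>R u"
    by blast
  then have "p B - p A = c * p u" "q B - q A = c * q u" "p C - p B = d * p u" "q C - q B = d * q u"
    by (metis p_simps(2,4) q_simps(2,4))+
  then show ?thesis
    by simp
qed

lemma open_hexagon_H: "open_hexagon H"
proof -
  define v where "v = (!) [0, P 0, P 0 - P 1, P 0 - P 1 + P 2, P 2 - P 1, P 2]"
  have v: "v 0 = 0" "v 1 = P 0" "v 2 = P 0 - P 1" "v 3 = P 0 - P 1 + P 2" "v 4 = P 2 - P 1" "v 5 = P 2"
    by (simp_all add: v_def)
  define g where "g = linepath (v 0) (v 1) +++ linepath (v 1) (v 2) +++ linepath (v 2) (v 3) +++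
                linepath (v 3) (v 4) +++ linepath (v 4) (v 5) +++ linepath (v 5) (v 0)"
  note a = a0 a1 a2
  have distinct: "v 0 \<noteq> v 1" "v 1 \<noteq> v 2" "v 2 \<noteq> v 3" "v 3 \<noteq> v 4" "v 4 \<noteq> v 5" "v 5 \<noteq> v 0"
    unfolding v using a by (auto simp: pq_eq_iff)
  have "arc (linepath (v 4) (v 5) +++ linepath (v 5) (v 0))"
    by (intro arc_join arc_linepath distinct)
      (use a in \<open>auto simp: v v(2)[unfolded One_nat_def] sides_in_coordinates[unfolded One_nat_def] pq_eq_iff\<close>)
  then have "arc (linepath (v 3) (v 4) +++ linepath (v 4) (v 5) +++ linepath (v 5) (v 0))"
    by (intro arc_join arc_linepath distinct)
      (use a in \<open>auto simp: v v(2)[unfolded One_nat_def] sides_in_coordinates[unfolded One_nat_def] pq_eq_iff path_image_join\<close>)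
  then have "arc (linepath (v 2) (v 3) +++ linepath (v 3) (v 4) +++ linepath (v 4) (v 5) +++ linepath (v 5) (v 0))"
    by (intro arc_join arc_linepath distinct)
      (use a in \<open>auto simp: v v(2)[unfolded One_nat_def] sides_in_coordinates[unfolded One_nat_def] pq_eq_iff path_image_join\<close>)
  then have "arc (linepath (v 1) (v 2) +++ linepath (v 2) (v 3) +++ linepath (v 3) (v 4) +++
      linepath (v 4) (v 5) +++ linepath (v 5) (v 0))"
    by (intro arc_join arc_linepath distinct)
      (use a in \<open>auto simp: v v(2)[unfolded One_nat_def] sides_in_coordinates[unfolded One_nat_def] pq_eq_iff path_image_join\<close>)
  then have "simple_path g"
    unfolding g_def by (intro simple_path_join_loop arc_linepath distinct)
      (use a in \<open>auto simp: v v(2)[unfolded One_nat_def] sides_in_coordinates[unfolded One_nat_def] pq_eq_iff path_image_join\<close>)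
  moreover have "path_image g = frontier H"
    unfolding frontier_H_sides g_def v by (simp add: path_image_join Un_assoc)
  then have "H = inside (path_image g)"
    using inside_frontier_eq_interior[OF bounded_H convex_H] open_H by (simp add: interior_open)
  moreover have "\<not> collinear {v i, v ((i + 1) mod 6), v ((i + 2) mod 6)}" if "i < 6" for i
  proof
    assume c: "collinear {v i, v ((i + 1) mod 6), v ((i + 2) mod 6)}"
    have "i = 0 \<or> i = 1 \<or> i = 2 \<or> i = 3 \<or> i = 4 \<or> i = 5"
      using that by linarith
    then show False
      using collinear_pq[OF c] a v v(3)[unfolded numeral_2_eq_2] by auto
  qed
  ultimately show ?thesis
    unfolding open_hexagon_def Let_def g_def by blast
qed

lemma edge_mem_lat: "z \<in> edge (lat m n) j \<longleftrightarrow> (\<exists>t. 0 \<le> t \<and> t \<le> 1 \<and> z = lat m n + t *\<^sub>R P j)"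
  by (auto simp: edge_def)

lemma edge_segment: "edge z j = closed_segment z (z + P j)"
  by (auto simp: edge_def in_segment algebra_simps)

text \<open>A point outside all open cells is a boundary point of a closed cell, because the closed cells cover the
  plane; and the six sides of \<open>H\<close> are arms of the tripod, translated by \<open>0\<close>, \<open>W1\<close> or \<open>W2\<close>.
  Conversely, a boundary point of one closed cell is in no open cell, by \<open>cells_disjoint\<close>.\<close>
lemma outside_cells_iff:
  "(\<forall>m n. x - lat m n \<notin> H) \<longleftrightarrow> (\<exists>m n. \<exists>j<3. x \<in> edge (lat m n) j)"
proof
  assume out: "\<forall>m n. x - lat m n \<notin> H"
  obtain m n where "x - lat m n \<in> HC"
    using cells_cover by blast
  then have "x - lat m n \<in> frontier H"
    using out by (simp add: frontier_H)
  moreover have "closed_segment (P 0) (P 0 - P 1) = edge W1 1"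
    "closed_segment (P 0 - P 1) (P 0 - P 1 + P 2) = edge W1 2"
    "closed_segment (P 0 - P 1 + P 2) (P 2 - P 1) = edge W2 0"
    "closed_segment (P 2 - P 1) (P 2) = edge W2 1"
    "closed_segment 0 (P 0) = edge 0 0" "closed_segment (P 2) 0 = edge 0 2"
    by (auto simp: edge_segment W1_def W2_def closed_segment_commute algebra_simps)
  ultimately have "x - lat m n \<in> edge W1 1 \<union> edge W1 2 \<union> edge W2 0 \<union> edge W2 1 \<union> edge 0 0 \<union> edge 0 2"
    unfolding frontier_H_sides by blast
  moreover have W: "W1 = lat 1 0" "W2 = lat 0 1" "0 = lat 0 0"
    by (simp_all add: lat_def)
  ultimately obtain m' n' j where j: "j < 3" "x - lat m n \<in> edge (lat m' n') j"
    unfolding W(1,2) W(3)[symmetric] using W(3) by (metis (no_types, lifting) UnE less_3_cases)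
  then obtain t where "0 \<le> t" "t \<le> 1" "x - lat m n = lat m' n' + t *\<^sub>R P j"
    unfolding edge_mem_lat by blast
  then have "x = lat (m + m') (n + n') + t *\<^sub>R P j"
    by (simp add: algebra_simps flip: lat_add)
  then show "\<exists>m n. \<exists>j<3. x \<in> edge (lat m n) j"
    using j(1) \<open>0 \<le> t\<close> \<open>t \<le> 1\<close> edge_mem_lat by blast
next
  assume "\<exists>m n. \<exists>j<3. x \<in> edge (lat m n) j"
  then obtain m n j t where j: "j < 3" and t: "0 \<le> t" "t \<le> 1" and x: "x = lat m n + t *\<^sub>R P j"
    unfolding edge_mem_lat by blast
  note a = a0 a1 a2
  define c where "c = t * a j"
  have c: "0 \<le> c" "c \<le> a j"
    using t a_pos[OF j] by (simp_all add: c_def mult_le_cancel_right1)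
  have "\<exists>m n. x - lat m n \<in> HC - H"
    using j unfolding less_3_cases
  proof (elim disjE)
    assume "j = 0"
    then have "p (x - lat m n) = c" "q (x - lat m n) = 0"
      by (simp_all add: x c_def)
    then have "x - lat m n \<in> HC - H"
      unfolding Diff_iff HC_def H_def mem_Collect_eq using c a \<open>j = 0\<close> by simp
    then show ?thesis by blast
  next
    assume "j = 1"
    \<comment> \<open>The arm from \<open>0\<close> to \<open>P 1\<close> is not a side of \<open>H\<close> itself, but its translate by \<open>W1\<close> is.\<close>
    have "x - lat (m - 1) n = W1 + t *\<^sub>R P j"
      by (simp add: x lat_def algebra_simps)
    moreover have "p (W1 + t *\<^sub>R P j) = a 0 + a 1 - c" "q (W1 + t *\<^sub>R P j) = a 1 - c"
      using \<open>j = 1\<close> by (simp_all add: c_def)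
    then have "W1 + t *\<^sub>R P j \<in> HC - H"
      unfolding Diff_iff HC_def H_def mem_Collect_eq using c a \<open>j = 1\<close> by simp
    ultimately show ?thesis by metis
  next
    assume "j = 2"
    then have "p (x - lat m n) = 0" "q (x - lat m n) = c"
      by (simp_all add: x c_def)
    then have "x - lat m n \<in> HC - H"
      unfolding Diff_iff HC_def H_def mem_Collect_eq using c a \<open>j = 2\<close> by simp
    then show ?thesis by blast
  qed
  then obtain m n where x: "x - lat m n \<in> HC" "x - lat m n \<notin> H"
    by blast
  show "\<forall>m n. x - lat m n \<notin> H"
  proof (intro allI notI)
    fix m' n' assume in_H: "x - lat m' n' \<in> H"
    then have "(x - lat m n) - lat (m' - m) (n' - n) \<in> H"
      by (simp flip: lat_diff)
    then have "m' - m = 0 \<and> n' - n = 0"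
      using cells_disjoint x(1) by blast
    then show False
      using in_H x(2) by simp
  qed
qed

text \<open>If \<open>\<tau>\<close> were not zero, the three numbers \<open>f k\<close> would have the same sign, so each of them would be smaller
  in absolute value than their sum, and none could be an integer.\<close>
lemma balanced_zero:
  fixes f :: "nat \<Rightarrow> real"
  assumes f: "\<And>k. k < 3 \<Longrightarrow> f k * a k = \<tau>" and sum: "\<bar>f 0 + f 1 + f 2\<bar> \<le> 1"
    and k: "k < 3" "f k = of_int z"
  shows "\<tau> = 0"
proof (rule ccontr)
  assume "\<tau> \<noteq> 0"
  then consider "\<tau> > 0" | "\<tau> < 0" by linarith
  then show False
  proof cases
    case 1
    then have pos: "f i > 0" if "i < 3" for i
      using f[OF that] a_pos[OF that] by (metis mult.commute zero_less_mult_pos)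
    then have "f k \<ge> 1"
      using pos[OF k(1)] k(2) by simp
    then show False
      using sum k(1) pos[of 0] pos[of 1] pos[of 2] unfolding less_3_cases by auto
  next
    case 2
    then have neg: "f i < 0" if "i < 3" for i
      using f[OF that] a_pos[OF that] by (metis mult_less_0_iff less_asym)
    then have "f k \<le> -1"
      using neg[OF k(1)] k(2) by simp
    then show False
      using sum k(1) neg[of 0] neg[of 1] neg[of 2] unfolding less_3_cases by auto
  qed
qed

text \<open>The difference of the two sides of the equation is a linear combination of \<open>P 0\<close>, \<open>P 1\<close>, \<open>P 2\<close> with
  certain coefficients \<open>f k\<close>. All linear relations between these vectors are multiples of the one with the
  coefficients \<open>1 / a k\<close>, so that \<open>balanced_zero\<close> applies; an integer among the \<open>f k\<close> is found
  at an index \<open>k\<close> different from \<open>i\<close> and \<open>j\<close>. Hence all \<open>f k\<close> are zero, and the claims can be read off.\<close>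
lemma edges_meet:
  assumes ij: "i < 3" "j < 3" and ts: "0 \<le> t" "t \<le> 1" "0 \<le> s" "s \<le> 1"
    and eq: "lat m n + t *\<^sub>R P i = lat m' n' + s *\<^sub>R P j"
  shows "t = s \<and> (i = j \<longrightarrow> m = m' \<and> n = n') \<and> (i \<noteq> j \<longrightarrow> t = 0 \<or> t = 1) \<and>
    (i \<noteq> j \<and> m = m' \<and> n = n' \<longrightarrow> t = 0)"
proof -
  define M N where "M = m - m'" and "N = n - n'"
  define c where "c = (\<lambda>k::nat. if k = 0 then M else if k = 1 then - M - N else N)"
  define d where "d k = (if k = j then s else 0) - (if k = i then t else 0)" for k
  define f where "f k = d k - of_int (c k)" for k
  have "lat M N + t *\<^sub>R P i - s *\<^sub>R P j = (lat m n + t *\<^sub>R P i) - (lat m' n' + s *\<^sub>R P j)"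
    by (simp add: M_def N_def algebra_simps flip: lat_diff)
  then have "lat M N + t *\<^sub>R P i - s *\<^sub>R P j = 0"
    by (simp add: eq)
  then have p0: "p (lat M N + t *\<^sub>R P i - s *\<^sub>R P j) = 0" and q0: "q (lat M N + t *\<^sub>R P i - s *\<^sub>R P j) = 0"
    by simp_all
  have "f 0 * a 0 = f 1 * a 1" "f 2 * a 2 = f 1 * a 1"
    using p0 q0 ij unfolding less_3_cases
    by (auto simp: f_def d_def c_def pq_lat algebra_simps)
  then have f: "f k * a k = f 1 * a 1" if "k < 3" for k
    using that unfolding less_3_cases by auto
  have sum: "f 0 + f 1 + f 2 = s - t"
    using ij unfolding less_3_cases by (auto simp: f_def d_def c_def)
  obtain k where k: "k < 3" "k \<noteq> i" "k \<noteq> j"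
    using ij unfolding less_3_cases by fastforce
  then have fk: "f k = of_int (- c k)"
    by (simp add: f_def d_def)
  have "f 1 * a 1 = 0"
  proof (rule balanced_zero[OF f _ k(1) fk])
    show "\<bar>f 0 + f 1 + f 2\<bar> \<le> 1"
      unfolding sum using ts by linarith
  qed
  then have f0: "f k = 0" if "k < 3" for k
  proof -
    have "f k * a k = 0"
      using f[OF that] \<open>f 1 * a 1 = 0\<close> by (simp only:)
    then show ?thesis
      using a_pos[OF that] by simp
  qed
  then have ts_eq: "t = s"
    using sum by simp
  have d: "d k = of_int (c k)" if "k < 3" for k
    using f0[OF that] by (simp add: f_def)
  have "m = m' \<and> n = n'" if "i = j"
  proof -
    have "d k = 0" for k
      using that ts_eq by (simp add: d_def)
    then show ?thesis
      using d[of 0] d[of 2] by (simp add: c_def M_def N_def)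
  qed
  moreover have "t = 0 \<or> t = 1" if "i \<noteq> j"
  proof -
    have "t = of_int (c j)"
      using d[OF ij(2)] that ts_eq by (simp add: d_def)
    then show ?thesis
      using ts by auto
  qed
  moreover have "t = 0" if "i \<noteq> j" "m = m'" "n = n'"
    using d[OF ij(2)] that ts_eq by (simp add: d_def c_def M_def N_def)
  ultimately show ?thesis
    using ts_eq by blast
qed

lemma P_nonzero: "j < 3 \<Longrightarrow> P j \<noteq> 0"
  using a0 a1 a2 unfolding less_3_cases by (auto simp: pq_eq_iff)

text \<open>Since the cells are disjoint, a ball in \<open>H\<close> provides a lower bound for the distance of lattice points.\<close>
lemma closed_lat_subset:
  assumes "A \<subseteq> {lat m n |m n. True}"
  shows "closed A"
proof -
  obtain r where r: "r > 0" "ball center r \<subseteq> H"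
    using open_H center_in_H open_contains_ball by blast
  show ?thesis
  proof (rule discrete_imp_closed[OF r(1)], intro ballI impI)
    fix x y assume "x \<in> A" "y \<in> A" and d: "dist y x < r"
    then obtain m n m' n' where xy: "x = lat m n" "y = lat m' n'"
      using assms by blast
    have "center - (y - x) \<in> ball center r"
      using d by (simp add: dist_norm)
    then have "center - lat (m' - m) (n' - n) \<in> H"
      using r(2) by (auto simp: xy lat_diff)
    moreover have "center \<in> HC"
      using center_in_H closure_H closure_subset by blast
    ultimately have "m' - m = 0 \<and> n' - n = 0"
      by (intro cells_disjoint)
    then show "y = x"
      by (simp add: xy)
  qed
qed

definition graph :: "plane set" where
  "graph = (\<Union>m n. \<Union>j\<in>{..<3}. edge (lat m n) j)"

lemma in_graph_iff: "x \<in> graph \<longleftrightarrow> (\<exists>m n. \<exists>j<3. x \<in> edge (lat m n) j)"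
  by (auto simp: graph_def)

text \<open>The union \<open>F\<close> of the edges that do not contain \<open>x\<close> is closed, as the sum of a compact arm and a closed
  set of lattice points, for each of the three directions.\<close>
lemma graph_near:
  "\<exists>r>0. \<forall>y\<in>graph \<inter> ball x r. \<exists>m n. \<exists>j<3. x \<in> edge (lat m n) j \<and> y \<in> edge (lat m n) j"
proof -
  define A where "A j = {lat m n |m n. x \<notin> edge (lat m n) j}" for j
  define F where "F = (\<Union>j\<in>{..<3::nat}. \<Union>z\<in>closed_segment 0 (P j). \<Union>y\<in>A j. {z + y})"
  have "closed F"
    unfolding F_def
    by (intro closed_UN compact_closed_sums compact_segment closed_lat_subset ballI) (auto simp: A_def)
  have mem: "y \<in> F" if j: "j < 3" and xe: "x \<notin> edge (lat m n) j" and ye: "y \<in> edge (lat m n) j" for y m n j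
  proof -
    obtain t where t: "0 \<le> t" "t \<le> 1" "y = lat m n + t *\<^sub>R P j"
      using ye edge_mem_lat by blast
    then have "t *\<^sub>R P j \<in> closed_segment 0 (P j)"
      by (auto simp: in_segment)
    moreover have "lat m n \<in> A j"
      using xe by (auto simp: A_def)
    moreover have "y = t *\<^sub>R P j + lat m n"
      using t(3) by (simp add: add.commute)
    ultimately show ?thesis
      unfolding F_def using j by blast
  qed
  have "x \<notin> F"
  proof
    assume "x \<in> F"
    then obtain j z y where jz: "z \<in> closed_segment 0 (P j)" "y \<in> A j" "x = z + y"
      unfolding F_def by blast
    then obtain m n where mn: "y = lat m n" "x \<notin> edge (lat m n) j"
      by (auto simp: A_def)
    obtain t where "0 \<le> t" "t \<le> 1" "z = t *\<^sub>R P j"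
      using jz(1) by (auto simp: in_segment)
    then show False
      using mn jz(3) edge_mem_lat[of x m n j] by (auto simp: add.commute)
  qed
  then obtain r where r: "r > 0" "ball x r \<subseteq> - F"
    using \<open>closed F\<close> open_contains_ball[of "- F"] by (auto simp: closed_def)
  show ?thesis
  proof (intro exI[of _ r] conjI ballI r(1))
    fix y assume y: "y \<in> graph \<inter> ball x r"
    then obtain m n j where "j < 3" "y \<in> edge (lat m n) j"
      by (auto simp: in_graph_iff)
    moreover have "y \<notin> F"
      using y r(2) by blast
    ultimately show "\<exists>m n. \<exists>j<3. x \<in> edge (lat m n) j \<and> y \<in> edge (lat m n) j"
      using mem by blast
  qed
qed

text \<open>The points \<open>P 0\<close>, \<open>P 1\<close> and \<open>P 2\<close> differ by lattice vectors, so \<open>P 0\<close> stands for all of them.\<close>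
definition vertices :: "plane set" where
  "vertices = {lat m n |m n. True} \<union> {lat m n + P 0 |m n. True}"

lemma edge_subset_graph: "j < 3 \<Longrightarrow> edge (lat m n) j \<subseteq> graph"
  using in_graph_iff by blast

lemma vertex_P: "j < 3 \<Longrightarrow> \<exists>m n. P 0 - P j = lat m n"
proof -
  have "P 0 - P 0 = lat 0 0" "P 0 - P 1 = lat 1 0" "P 0 - P 2 = lat 1 (-1)"
    by (simp_all add: pq_eq_iff pq_lat)
  then show "j < 3 \<Longrightarrow> ?thesis"
    unfolding less_3_cases by blast
qed

lemma vertices_subset_graph: "vertices \<subseteq> graph"
proof -
  have "lat m n \<in> edge (lat m n) 0" "lat m n + P 0 \<in> edge (lat m n) 0" for m n
    unfolding edge_mem_lat by (auto intro: exI[of _ 0] exI[of _ 1])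
  then show ?thesis
    unfolding vertices_def using edge_subset_graph[of 0, simplified] by blast
qed

end

lemma regular_arc_line:
  assumes "v \<noteq> 0"
  shows "regular_arc (\<lambda>t. x + t *\<^sub>R v) I"
  unfolding regular_arc_def
proof (intro conjI exI[of _ "\<lambda>n::nat. if n = 0 then (\<lambda>t. x + t *\<^sub>R v) else if n = 1 then (\<lambda>t. v) else (\<lambda>t. 0)"])
  show "inj_on (\<lambda>t. x + t *\<^sub>R v) I"
    using assms by (auto simp: inj_on_def)
  let ?d = "\<lambda>n::nat. if n = 0 then (\<lambda>t. x + t *\<^sub>R v) else if n = 1 then (\<lambda>t. v) else (\<lambda>t. 0)"
  show "?d 0 = (\<lambda>t. x + t *\<^sub>R v)"
    by simp
  show "\<forall>n. \<forall>t\<in>I. (?d n has_vector_derivative ?d (Suc n) t) (at t within I)"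
    by (auto intro!: derivative_eq_intros)
  show "\<forall>t\<in>I. ?d 1 t \<noteq> 0"
    using assms by simp
qed

context honeycomb
begin

lemma regular_curve_off_vertices:
  assumes "x \<in> graph" "x \<notin> vertices"
  shows "regular_curve_near graph x"
proof -
  obtain m n i t where i: "i < 3" and t: "0 \<le> t" "t \<le> 1" and x: "x = lat m n + t *\<^sub>R P i"
    using assms(1) unfolding in_graph_iff edge_mem_lat by blast
  have t0: "t \<noteq> 0"
  proof
    assume "t = 0"
    then have "x = lat m n"
      by (simp add: x)
    then show False
      using assms(2) unfolding vertices_def by blast
  qed
  have t1: "t \<noteq> 1"
  proof
    assume "t = 1"
    obtain m' n' where "P 0 - P i = lat m' n'"
      using vertex_P[OF i] by blast
    then have "x = lat (m - m') (n - n') + P 0"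
      using x \<open>t = 1\<close> by (simp add: algebra_simps flip: lat_diff)
    then show False
      using assms(2) unfolding vertices_def by blast
  qed
  define \<delta> where "\<delta> = min t (1 - t)"
  have \<delta>: "\<delta> > 0" "\<delta> \<le> t" "\<delta> \<le> 1 - t"
    using t t0 t1 by (auto simp: \<delta>_def)
  obtain r where r: "r > 0"
    "\<And>y. y \<in> graph \<Longrightarrow> y \<in> ball x r \<Longrightarrow> \<exists>m n. \<exists>j<3. x \<in> edge (lat m n) j \<and> y \<in> edge (lat m n) j"
    using graph_near[of x] by blast
  define r' where "r' = min r (\<delta> * norm (P i))"
  have r': "r' > 0"
    using r(1) \<delta>(1) P_nonzero[OF i] by (simp add: r'_def)
  have "graph \<inter> ball x r' = (\<lambda>u. x + u *\<^sub>R (\<delta> *\<^sub>R P i)) ` {-1..1} \<inter> ball x r'"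
  proof (intro equalityI subsetI)
    fix y assume y: "y \<in> graph \<inter> ball x r'"
    then obtain m' n' j where j: "j < 3" "x \<in> edge (lat m' n') j" "y \<in> edge (lat m' n') j"
      using r(2)[of y] by (auto simp: r'_def)
    obtain s where s: "0 \<le> s" "s \<le> 1" "x = lat m' n' + s *\<^sub>R P j"
      using j(2) edge_mem_lat by blast
    have "lat m n + t *\<^sub>R P i = lat m' n' + s *\<^sub>R P j"
      using x s(3) by simp
    from edges_meet[OF i j(1) t s(1,2) this] have "i = j" "m = m'" "n = n'"
      using t0 t1 by blast+
    then obtain s' where s': "y = lat m n + s' *\<^sub>R P i"
      using j(3) edge_mem_lat by blast
    define u where "u = (s' - t) / \<delta>"
    have y_eq: "y = x + u *\<^sub>R (\<delta> *\<^sub>R P i)"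
      using \<delta>(1) by (simp add: u_def s' x scaleR_left_diff_distrib)
    have "norm (u *\<^sub>R (\<delta> *\<^sub>R P i)) < \<delta> * norm (P i)"
      using y by (simp add: y_eq r'_def dist_norm)
    then have "\<bar>u\<bar> * (\<delta> * norm (P i)) < 1 * (\<delta> * norm (P i))"
      using \<delta>(1) by (simp add: abs_mult)
    then have "\<bar>u\<bar> < 1"
      using \<delta>(1) P_nonzero[OF i] by (simp add: mult_less_cancel_right2)
    then have "u \<in> {-1..1}"
      by auto
    then show "y \<in> (\<lambda>u. x + u *\<^sub>R (\<delta> *\<^sub>R P i)) ` {-1..1} \<inter> ball x r'"
      using y y_eq by blast
  next
    fix y assume y: "y \<in> (\<lambda>u. x + u *\<^sub>R (\<delta> *\<^sub>R P i)) ` {-1..1} \<inter> ball x r'"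
    then obtain u where u: "-1 \<le> u" "u \<le> 1" "y = x + u *\<^sub>R (\<delta> *\<^sub>R P i)"
      by auto
    then have "y = lat m n + (t + u * \<delta>) *\<^sub>R P i"
      by (simp add: x algebra_simps)
    moreover have "\<bar>u * \<delta>\<bar> \<le> \<delta>"
      using u \<delta>(1) by (simp add: abs_mult abs_le_iff)
    then have "0 \<le> t + u * \<delta>" "t + u * \<delta> \<le> 1"
      using \<delta> by linarith+
    ultimately have "y \<in> edge (lat m n) i"
      using edge_mem_lat by blast
    then show "y \<in> graph \<inter> ball x r'"
      using edge_subset_graph[OF i] y by blast
  qed
  moreover have "regular_arc (\<lambda>u. x + u *\<^sub>R (\<delta> *\<^sub>R P i)) {-1..1}"
    using \<delta>(1) P_nonzero[OF i] by (intro regular_arc_line) simp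
  ultimately show ?thesis
    unfolding regular_curve_near_def using r'
    by (intro exI[of _ "\<lambda>u. x + u *\<^sub>R (\<delta> *\<^sub>R P i)"] exI[of _ r']) simp
qed

text \<open>The three edges leave a lattice point in the directions \<open>P j\<close>, and a point of the form
  \<open>lat m n + P 0\<close> in the opposite directions.\<close>
lemma star_at_vertices:
  assumes "x \<in> vertices"
  shows "\<exists>r>0. \<exists>\<sigma>\<in>{1, -1}. graph \<inter> ball x r = (\<Union>j<3. (\<lambda>t. x + t *\<^sub>R (\<sigma> *\<^sub>R P j)) ` {0..1}) \<inter> ball x r"
proof -
  obtain r where r: "r > 0"
    "\<And>y. y \<in> graph \<Longrightarrow> y \<in> ball x r \<Longrightarrow> \<exists>m n. \<exists>j<3. x \<in> edge (lat m n) j \<and> y \<in> edge (lat m n) j"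
    using graph_near[of x] by blast
  consider m n where "x = lat m n" | m n where "x = lat m n + P 0"
    using assms by (auto simp: vertices_def)
  then show ?thesis
  proof cases
    case 1
    have "graph \<inter> ball x r = (\<Union>j<3. (\<lambda>t. x + t *\<^sub>R (1 *\<^sub>R P j)) ` {0..1}) \<inter> ball x r"
    proof (intro equalityI subsetI)
      fix y assume y: "y \<in> graph \<inter> ball x r"
      then obtain m' n' j where j: "j < 3" "x \<in> edge (lat m' n') j" "y \<in> edge (lat m' n') j"
        using r(2)[of y] by auto
      obtain s where s: "0 \<le> s" "s \<le> 1" "x = lat m' n' + s *\<^sub>R P j"
        using j(2) edge_mem_lat by blast
      have "lat m n + 0 *\<^sub>R P j = lat m' n' + s *\<^sub>R P j"
        using 1 s(3) by simp
      from edges_meet[OF j(1) j(1) _ _ s(1,2) this] have "m = m'" "n = n'"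
        by auto
      then obtain s' where s': "0 \<le> s'" "s' \<le> 1" "y = x + s' *\<^sub>R P j"
        using j(3) edge_mem_lat 1 by blast
      then have "s' \<in> {0..1}" "y = x + s' *\<^sub>R (1 *\<^sub>R P j)"
        by simp_all
      then show "y \<in> (\<Union>j<3. (\<lambda>t. x + t *\<^sub>R (1 *\<^sub>R P j)) ` {0..1}) \<inter> ball x r"
        using y j(1) by blast
    next
      fix y assume y: "y \<in> (\<Union>j<3. (\<lambda>t. x + t *\<^sub>R (1 *\<^sub>R P j)) ` {0..1}) \<inter> ball x r"
      then obtain j t where "j < 3" "0 \<le> t" "t \<le> 1" "y = lat m n + t *\<^sub>R P j"
        using 1 by auto
      then have "y \<in> graph"
        using edge_mem_lat edge_subset_graph by blast
      then show "y \<in> graph \<inter> ball x r"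
        using y by blast
    qed
    then show ?thesis
      using r(1) by blast
  next
    case 2
    have "graph \<inter> ball x r = (\<Union>j<3. (\<lambda>t. x + t *\<^sub>R ((-1) *\<^sub>R P j)) ` {0..1}) \<inter> ball x r"
    proof (intro equalityI subsetI)
      fix y assume y: "y \<in> graph \<inter> ball x r"
      then obtain m' n' j where j: "j < 3" "x \<in> edge (lat m' n') j" "y \<in> edge (lat m' n') j"
        using r(2)[of y] by auto
      obtain s where s: "0 \<le> s" "s \<le> 1" "x = lat m' n' + s *\<^sub>R P j"
        using j(2) edge_mem_lat by blast
      obtain m0 n0 where "P 0 - P j = lat m0 n0"
        using vertex_P[OF j(1)] by blast
      then have x: "x = lat (m + m0) (n + n0) + 1 *\<^sub>R P j"
        using 2 by (simp add: algebra_simps flip: lat_add)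
      then have "lat (m + m0) (n + n0) + 1 *\<^sub>R P j = lat m' n' + s *\<^sub>R P j"
        using s(3) by simp
      from edges_meet[OF j(1) j(1) _ _ s(1,2) this] have "m + m0 = m'" "n + n0 = n'"
        by auto
      then obtain s' where s': "0 \<le> s'" "s' \<le> 1" "y = lat (m + m0) (n + n0) + s' *\<^sub>R P j"
        using j(3) edge_mem_lat by blast
      then have "y = x + (1 - s') *\<^sub>R ((-1) *\<^sub>R P j)"
        using x by (simp add: algebra_simps)
      moreover have "1 - s' \<in> {0..1}"
        using s' by simp
      ultimately show "y \<in> (\<Union>j<3. (\<lambda>t. x + t *\<^sub>R ((-1) *\<^sub>R P j)) ` {0..1}) \<inter> ball x r"
        using y j(1) by blast
    next
      fix y assume y: "y \<in> (\<Union>j<3. (\<lambda>t. x + t *\<^sub>R ((-1) *\<^sub>R P j)) ` {0..1}) \<inter> ball x r"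
      then obtain j t where j: "j < 3" and t: "0 \<le> t" "t \<le> 1" and "y = x + t *\<^sub>R ((-1) *\<^sub>R P j)"
        by auto
      moreover obtain m0 n0 where "P 0 - P j = lat m0 n0"
        using vertex_P[OF j] by blast
      ultimately have "y = lat (m + m0) (n + n0) + (1 - t) *\<^sub>R P j"
        using 2 by (simp add: algebra_simps flip: lat_add)
      moreover have "0 \<le> 1 - t" "1 - t \<le> 1"
        using t by simp_all
      ultimately have "y \<in> graph"
        using edge_mem_lat edge_subset_graph[OF j] by blast
      then show "y \<in> graph \<inter> ball x r"
        using y by blast
    qed
    then show ?thesis
      using r(1) by blast
  qed
qed

text \<open>The sign \<open>\<sigma>\<close> of \<open>star_at_vertices\<close> is absorbed into the angle: the opposite directions are rotated by \<open>pi\<close>.\<close>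
lemma equal_angle_at_vertices:
  assumes e: "\<And>j. j < 3 \<Longrightarrow> e j = (cos (\<theta> + 2 * pi * real j / 3), sin (\<theta> + 2 * pi * real j / 3))"
    and x: "x \<in> vertices"
  shows "equal_angle_meeting_at graph x"
proof -
  obtain r \<sigma> where r: "r > 0" and \<sigma>: "\<sigma> \<in> {1, -1 :: real}"
    and star: "graph \<inter> ball x r = (\<Union>j<3. (\<lambda>t. x + t *\<^sub>R (\<sigma> *\<^sub>R P j)) ` {0..1}) \<inter> ball x r"
    using star_at_vertices[OF x] by blast
  define \<alpha> where "\<alpha> = (if \<sigma> = 1 then \<theta> else \<theta> + pi)"
  define \<gamma> where "\<gamma> j = (\<lambda>t. x + t *\<^sub>R (\<sigma> *\<^sub>R P j))" for j
  have dir: "\<sigma> *\<^sub>R P j = a j *\<^sub>R (cos (\<alpha> + 2 * pi * real j / real 3), sin (\<alpha> + 2 * pi * real j / real 3))"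
    if "j < 3" for j
  proof (cases "\<sigma> = 1")
    case True
    then show ?thesis
      by (simp add: P_def e[OF that] \<alpha>_def)
  next
    case False
    then have eq: "\<alpha> + 2 * pi * real j / real 3 = (\<theta> + 2 * pi * real j / 3) + pi"
      by (simp add: \<alpha>_def)
    show ?thesis
      unfolding eq using False \<sigma> by (simp add: P_def e[OF that])
  qed
  have "\<forall>j<3. regular_arc (\<gamma> j) {0..1} \<and> \<gamma> j 0 = x"
    unfolding \<gamma>_def using \<sigma> P_nonzero by (auto intro!: regular_arc_line[of "_ *\<^sub>R _", simplified])
  moreover have "\<forall>i<3. \<forall>j<3. i \<noteq> j \<longrightarrow> \<gamma> i ` {0..1} \<inter> \<gamma> j ` {0..1} = {x}"
  proof (intro allI impI)
    fix i j :: nat assume ij: "i < 3" "j < 3" "i \<noteq> j"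
    have "y = x" if y: "y \<in> \<gamma> i ` {0..1} \<inter> \<gamma> j ` {0..1}" for y
    proof -
      obtain t s where ts: "0 \<le> t" "t \<le> 1" "0 \<le> s" "s \<le> 1" "y = \<gamma> i t" "y = \<gamma> j s"
        using y by auto
      then have "\<sigma> *\<^sub>R (t *\<^sub>R P i) = \<sigma> *\<^sub>R (s *\<^sub>R P j)"
        by (simp add: \<gamma>_def mult.commute)
      then have "t *\<^sub>R P i = s *\<^sub>R P j"
        using \<sigma> by auto
      then have "lat 0 0 + t *\<^sub>R P i = lat 0 0 + s *\<^sub>R P j"
        by simp
      from edges_meet[OF ij(1,2) ts(1-4) this] have "t = 0"
        using ij(3) by blast
      then show "y = x"
        using ts(5) by (simp add: \<gamma>_def)
    qed
    moreover have "x \<in> \<gamma> k ` {0..1}" for k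
      by (auto simp: \<gamma>_def image_iff intro!: bexI[of _ 0])
    ultimately show "\<gamma> i ` {0..1} \<inter> \<gamma> j ` {0..1} = {x}"
      by blast
  qed
  moreover have "graph \<inter> ball x r = (\<Union>j<3. \<gamma> j ` {0..1}) \<inter> ball x r"
    using star by (simp add: \<gamma>_def)
  moreover have "\<forall>j<3. \<exists>s>0. (\<gamma> j has_vector_derivative
      s *\<^sub>R (cos (\<alpha> + 2 * pi * real j / real 3), sin (\<alpha> + 2 * pi * real j / real 3))) (at 0 within {0..1})"
  proof (intro allI impI)
    fix j :: nat assume j: "j < 3"
    have "(\<gamma> j has_vector_derivative \<sigma> *\<^sub>R P j) (at 0 within {0..1})"
      unfolding \<gamma>_def by (auto intro!: derivative_eq_intros)
    then show "\<exists>s>0. (\<gamma> j has_vector_derivative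
      s *\<^sub>R (cos (\<alpha> + 2 * pi * real j / real 3), sin (\<alpha> + 2 * pi * real j / real 3))) (at 0 within {0..1})"
      unfolding dir[OF j] using a_pos[OF j] by blast
  qed
  ultimately show ?thesis
    unfolding equal_angle_meeting_at_def using r
    by (intro exI[of _ "3::nat"] exI[of _ \<gamma>] exI[of _ \<alpha>] exI[of _ r]) simp
qed

end

section \<open>Honeycombs on the torus\<close>
lemma torus_proj_closure_subset:
  "torus_proj b ` closure V \<subseteq> torus b closure_of (torus_proj b ` V)"
  using continuous_map_torus_proj[of b] by (auto simp: continuous_map_eq_image_closure_subset)

text \<open>An open domain does not meet the closures of the others, so a boundary point of one domain is in
  none of them; the other inclusion holds because the closures cover the torus.\<close>
lemma boundary_set_strong_partition:
  assumes "strong_partition b k D"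
  shows "boundary_set b k D = topspace (torus b) - (\<Union>i\<in>{1..k}. D i)"
proof -
  have op: "openin (torus b) (D i)" if "i \<in> {1..k}" for i
    using assms that by (simp add: strong_partition_def partition_of_torus_def)
  have disj: "D i \<inter> D j = {}" if "i \<in> {1..k}" "j \<in> {1..k}" "i \<noteq> j" for i j
    using assms that by (auto simp: strong_partition_def partition_of_torus_def disjoint_family_on_def)
  have cov: "topspace (torus b) = (\<Union>i\<in>{1..k}. torus b closure_of D i)"
    using assms by (simp add: strong_partition_def)
  have fr: "torus b frontier_of D i = torus b closure_of D i - D i" if "i \<in> {1..k}" for i
    using op[OF that] by (simp add: frontier_of_def interior_of_openin)
  have cl: "D j \<inter> torus b closure_of D i = {}" if "i \<in> {1..k}" "j \<in> {1..k}" "i \<noteq> j" for i j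
    using disj[OF that] op[OF that(2)] by (simp add: openin_Int_closure_of_eq_empty Int_commute)
  show ?thesis
  proof (intro equalityI subsetI)
    fix d assume "d \<in> boundary_set b k D"
    then obtain i where i: "i \<in> {1..k}" "d \<in> torus b closure_of D i" "d \<notin> D i"
      using fr by (auto simp: boundary_set_def)
    then show "d \<in> topspace (torus b) - (\<Union>i\<in>{1..k}. D i)"
      using cl cov by blast
  next
    fix d assume "d \<in> topspace (torus b) - (\<Union>i\<in>{1..k}. D i)"
    then show "d \<in> boundary_set b k D"
      unfolding boundary_set_def cov using fr by auto
  qed
qed

text \<open>The lattice of the honeycomb contains the periods of the torus, and the multiples of \<open>W2\<close> by the
  factors \<open>1, ..., k\<close> represent the classes of lattice points modulo the periods.\<close>
locale honeycomb_torus = honeycomb e a for e a +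
  fixes b :: real and k :: nat
  assumes b: "b > 0" and k: "k \<ge> 1"
    and period_lat: "\<exists>m' n'. period b m n = lat m' n'"
    and lat_mod_period: "\<exists>i\<in>{1..k}. \<exists>m' n'. lat m n = lat 0 (int i) + period b m' n'"
    and lat_mod_period_unique: "i \<in> {1..k} \<Longrightarrow> j \<in> {1..k} \<Longrightarrow>
      lat 0 (int i) - lat 0 (int j) = period b m' n' \<Longrightarrow> i = j"
begin

definition tile :: "nat \<Rightarrow> plane set set" where
  "tile i = torus_proj b ` (+) (lat 0 (int i)) ` H"

lemma H_cells:
  assumes "h \<in> H" "h' \<in> H" "h = h' + lat m n"
  shows "m = 0 \<and> n = 0"
proof (rule cells_disjoint)
  show "h \<in> HC"
    using assms(1) closure_H closure_subset by blast
  show "h - lat m n \<in> H"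
    using assms(2,3) by simp
qed

text \<open>Points of two tiles with the same image lie in translates of \<open>H\<close> by lattice vectors, and these are disjoint.\<close>
lemma tile_overlap:
  assumes i: "i \<in> {1..k}" and j: "j \<in> {1..k}" and h: "h \<in> H" "h' \<in> H"
    and eq: "torus_proj b (lat 0 (int i) + h) = torus_proj b (lat 0 (int j) + h')"
  shows "i = j \<and> h = h'"
proof -
  obtain m n where mn: "lat 0 (int j) + h' = lat 0 (int i) + h + period b m n"
    using eq torus_proj_eq_iff by blast
  obtain m' n' where per: "period b m n = lat m' n'"
    using period_lat by blast
  have "h' = h + lat m' (int i - int j + n')"
  proof -
    have "h' = h + (lat 0 (int i) - lat 0 (int j) + lat m' n')"
      using mn per by (simp add: algebra_simps)
    then show ?thesis
      by (simp add: lat_diff lat_add)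
  qed
  then have z: "m' = 0 \<and> int i - int j + n' = 0"
    using H_cells h by blast
  then have "h = h'"
    using \<open>h' = h + lat m' (int i - int j + n')\<close> by simp
  then have "lat 0 (int j) - lat 0 (int i) = period b m n"
    using mn by (simp add: algebra_simps)
  then have "j = i"
    using lat_mod_period_unique i j by blast
  then show ?thesis
    using \<open>h = h'\<close> by simp
qed

lemma embedded_tile: "i \<in> {1..k} \<Longrightarrow> embedded_cell b (lat 0 (int i)) H"
  using b open_H bounded_H tile_overlap by unfold_locales (auto simp: inj_on_def)

lemma lambda1_tile: "i \<in> {1..k} \<Longrightarrow> lambda1_torus b (tile i) = lambda1_plane H"
  using embedded_cell.lambda1_cell[OF embedded_tile] embedded_cell.D_def[OF embedded_tile]
  by (simp add: tile_def)

lemma partition_tile: "partition_of_torus b k tile"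
  unfolding partition_of_torus_def
proof (intro conjI ballI)
  fix i assume "i \<in> {1..k}"
  show "openin (torus b) (tile i)"
    unfolding tile_def by (intro openin_torus_image open_translation open_H)
  have "connected ((+) (lat 0 (int i)) ` H)"
    using convex_H by (intro convex_connected convex_translation)
  then show "connectedin (torus b) (tile i)"
    unfolding tile_def by (intro connectedin_continuous_map_image[OF continuous_map_torus_proj]) simp
  show "tile i \<noteq> {}"
    using center_in_H by (auto simp: tile_def)
next
  show "disjoint_family_on tile {1..k}"
    unfolding disjoint_family_on_def tile_def using tile_overlap by blast
qed

lemma in_some_translate:
  "\<exists>i\<in>{1..k}. \<exists>m' n'. x - lat m n = (x - period b m' n') - lat 0 (int i)"
proof -
  obtain i m' n' where i: "i \<in> {1..k}" and "lat m n = lat 0 (int i) + period b m' n'"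
    using lat_mod_period by blast
  then have "x - lat m n = (x - period b m' n') - lat 0 (int i)"
    by (simp add: algebra_simps)
  with i show ?thesis by blast
qed

lemma strong_tile: "strong_partition b k tile"
  unfolding strong_partition_def
proof (intro conjI equalityI subsetI)
  show "partition_of_torus b k tile"
    by (rule partition_tile)
  fix d assume "d \<in> topspace (torus b)"
  then obtain x where x: "d = torus_proj b x"
    by (auto simp: topspace_torus)
  obtain m n where "x - lat m n \<in> HC"
    using cells_cover by blast
  then obtain i m' n' where i: "i \<in> {1..k}" "(x - period b m' n') - lat 0 (int i) \<in> HC"
    using in_some_translate by metis
  then have "x - period b m' n' \<in> closure ((+) (lat 0 (int i)) ` H)"
    unfolding closure_translation closure_H by (rule_tac image_eqI[rotated]) auto
  then have "torus_proj b (x - period b m' n') \<in> torus b closure_of tile i"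
    unfolding tile_def using torus_proj_closure_subset by blast
  then show "d \<in> (\<Union>i\<in>{1..k}. torus b closure_of tile i)"
    using i(1) x by auto
qed (auto simp: in_closure_of)

lemma vimage_tiles:
  "(\<exists>i\<in>{1..k}. torus_proj b x \<in> tile i) \<longleftrightarrow> (\<exists>m n. x - lat m n \<in> H)"
proof
  assume "\<exists>i\<in>{1..k}. torus_proj b x \<in> tile i"
  then obtain i h where h: "h \<in> H" "torus_proj b (lat 0 (int i) + h) = torus_proj b x"
    by (auto simp: tile_def)
  then obtain m n where "x = lat 0 (int i) + h + period b m n"
    using torus_proj_eq_iff by blast
  moreover obtain m' n' where "period b m n = lat m' n'"
    using period_lat by blast
  ultimately have "x - lat m' (int i + n') = h"
    by (simp add: algebra_simps flip: lat_add[of 0 "int i", simplified])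
  then show "\<exists>m n. x - lat m n \<in> H"
    using h(1) by metis
next
  assume "\<exists>m n. x - lat m n \<in> H"
  then obtain i m' n' where i: "i \<in> {1..k}" "(x - period b m' n') - lat 0 (int i) \<in> H"
    using in_some_translate by metis
  have "x - period b m' n' \<in> (+) (lat 0 (int i)) ` H"
    using i(2) by (rule_tac image_eqI[rotated]) auto
  then have "torus_proj b (x - period b m' n') \<in> tile i"
    unfolding tile_def by (rule imageI)
  then show "\<exists>i\<in>{1..k}. torus_proj b x \<in> tile i"
    using i(1) by auto
qed

lemma vimage_boundary: "torus_proj b -` boundary_set b k tile = graph"
proof -
  have "torus_proj b x \<in> boundary_set b k tile \<longleftrightarrow> x \<in> graph" for x
  proof -
    have "torus_proj b x \<in> boundary_set b k tile \<longleftrightarrow> \<not> (\<exists>i\<in>{1..k}. torus_proj b x \<in> tile i)"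
      unfolding boundary_set_strong_partition[OF strong_tile] topspace_torus by blast
    then show ?thesis
      unfolding vimage_tiles in_graph_iff outside_cells_iff[symmetric] by blast
  qed
  then show ?thesis
    by blast
qed

lemma vimage_vertices: "torus_proj b x \<in> torus_proj b ` vertices \<longleftrightarrow> x \<in> vertices"
proof
  assume "torus_proj b x \<in> torus_proj b ` vertices"
  then obtain v where v: "v \<in> vertices" "torus_proj b v = torus_proj b x"
    by (metis imageE)
  then obtain m n where "x = v + period b m n"
    using torus_proj_eq_iff by blast
  moreover obtain m' n' where "period b m n = lat m' n'"
    using period_lat by blast
  ultimately have x: "x = v + lat m' n'"
    by simp
  from v(1) consider m n where "v = lat m n" | m n where "v = lat m n + P 0"
    unfolding vertices_def by blast
  then show "x \<in> vertices"
  proof cases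
    case 1
    then have "x = lat (m + m') (n + n')"
      using x by (simp add: lat_add)
    then show ?thesis
      unfolding vertices_def by blast
  next
    case 2
    then have "x = lat (m + m') (n + n') + P 0"
      using x by (simp add: algebra_simps flip: lat_add)
    then show ?thesis
      unfolding vertices_def by blast
  qed
qed blast

lemma finite_vertices: "finite (torus_proj b ` vertices)"
proof (rule finite_subset)
  let ?R = "(\<lambda>i. torus_proj b (lat 0 (int i))) ` {1..k} \<union> (\<lambda>i. torus_proj b (lat 0 (int i) + P 0)) ` {1..k}"
  show "finite ?R"
    by simp
  show "torus_proj b ` vertices \<subseteq> ?R"
  proof
    fix d assume "d \<in> torus_proj b ` vertices"
    then obtain v where v: "v \<in> vertices" "d = torus_proj b v"
      by blast
    then have "\<exists>m n. v = lat m n \<or> v = lat m n + P 0"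
      unfolding vertices_def by blast
    then obtain m n where "v = lat m n + 0 \<or> v = lat m n + P 0"
      by auto
    then obtain z where z: "z = 0 \<or> z = P 0" "d = torus_proj b (lat m n + z)"
      using v(2) by blast
    obtain i m' n' where i: "i \<in> {1..k}" "lat m n = lat 0 (int i) + period b m' n'"
      using lat_mod_period by blast
    have "lat m n + z = (lat 0 (int i) + z) + period b m' n'"
      using i(2) by simp
    then have "d = torus_proj b (lat 0 (int i) + z)"
      unfolding z(2) by (simp only: torus_proj_period)
    then show "d \<in> ?R"
      using z(1) i(1) by auto
  qed
qed

lemma hexagonal_tiling_tile:
  assumes "\<And>j. j < 3 \<Longrightarrow> e j = (cos (\<theta> + 2 * pi * real j / 3), sin (\<theta> + 2 * pi * real j / 3))"
  shows "hexagonal_tiling b k tile H"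
  unfolding hexagonal_tiling_def
proof (intro conjI ballI)
  show "regular_partition b k tile"
    unfolding regular_partition_def vimage_boundary
  proof (intro exI[of _ "torus_proj b ` vertices"] conjI allI impI)
    show "torus_proj b ` vertices \<subseteq> boundary_set b k tile"
      using vertices_subset_graph vimage_boundary by blast
    show "regular_curve_near graph x" if "torus_proj b x \<in> boundary_set b k tile - torus_proj b ` vertices" for x
      using that vimage_boundary vimage_vertices[of x] by (intro regular_curve_off_vertices) auto
    show "equal_angle_meeting_at graph x" if "torus_proj b x \<in> torus_proj b ` vertices" for x
      using that vimage_vertices[of x] by (intro equal_angle_at_vertices[of \<theta>] assms) auto
  qed (rule finite_vertices)
  fix i assume i: "i \<in> {1..k}"
  show "\<exists>f. (\<forall>x y. dist (f x) (f y) = dist x y) \<and> inj_on (torus_proj b) (f ` H) \<and>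
      tile i = torus_proj b ` f ` H"
    using embedded_cell.inj[OF embedded_tile[OF i]]
    by (intro exI[of _ "(+) (lat 0 (int i))"]) (simp add: tile_def)
qed (rule strong_tile open_hexagon_H)+

lemma minimal_energy_le_hexagon: "minimal_energy k b \<le> lambda1_plane H"
  using k partition_tile lambda1_tile by (intro minimal_energy_le) auto

end

section \<open>The Fermat point and the choice of the lattice\<close>
definition direction :: "real \<Rightarrow> nat \<Rightarrow> plane" where
  "direction \<theta> j = (cos (\<theta> + 2 * pi * real j / 3), sin (\<theta> + 2 * pi * real j / 3))"

lemma direction_simps:
  "direction \<theta> 0 = (cos \<theta>, sin \<theta>)"
  "direction \<theta> 1 = (- cos \<theta> / 2 - sqrt 3 * sin \<theta> / 2, sqrt 3 * cos \<theta> / 2 - sin \<theta> / 2)"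
  "direction \<theta> 2 = (- cos \<theta> / 2 + sqrt 3 * sin \<theta> / 2, - sqrt 3 * cos \<theta> / 2 - sin \<theta> / 2)"
proof -
  have trig: "cos (2 * pi / 3) = - 1 / 2" "sin (2 * pi / 3) = sqrt 3 / 2"
    by (simp_all add: cos_120 sin_120)
  have "direction \<theta> 1 = (cos (\<theta> + 2 * pi / 3), sin (\<theta> + 2 * pi / 3))"
    by (simp add: direction_def)
  then show "direction \<theta> 1 = (- cos \<theta> / 2 - sqrt 3 * sin \<theta> / 2, sqrt 3 * cos \<theta> / 2 - sin \<theta> / 2)"
    unfolding cos_add sin_add trig by (simp add: algebra_simps)
  have trig2: "cos (2 * (2 * pi / 3)) = - 1 / 2" "sin (2 * (2 * pi / 3)) = - sqrt 3 / 2"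
    unfolding cos_double_cos sin_double trig by (simp_all add: power2_eq_square)
  have "direction \<theta> 2 = (cos (\<theta> + 2 * (2 * pi / 3)), sin (\<theta> + 2 * (2 * pi / 3)))"
    by (simp add: direction_def)
  then show "direction \<theta> 2 = (- cos \<theta> / 2 + sqrt 3 * sin \<theta> / 2, - sqrt 3 * cos \<theta> / 2 - sin \<theta> / 2)"
    unfolding cos_add sin_add trig2 by (simp add: algebra_simps)
qed (simp add: direction_def)

lemma honeycomb_direction:
  assumes "\<And>j. j < 3 \<Longrightarrow> a j > 0"
  shows "honeycomb (direction \<theta>) a"
proof
  show "direction \<theta> 0 + direction \<theta> 1 + direction \<theta> 2 = 0"
    unfolding direction_simps by (simp add: zero_prod_def)
  have "cross (direction \<theta> 0) (direction \<theta> 2) = - (sqrt 3 / 2) * ((sin \<theta>)\<^sup>2 + (cos \<theta>)\<^sup>2)"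
    unfolding direction_simps cross_def fst_conv snd_conv power2_eq_square by algebra
  also have "\<dots> = - (sqrt 3 / 2)"
    by (simp only: sin_cos_squared_add mult_1_right)
  finally show "cross (direction \<theta> 0) (direction \<theta> 2) \<noteq> 0"
    by simp
qed (rule assms)

text \<open>Let \<open>P0\<close>, \<open>P1\<close>, \<open>P2\<close> be a triangle with the sides \<open>P0 - P1 = (x1, y1)\<close> and \<open>P2 - P1 = (x2, y2)\<close>. The
  number \<open>c\<close> is twice its area, and the cotangents of its angles are the scalar products of pairs of
  sides divided by \<open>c\<close>. The three hypotheses on these quotients therefore say that the angles are less than
  \<open>2 * pi/3\<close>. The Fermat point is the origin of the directions obtained.\<close>
lemma fermat_point:
  fixes x1 y1 x2 y2 :: real
  defines "d \<equiv> x1 * x2 + y1 * y2" and "c \<equiv> x2 * y1 - x1 * y2"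
  assumes "c > 0" and "sqrt 3 * d > - c" and "sqrt 3 * (x1\<^sup>2 + y1\<^sup>2 - d) > - c" and "sqrt 3 * (x2\<^sup>2 + y2\<^sup>2 - d) > - c"
  shows "\<exists>\<theta> (a :: nat \<Rightarrow> real). (\<forall>j<3. a j > 0) \<and>
    a 0 *\<^sub>R direction \<theta> 0 - a 1 *\<^sub>R direction \<theta> 1 = (x1, y1) \<and>
    a 2 *\<^sub>R direction \<theta> 2 - a 1 *\<^sub>R direction \<theta> 1 = (x2, y2)"
proof -
  define r where "r = sqrt (3::real)"
  have r: "r > 0" "r * r = 3"
    by (simp_all add: r_def)
  \<comment> \<open>The numbers \<open>A0\<close>, \<open>A1\<close>, \<open>A2\<close> turn out to be the lengths \<open>a j\<close> multiplied by their sum \<open>S\<close>.\<close>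
  define A0 where "A0 = (c + r * (x1\<^sup>2 + y1\<^sup>2 - d)) / r"
  define A1 where "A1 = (c + r * d) / r"
  define A2 where "A2 = (c + r * (x2\<^sup>2 + y2\<^sup>2 - d)) / r"
  have A: "A0 > 0" "A1 > 0" "A2 > 0"
    using assms(3-6) r(1) by (simp_all add: A0_def A1_def A2_def r_def add_pos_pos)
  have rr: "r * (r * z) = 3 * z" for z
    using r(2) by (simp flip: mult.assoc)
  have A': "A0 = c * r / 3 + (x1\<^sup>2 + y1\<^sup>2 - d)" "A1 = c * r / 3 + d" "A2 = c * r / 3 + (x2\<^sup>2 + y2\<^sup>2 - d)"
    using r by (simp_all add: A0_def A1_def A2_def field_simps)
  \<comment> \<open>The vector \<open>(X, Y)\<close> is \<open>(x1, y1)\<close> plus \<open>(x2, y2)\<close> rotated by \<open>2 * pi/3\<close>. As this rotation maps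
    \<open>e 0\<close> to \<open>e 1\<close> and \<open>e 2\<close> to \<open>e 0\<close>, the sum must be \<open>(a 0 + a 1 + a 2) *\<^sub>R e 0\<close>.\<close>
  define X where "X = x1 - x2 / 2 - r * y2 / 2"
  define Y where "Y = y1 + r * x2 / 2 - y2 / 2"
  have XY: "X\<^sup>2 + Y\<^sup>2 = A0 + A1 + A2"
    unfolding A' X_def Y_def c_def d_def by (simp add: power2_eq_square field_simps r(2) rr)
  define S where "S = sqrt (A0 + A1 + A2)"
  have S: "S > 0" "S * S = A0 + A1 + A2"
    using A by (simp_all add: S_def)
  have "(X / S)\<^sup>2 + (Y / S)\<^sup>2 = 1"
    using S XY A by (simp add: power_divide power2_eq_square flip: add_divide_distrib)
  then obtain \<theta> where \<theta>: "X / S = cos \<theta>" "Y / S = sin \<theta>"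
    using sincos_total_2pi by metis
  define a where "a = (\<lambda>j::nat. if j = 0 then A0 / S else if j = 1 then A1 / S else A2 / S)"
  have X: "X = S * cos \<theta>" and Y: "Y = S * sin \<theta>"
    using \<theta> S(1) by (simp_all add: field_simps)
  show ?thesis
  proof (intro exI[of _ \<theta>] exI[of _ a] conjI allI impI)
    show "a j > 0" if "j < 3" for j
      using A S(1) by (simp add: a_def)
    define e where "e = direction \<theta>"
    have e0: "S *\<^sub>R e 0 = (X, Y)"
      unfolding e_def direction_simps X Y by simp
    have e1: "S *\<^sub>R e 1 = (- X / 2 - r * Y / 2, r * X / 2 - Y / 2)"
      unfolding e_def direction_simps X Y r_def by (simp add: algebra_simps)
    have e2: "S *\<^sub>R e 2 = (- X / 2 + r * Y / 2, - r * X / 2 - Y / 2)"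
      unfolding e_def direction_simps X Y r_def by (simp add: algebra_simps)
    have "(S * S) *\<^sub>R (a 0 *\<^sub>R e 0 - a 1 *\<^sub>R e 1) = A0 *\<^sub>R (S *\<^sub>R e 0) - A1 *\<^sub>R (S *\<^sub>R e 1)"
      using S(1) by (simp add: a_def algebra_simps)
    also have "\<dots> = (S * S) *\<^sub>R (x1, y1)"
    proof -
      have "A0 * X - A1 * (- X / 2 - r * Y / 2) = (A0 + A1 + A2) * x1"
        unfolding A' X_def Y_def c_def d_def by (simp add: power2_eq_square field_simps r(2) rr)
      moreover have "A0 * Y - A1 * (r * X / 2 - Y / 2) = (A0 + A1 + A2) * y1"
        unfolding A' X_def Y_def c_def d_def by (simp add: power2_eq_square field_simps r(2) rr)
      ultimately show ?thesis
        unfolding e0 e1 S(2) by simp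
    qed
    finally show "a 0 *\<^sub>R direction \<theta> 0 - a 1 *\<^sub>R direction \<theta> 1 = (x1, y1)"
      using S(1) by (simp add: e_def del: scaleR_Pair)
    have "(S * S) *\<^sub>R (a 2 *\<^sub>R e 2 - a 1 *\<^sub>R e 1) = A2 *\<^sub>R (S *\<^sub>R e 2) - A1 *\<^sub>R (S *\<^sub>R e 1)"
      using S(1) by (simp add: a_def algebra_simps)
    also have "\<dots> = (S * S) *\<^sub>R (x2, y2)"
    proof -
      have "A2 * (- X / 2 + r * Y / 2) - A1 * (- X / 2 - r * Y / 2) = (A0 + A1 + A2) * x2"
        unfolding A' X_def Y_def c_def d_def by (simp add: power2_eq_square field_simps r(2) rr)
      moreover have "A2 * (- r * X / 2 - Y / 2) - A1 * (r * X / 2 - Y / 2) = (A0 + A1 + A2) * y2"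
        unfolding A' X_def Y_def c_def d_def by (simp add: power2_eq_square field_simps r(2) rr)
      ultimately show ?thesis
        unfolding e1 e2 S(2) by simp
    qed
    finally show "a 2 *\<^sub>R direction \<theta> 2 - a 1 *\<^sub>R direction \<theta> 1 = (x2, y2)"
      using S(1) by (simp add: e_def del: scaleR_Pair)
  qed
qed

text \<open>The lattice generated by \<open>W1 = (-1/k, q * b/k)\<close> and \<open>W2 = (1/k, p * b/k)\<close> contains the periods, since
  \<open>W1 + W2 = (0, b)\<close> and \<open>q * W2 - p * W1 = (1, 0)\<close>. The hypothesis \<open>obtuse\<close> says that the angle between
  \<open>W1\<close> and \<open>W2\<close> is less than \<open>2 * pi/3\<close>; the hypotheses \<open>acute\<close> and \<open>p \<le> q\<close> make the other two angles of
  the triangle at most \<open>pi/2\<close>.\<close>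
lemma hexagonal_tiling_exists:
  fixes b :: real and k p q :: nat
  assumes b: "0 < b" and p: "1 \<le> p" "p \<le> q" and k: "k = p + q"
    and obtuse: "sqrt 3 * (real p * real q * b\<^sup>2 - 1) + real k * b > 0"
    and acute: "real p * (real q - real p) * b\<^sup>2 \<le> 2"
  shows "\<exists>D H. hexagonal_tiling b k D H \<and> minimal_energy k b \<le> lambda1_plane H"
proof -
  have k0: "real k > 0" and pq: "real p > 0" "real q > 0" "real p \<le> real q" "real k = real p + real q"
    using p k by auto
  define x1 where "x1 = - 1 / real k"
  define y1 where "y1 = real q * b / real k"
  define x2 where "x2 = 1 / real k"
  define y2 where "y2 = real p * b / real k"
  define d where "d = x1 * x2 + y1 * y2"
  define c where "c = x2 * y1 - x1 * y2"
  have c: "c = b / k"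
  proof -
    have "c = (real p + real q) * b / (real k * real k)"
      by (simp add: c_def x1_def x2_def y1_def y2_def algebra_simps flip: add_divide_distrib)
    then show ?thesis
      using k0 unfolding pq(4)[symmetric] by simp
  qed
  have kk: "(real k)\<^sup>2 > 0"
    using k0 by simp
  have d: "d = (real p * real q * b\<^sup>2 - 1) / (real k)\<^sup>2"
    by (simp add: d_def x1_def x2_def y1_def y2_def diff_divide_distrib power2_eq_square)
  have d0: "x1\<^sup>2 + y1\<^sup>2 - d = (2 + real q * (real q - real p) * b\<^sup>2) / (real k)\<^sup>2"
    by (simp add: d x1_def y1_def power_divide power_mult_distrib algebra_simps power2_eq_square
        flip: add_divide_distrib diff_divide_distrib)
  have d2: "x2\<^sup>2 + y2\<^sup>2 - d = (2 - real p * (real q - real p) * b\<^sup>2) / (real k)\<^sup>2"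
    by (simp add: d x2_def y2_def power_divide power_mult_distrib algebra_simps power2_eq_square
        flip: add_divide_distrib diff_divide_distrib)
  have c_pos: "c > 0"
    using b k0 by (simp add: c)
  have "(sqrt 3 * d + c) * (real k)\<^sup>2 > 0"
  proof -
    have "(sqrt 3 * d + c) * (real k)\<^sup>2 = sqrt 3 * (real p * real q * b\<^sup>2 - 1) + real k * b"
      using k0 by (simp add: d c field_simps power2_eq_square)
    then show ?thesis
      using obtuse by simp
  qed
  then have "sqrt 3 * d > - c"
    using kk by (simp add: zero_less_mult_iff)
  moreover have "sqrt 3 * (x1\<^sup>2 + y1\<^sup>2 - d) > - c"
  proof -
    have "0 \<le> x1\<^sup>2 + y1\<^sup>2 - d"
      unfolding d0 using pq by simp
    then have "0 \<le> sqrt 3 * (x1\<^sup>2 + y1\<^sup>2 - d)"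
      by simp
    then show ?thesis
      using c_pos by linarith
  qed
  moreover have "sqrt 3 * (x2\<^sup>2 + y2\<^sup>2 - d) > - c"
  proof -
    have "0 \<le> x2\<^sup>2 + y2\<^sup>2 - d"
      unfolding d2 using acute by simp
    then have "0 \<le> sqrt 3 * (x2\<^sup>2 + y2\<^sup>2 - d)"
      by simp
    then show ?thesis
      using c_pos by linarith
  qed
  ultimately obtain \<theta> and a :: "nat \<Rightarrow> real" where a: "\<forall>j<3. a j > 0"
    and W: "a 0 *\<^sub>R direction \<theta> 0 - a 1 *\<^sub>R direction \<theta> 1 = (x1, y1)"
      "a 2 *\<^sub>R direction \<theta> 2 - a 1 *\<^sub>R direction \<theta> 1 = (x2, y2)"
    using fermat_point[where ?x1.0 = x1 and ?x2.0 = x2 and ?y1.0 = y1 and ?y2.0 = y2] c_pos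
    unfolding c_def d_def by blast
  interpret honeycomb "direction \<theta>" a
    using a by (intro honeycomb_direction) blast
  have WW: "W1 = (x1, y1)" "W2 = (x2, y2)"
    using W by (simp_all only: W1_def W2_def P_def)
  have lat_eq: "lat m n = (of_int (n - m) / real k, of_int (m * int q + n * int p) * b / real k)" for m n
    by (simp add: lat_def WW x1_def x2_def y1_def y2_def add_divide_distrib diff_divide_distrib algebra_simps)
  have period_eq_lat: "period b m n = lat (n - m * int p) (n + m * int q)" for m n
  proof -
    have "(n + m * int q) - (n - m * int p) = m * int k"
      "(n - m * int p) * int q + (n + m * int q) * int p = n * int k"
      using k by (simp_all add: algebra_simps)
    then show ?thesis
      unfolding lat_eq period_def using k0 by simp
  qed
  interpret honeycomb_torus "direction \<theta>" a b k
  proof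
    show "b > 0" by fact
    show "k \<ge> 1" using p k by simp
    show "\<exists>m' n'. period b m n = lat m' n'" for m n
      using period_eq_lat by blast
    show "\<exists>i\<in>{1..k}. \<exists>m' n'. lat m n = lat 0 (int i) + period b m' n'" for m n
    proof -
      \<comment> \<open>The shift by \<open>1\<close> makes the remainder range over \<open>1, ..., k\<close> instead of \<open>0, ..., k - 1\<close>.\<close>
      define M where "M = (n - m - 1) div int k"
      define i where "i = nat ((n - m - 1) mod int k + 1)"
      have k1: "int k > 0"
        using p k by simp
      have "0 \<le> (n - m - 1) mod int k" "(n - m - 1) mod int k < int k"
        using k1 by simp_all
      then have i: "i \<in> {1..k}" "int i = (n - m - 1) mod int k + 1"
        unfolding i_def by auto
      have n: "n = m + int i + M * int k"
        using div_mult_mod_eq[of "n - m - 1" "int k"] by (simp add: i(2) M_def)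
      have "lat m n - lat 0 (int i) = period b M (m + M * int p)"
        unfolding period_eq_lat lat_diff lat_eq_iff using n k by (simp add: algebra_simps)
      then have "lat m n = lat 0 (int i) + period b M (m + M * int p)"
        by (simp add: algebra_simps)
      with i(1) show ?thesis by blast
    qed
    show "i = j" if ij: "i \<in> {1..k}" "j \<in> {1..k}" and eq: "lat 0 (int i) - lat 0 (int j) = period b m n" for i j m n
    proof -
      have "0 = n - m * int p" "int i - int j = n + m * int q"
        using eq unfolding period_eq_lat lat_diff lat_eq_iff by auto
      then have *: "int i - int j = m * int k"
        using k by (simp add: algebra_simps)
      have "\<bar>m * int k\<bar> < int k"
        unfolding *[symmetric] using ij by auto
      then have "m = 0"
        by (simp add: abs_mult mult_less_cancel_right2)
      then show "i = j"
        using * by simp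
    qed
  qed
  have "hexagonal_tiling b k tile H"
    by (rule hexagonal_tiling_tile) (simp add: direction_def)
  then show ?thesis
    using minimal_energy_le_hexagon by blast
qed

text \<open>In each of the three cases the bound on \<open>b\<close> is the positive root of the quadratic polynomial in the conclusion.\<close>
lemma obtuse_condition_3:
  assumes "b > (sqrt 11 - sqrt 3) / 4"
  shows "sqrt 3 * (2 * b\<^sup>2 - 1) + 3 * b > (0::real)"
proof -
  have "(sqrt 11)\<^sup>2 < (4 * b + sqrt 3)\<^sup>2"
    using assms by (intro power_strict_mono) auto
  then have "0 < 2 * b\<^sup>2 - 1 + sqrt 3 * b"
    by (simp add: power2_sum power_mult_distrib algebra_simps)
  then have "0 < sqrt 3 * (2 * b\<^sup>2 - 1 + sqrt 3 * b)"
    by simp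
  also have "\<dots> = sqrt 3 * (2 * b\<^sup>2 - 1) + sqrt 3 * sqrt 3 * b"
    by (simp only: algebra_simps)
  finally show ?thesis
    by simp
qed

lemma obtuse_condition_4:
  assumes "b > 1 / (2 * sqrt 3)"
  shows "sqrt 3 * (4 * b\<^sup>2 - 1) + 4 * b > (0::real)"
proof -
  have s: "sqrt 3 > 0" "sqrt 3 * sqrt 3 = (3::real)"
    by simp_all
  have "1 < b * (2 * sqrt 3)"
    using assms by (simp add: divide_less_eq)
  then have "0 < (2 * sqrt 3 * b - 1) * (2 * sqrt 3 * b + 3)"
    by (intro mult_pos_pos) (simp_all add: mult.commute mult.left_commute)
  also have "\<dots> = 4 * (sqrt 3 * sqrt 3) * b\<^sup>2 + 4 * sqrt 3 * b - 3"
    by (simp only: algebra_simps power2_eq_square)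
  also have "\<dots> = sqrt 3 * (sqrt 3 * (4 * b\<^sup>2 - 1) + 4 * b)"
    by (simp add: right_diff_distrib distrib_left flip: mult.assoc)
  finally show ?thesis
    using s(1) by (simp only: zero_less_mult_pos)
qed

lemma obtuse_condition_5:
  assumes "b > (sqrt 291 - 5 * sqrt 3) / 36"
  shows "sqrt 3 * (6 * b\<^sup>2 - 1) + 5 * b > (0::real)"
proof -
  have "(sqrt 291)\<^sup>2 < (36 * b + 5 * sqrt 3)\<^sup>2"
    using assms by (intro power_strict_mono) auto
  then have "0 < 18 * b\<^sup>2 - 3 + 5 * sqrt 3 * b"
    by (simp add: power2_sum power_mult_distrib algebra_simps)
  then have "0 < sqrt 3 * (18 * b\<^sup>2 - 3 + 5 * sqrt 3 * b)"
    by simp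
  also have "\<dots> = 3 * (sqrt 3 * (6 * b\<^sup>2 - 1)) + 5 * (sqrt 3 * sqrt 3) * b"
    by (simp only: algebra_simps)
  finally show ?thesis
    by simp
qed

theorem theorem1p10:
  shows "\<exists>bH :: nat \<Rightarrow> real.
    bH 3 = (sqrt 11 - sqrt 3) / 4 \<and>
    bH 4 = 1 / (2 * sqrt 3) \<and> bH 4 < 1 / 2 \<and>
    bH 5 = (sqrt 291 - 5 * sqrt 3) / 36 \<and>
    (\<forall>k\<in>{3, 4, 5}. bH k \<in> {0<..<1} \<and>
       (\<forall>b\<in>{bH k<..1}. \<exists>D H. hexagonal_tiling b k D H \<and>
          minimal_energy k b \<le> min ((real k)\<^sup>2 * pi\<^sup>2) (lambda1_plane H)))"
proof -
  define bH :: "nat \<Rightarrow> real" where "bH k = (if k = 3 then (sqrt 11 - sqrt 3) / 4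
    else if k = 4 then 1 / (2 * sqrt 3) else (sqrt 291 - 5 * sqrt 3) / 36)" for k
  have bH: "bH 3 = (sqrt 11 - sqrt 3) / 4" "bH 4 = 1 / (2 * sqrt 3)" "bH 5 = (sqrt 291 - 5 * sqrt 3) / 36"
    by (simp_all add: bH_def)
  have s3: "1 < sqrt (3::real)"
    by simp
  have "sqrt 11 < sqrt (16::real)" "sqrt 291 < sqrt (324::real)" "sqrt 3 < sqrt (11::real)" "sqrt 75 < sqrt (291::real)"
    by (simp_all only: real_sqrt_less_iff)
  moreover have "sqrt 16 = (4::real)" "sqrt 324 = (18::real)" "sqrt 75 = 5 * sqrt (3::real)"
    by (simp_all add: real_sqrt_unique real_sqrt_mult[of 25 3, simplified])
  ultimately have s: "sqrt 11 < (4::real)" "sqrt 291 < (18::real)" "sqrt 3 < sqrt (11::real)" "5 * sqrt 3 < sqrt (291::real)"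
    by simp_all
  have between: "0 < (u - v) / c \<and> (u - v) / c < 1" if "v < u" "u < c" "0 < v" for u v c :: real
    using that by simp
  have "0 < bH 3 \<and> bH 3 < 1"
    unfolding bH by (rule between[OF s(3,1)]) simp
  moreover have "0 < bH 5 \<and> bH 5 < 1"
    unfolding bH by (rule between[OF s(4)]) (use s(2) in simp_all)
  ultimately have range: "bH 3 \<in> {0<..<1}" "bH 5 \<in> {0<..<1}"
    by simp_all
  have b4: "0 < bH 4" "bH 4 < 1 / 2"
    unfolding bH using s3 by (simp_all add: field_simps)
  have ex: "\<exists>D H. hexagonal_tiling b k D H \<and>
      minimal_energy k b \<le> min ((real k)\<^sup>2 * pi\<^sup>2) (lambda1_plane H)"
    if k: "k \<in> {3, 4, 5}" and b: "b \<in> {bH k<..1}" for k b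
  proof -
    have bpos: "0 < b"
      using k b range b4 by auto
    have "b\<^sup>2 \<le> 1"
      using b bpos by (simp add: power_le_one)
    have "\<exists>p q. 1 \<le> p \<and> p \<le> q \<and> k = p + q \<and>
        sqrt 3 * (real p * real q * b\<^sup>2 - 1) + real k * b > 0 \<and> real p * (real q - real p) * b\<^sup>2 \<le> 2"
      using k
    proof (elim insertE emptyE)
      assume "k = 3"
      then show ?thesis
        using obtuse_condition_3[of b] b bH \<open>b\<^sup>2 \<le> 1\<close> by (intro exI[of _ 1] exI[of _ 2]) simp
    next
      assume "k = 4"
      then show ?thesis
        using obtuse_condition_4[of b] b bH by (intro exI[of _ 2] exI[of _ 2]) simp
    next
      assume "k = 5"
      then show ?thesis
        using obtuse_condition_5[of b] b bH \<open>b\<^sup>2 \<le> 1\<close> by (intro exI[of _ 2] exI[of _ 3]) simp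
    qed
    then obtain D H where "hexagonal_tiling b k D H" "minimal_energy k b \<le> lambda1_plane H"
      using hexagonal_tiling_exists[OF bpos] by blast
    moreover have "minimal_energy k b \<le> (real k)\<^sup>2 * pi\<^sup>2"
      using k by (intro minimal_energy_le_strips[OF bpos]) auto
    ultimately show ?thesis
      by (metis min.bounded_iff)
  qed
  show ?thesis
  proof (intro exI[of _ bH] conjI ballI bH b4 ex)
    show "bH k \<in> {0<..<1}" if "k \<in> {3, 4, 5}" for k
      using that range b4 by auto
  qed
qed

end
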